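(* Let $V\colon \mathbb R\to\mathbb R$ with $V \in L^1(\mathbb R)$, and for $h>0$ let $P = -h^2\partial_x^2 + V$. Then $$ \|m^{1/2} (P - E-i\varepsilon)^{-1} m^{1/2}\|_{L^2(\mathbb R) \to L^2(\mathbb R)} \le \exp\left(\frac{2 E^{-1/2} \int_{\mathbb R} m }{ h }\right) $$ for any $m \in L^1(\mathbb R)$ such that $|V|\le m$ almost everywhere, and for any real numbers $E,\varepsilon,h$ with $E \ge 2 \varepsilon>0$ and $h>0$.
   Context: $L^2(\mathbb R)$ is the space of complex-valued square-integrable functions on $\mathbb R$. For real-valued $V\in L^1(\mathbb R)$ and $h>0$, $P u= -h^2 u''+Vu$ is regarded as the self-adjoint operator on $L^2(\mathbb R)$ whose domain $\mathcal D$ is the set of all $u \in L^2(\mathbb R)\cap L^\infty(\mathbb R)$ such that $u' \in L^2(\mathbb R)\cap L^\infty(\mathbb R)$ and $Pu \in L^2(\mathbb R)$ (derivatives in the sense of distributions). In particular $P-z\colon\mathcal D\to L^2(\mathbb R)$ is bijective for $z\in\mathbb C\setminus\mathbb R$, and $(P-z)^{-1}$ denotes its inverse. In the weighted operator $m^{1/2}(P-E-i\varepsilon)^{-1}m^{1/2}$, $m^{1/2}$ denotes multiplication by the function $m^{1/2}$; since $m\in L^1$, this operator is defined on the dense subspace $L^2(\mathbb R)\cap L^\infty(\mathbb R)$ of $L^2(\mathbb R)$ (for such $v$ one has $m^{1/2}v\in L^2$), and the norm bound means that $\|m^{1/2}(P-E-i\varepsilon)^{-1}m^{1/2}v\|_{L^2}\le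 C\|v\|_{L^2}$ for all such $v$, with $C$ the stated right-hand side, so that it extends to a bounded operator on $L^2(\mathbb R)$ of norm at most $C$. *)

theory Defs
  imports "HOL-Analysis.Analysis"
begin

text \<open>
  Elements of \<open>L\<^sup>2(\<real>)\<close> and \<open>L\<^sup>\<infinity>(\<real>)\<close> are represented by Lebesgue measurable functions, with
  equality almost everywhere in place of a quotient.
\<close>

definition L2 :: "(real \<Rightarrow> complex) set" where
  "L2 = {f \<in> borel_measurable lebesgue. integrable lebesgue (\<lambda>x. (cmod (f x))\<^sup>2)}"

definition L2_norm :: "(real \<Rightarrow> complex) \<Rightarrow> real" where
  "L2_norm f = sqrt (LINT x|lebesgue. (cmod (f x))\<^sup>2)"

definition Linfty :: "(real \<Rightarrow> complex) set" where
  "Linfty = {f \<in> borel_measurable lebesgue. \<exists>C. AE x in lebesgue. cmod (f x) \<le> C}"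

text \<open>
  Real-valued test functions are enough: the pairings below are linear in the test function, so an
  identity valid for these is also valid for complex-valued ones.
\<close>

definition test_function :: "(real \<Rightarrow> real) \<Rightarrow> bool" where
  "test_function \<phi> \<longleftrightarrow>
     (\<forall>n. (deriv ^^ n) \<phi> differentiable_on UNIV) \<and> compact (closure {x. \<phi> x \<noteq> 0})"

definition has_distr_deriv :: "(real \<Rightarrow> complex) \<Rightarrow> (real \<Rightarrow> complex) \<Rightarrow> bool" where
  "has_distr_deriv u g \<longleftrightarrow> (\<forall>\<phi>. test_function \<phi> \<longrightarrow>
     - (LINT x|lebesgue. deriv \<phi> x *\<^sub>R u x) = (LINT x|lebesgue. \<phi> x *\<^sub>R g x))"

text \<open>
  The distribution \<open>-h\<^sup>2 u'' + V u\<close> is the function \<open>w\<close>. For \<open>V \<in> L\<^sup>1\<close>, \<open>u \<in> L\<^sup>\<infinity>\<close> and \<open>w \<in> L\<^sup>2\<close>, which is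
  the only case used, every integrand is integrable.
\<close>

definition schroedinger_distr ::
    "real \<Rightarrow> (real \<Rightarrow> real) \<Rightarrow> (real \<Rightarrow> complex) \<Rightarrow> (real \<Rightarrow> complex) \<Rightarrow> bool" where
  "schroedinger_distr h V u w \<longleftrightarrow> (\<forall>\<phi>. test_function \<phi> \<longrightarrow>
     - (h\<^sup>2 *\<^sub>R (LINT x|lebesgue. (deriv ^^ 2) \<phi> x *\<^sub>R u x))
       + (LINT x|lebesgue. \<phi> x *\<^sub>R (V x *\<^sub>R u x))
     = (LINT x|lebesgue. \<phi> x *\<^sub>R w x))"

definition schroedinger_dom :: "real \<Rightarrow> (real \<Rightarrow> real) \<Rightarrow> (real \<Rightarrow> complex) set" where
  "schroedinger_dom h V = {u \<in> L2 \<inter> Linfty.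
     (\<exists>g \<in> L2 \<inter> Linfty. has_distr_deriv u g) \<and> (\<exists>w \<in> L2. schroedinger_distr h V u w)}"

text \<open>
  The choices below select a representative: for \<open>u\<close> in the domain, \<open>schroedinger h V u\<close> is
  determined up to a null set, and so is \<open>resolvent h V z f\<close> for \<open>f \<in> L\<^sup>2\<close> and \<open>z\<close> non-real,
  \<open>P - z\<close> then being a bijection from the domain onto \<open>L\<^sup>2\<close>.
\<close>

definition schroedinger :: "real \<Rightarrow> (real \<Rightarrow> real) \<Rightarrow> (real \<Rightarrow> complex) \<Rightarrow> real \<Rightarrow> complex" where
  "schroedinger h V u = (SOME w. w \<in> L2 \<and> schroedinger_distr h V u w)"

definition resolvent ::
    "real \<Rightarrow> (real \<Rightarrow> real) \<Rightarrow> complex \<Rightarrow> (real \<Rightarrow> complex) \<Rightarrow> real \<Rightarrow> complex" where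
  "resolvent h V z f =
     (SOME u. u \<in> schroedinger_dom h V \<and>
        (AE x in lebesgue. schroedinger h V u x - z * u x = f x))"

definition sqrt_mult :: "(real \<Rightarrow> real) \<Rightarrow> (real \<Rightarrow> complex) \<Rightarrow> real \<Rightarrow> complex" where
  "sqrt_mult m v = (\<lambda>x. sqrt (m x) *\<^sub>R v x)"

text \<open>
  \<open>T\<close>, defined on the dense subspace \<open>L\<^sup>2 \<inter> L\<^sup>\<infinity>\<close>, has \<open>L\<^sup>2\<close> operator norm at most \<open>C\<close>. Membership in \<open>L2\<close>
  is stated separately because \<open>L2_norm\<close> is \<open>0\<close> on functions that are not square integrable.
\<close>

definition L2_opnorm_le :: "((real \<Rightarrow> complex) \<Rightarrow> real \<Rightarrow> complex) \<Rightarrow> real \<Rightarrow> bool" where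
  "L2_opnorm_le T C \<longleftrightarrow> (\<forall>v \<in> L2 \<inter> Linfty. T v \<in> L2 \<and> L2_norm (T v) \<le> C * L2_norm v)"

end

theory Submission
  imports Defs
begin

text \<open>
  Dividing by \<open>h\<^sup>2\<close> one may take \<open>h = 1\<close>. Then \<open>(P - z) u = f\<close> becomes the integral equation
  \<open>u = G(f - V u)\<close>, where \<open>G\<close> is convolution with \<open>- exp(w \<bar>x\<bar>) / (2 w)\<close>, \<open>w\<^sup>2 = - z\<close>, \<open>Re w < 0\<close>.
  The estimate is a pointwise one: \<open>sqrt E sup \<bar>u\<bar> \<le> c(A) \<parallel>f\<parallel>\<close> in terms of the \<open>L\<^sup>1\<close> norm of \<open>f\<close>, with
  \<open>A = \<parallel>V\<parallel> / sqrt E\<close> (again an \<open>L\<^sup>1\<close> norm) and \<open>A c(A) \<le> exp(2 A)\<close>; the weights \<open>m\<^bsup>1/2\<^esup>\<close> turn it into the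
  operator bound by the Cauchy--Schwarz inequality.

  For continuous \<open>V\<close> and \<open>f\<close> the energy \<open>F = \<bar>u'\<bar>\<^sup>2 + E \<bar>u\<bar>\<^sup>2\<close> satisfies
  \<open>\<bar>F'\<bar> \<le> \<bar>V\<bar> F / sqrt E + 2 \<epsilon> \<bar>u\<bar> \<bar>u'\<bar> + 2 \<bar>f\<bar> \<bar>u'\<bar>\<close>. The \<open>\<epsilon>\<close> term is controlled by the identity obtained on
  pairing the equation with \<open>u\<close>, and Gronwall's inequality, applied from both ends of the line, bounds
  \<open>sup F\<close>. The general case follows by density, and the a priori bound yields existence by the
  continuity method in \<open>t V\<close>, \<open>0 \<le> t \<le> 1\<close>.
\<close>

text \<open>With M the integral of m, f = m^(1/2) v obeys ||f||_1 \<le> sqrt(M) ||v||, and ||m^(1/2)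
  u|| \<le> sqrt(M) sup |u|; the weights thus contribute the factor M, and c(A) enters only through
  A c(A).

  The obstacle in bounding F is the \<epsilon> term. The pairing identity controls \<epsilon>
  ||u||^2 by the data, but \<epsilon> ||u'||^2 only up to a multiple of A S^2, where S^2 = sup F.
  Splitting |u| |u'| with the weight exp(A) makes this term harmless: after Gronwall it contributes
  (A/4) exp(-A/2) S^2 \<le> S^2 / (2e), which is absorbed. The price is c(A) of order exp(3A/2),
  still leaving exp(A/2) to spare in A c(A) \<le> exp(2A). A one-sided Gronwall factor exp(A) would
  leave no such room.

  A second obstacle is that the resolvent is a choice among distributional solutions. The bound must
  therefore hold for every solution in the domain, so uniqueness has to be proved weakly, for
  functions known only to be bounded.\<close>

section \<open>Convolution with one-sided exponentials\<close>

lemma integrable_mult_bounded: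
  fixes f g :: "'a \<Rightarrow> 'b :: {banach, second_countable_topology, real_normed_algebra}"
  assumes "integrable M f" "g \<in> borel_measurable M" "\<And>x. norm (g x) \<le> B"
  shows "integrable M (\<lambda>x. g x * f x)"
proof (rule Bochner_Integration.integrable_bound)
  show "integrable M (\<lambda>x. B * norm (f x))" using assms by auto
  show "(\<lambda>x. g x * f x) \<in> borel_measurable M" using assms by measurable
  have "norm (g x * f x) \<le> B * norm (f x)" for x
    by (rule order_trans[OF norm_mult_ineq]) (simp add: assms mult_right_mono)
  then have "norm (g x * f x) \<le> norm (B * norm (f x))" for x
    using abs_ge_self order_trans real_norm_def by metis
  then show "AE x in M. norm (g x * f x) \<le> norm (B * norm (f x))" by simp
qed

text \<open>The fundamental solution of d/dt - w supported on the half-line. The kernel exp(w |x -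
  y|) is this one plus its reflection, so the second-order theory reduces to first-order
  equations.\<close>

definition kexp :: "complex \<Rightarrow> real \<Rightarrow> complex" where
  "kexp w t = (if 0 \<le> t then exp (w * of_real t) else 0)"

lemma kexp_measurable [measurable]: "kexp w \<in> borel_measurable borel"
proof -
  have "kexp w = (\<lambda>t. indicator {0..} t *\<^sub>R exp (w * of_real t))"
    by (auto simp: kexp_def fun_eq_iff)
  moreover have "(\<lambda>t. exp (w * of_real t)) \<in> borel_measurable borel"
    by (intro borel_measurable_continuous_onI continuous_intros)
  ultimately show ?thesis by simp
qed

lemma norm_kexp: "cmod (kexp w t) = (if 0 \<le> t then exp (Re w * t) else 0)"
  by (simp add: kexp_def)

lemma norm_kexp_le_1: "Re w \<le> 0 \<Longrightarrow> cmod (kexp w t) \<le> 1"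
  by (simp add: norm_kexp mult_nonpos_nonneg)

lemma integrable_kexp:
  assumes "Re w < 0"
  shows "integrable lborel (kexp w)"
proof -
  have "((\<lambda>x. exp (-(- Re w) * x)) has_integral exp (-(- Re w) * 0) / (- Re w)) {0..}"
    by (rule has_integral_exp_minus_to_infinity) (use assms in simp)
  then have "(\<lambda>x. exp (Re w * x)) absolutely_integrable_on {0..}"
    by (intro nonnegative_absolutely_integrable_1) (auto simp: integrable_on_def)
  then have "integrable lebesgue (\<lambda>x. indicator {0..} x *\<^sub>R exp (Re w * x))"
    by (simp add: set_integrable_def)
  then have "integrable lborel (\<lambda>x. indicator {0..} x *\<^sub>R exp (Re w * x))"
    by (subst (asm) integrable_completion) auto
  then show ?thesis
    by (rule Bochner_Integration.integrable_bound)
      (auto simp: norm_kexp indicator_def)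
qed

lemma kexp_at_top: "Re w < 0 \<Longrightarrow> (kexp w \<longlongrightarrow> 0) at_top"
proof (rule tendsto_norm_zero_cancel)
  assume w: "Re w < 0"
  have "filterlim (\<lambda>x. Re w * x) at_bot at_top"
    using w by (intro filterlim_tendsto_neg_mult_at_bot[OF tendsto_const] filterlim_ident)
  then have "((\<lambda>x. exp (Re w * x)) \<longlongrightarrow> 0) at_top"
    by (rule filterlim_compose[OF exp_at_bot])
  then show "((\<lambda>x. cmod (kexp w x)) \<longlongrightarrow> 0) at_top"
    by (rule Lim_transform_eventually)
      (use eventually_ge_at_top[of "0::real"] in \<open>eventually_elim, simp add: norm_kexp\<close>)
qed

definition fwd :: "complex \<Rightarrow> (real \<Rightarrow> complex) \<Rightarrow> real \<Rightarrow> complex" where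
  "fwd w r x = (LINT y|lborel. kexp w (x - y) * r y)"

definition bwd :: "complex \<Rightarrow> (real \<Rightarrow> complex) \<Rightarrow> real \<Rightarrow> complex" where
  "bwd w r x = (LINT y|lborel. kexp w (y - x) * r y)"

lemma integrable_reflect:
  fixes r :: "real \<Rightarrow> 'a :: {banach, second_countable_topology}"
  shows "integrable lborel r \<Longrightarrow> integrable lborel (\<lambda>y. r (- y))"
  using lborel_integrable_real_affine[of r "-1" 0] by simp

lemma integral_reflect:
  fixes r :: "real \<Rightarrow> 'a :: {banach, second_countable_topology}"
  shows "(LINT y|lborel. r (- y)) = (LINT y|lborel. r y)"
  using lborel_integral_real_affine[of "-1" r 0] by simp

text \<open>Lets each fact be proved for \<open>fwd\<close> and transferred to \<open>bwd\<close> by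
  reflection.\<close>

lemma bwd_eq_fwd: "bwd w r x = fwd w (\<lambda>y. r (- y)) (- x)"
proof -
  have "bwd w r x = (LINT y|lborel. (\<lambda>y. kexp w (y - x) * r y) (- y))"
    unfolding bwd_def by (rule integral_reflect[symmetric])
  moreover have "kexp w (- y - x) = kexp w (- x - y)" for y
    by (rule arg_cong[where f = "kexp w"]) simp
  ultimately show ?thesis by (simp add: fwd_def)
qed

lemma integrable_kexp_mult:
  assumes "Re w \<le> 0" "integrable lborel r"
  shows "integrable lborel (\<lambda>y. kexp w (x - y) * r y)"
  by (rule integrable_mult_bounded[OF assms(2), of _ 1]) (auto simp: norm_kexp_le_1 assms)

lemma norm_fwd_le:
  assumes "Re w \<le> 0" "integrable lborel r"
  shows "cmod (fwd w r x) \<le> (LINT y|lborel. cmod (r y))"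
proof -
  have "cmod (fwd w r x) \<le> (LINT y|lborel. cmod (kexp w (x - y) * r y))"
    unfolding fwd_def by (rule integral_norm_bound)
  also have "\<dots> \<le> (LINT y|lborel. cmod (r y))"
    using assms integrable_kexp_mult[OF assms, of x]
    by (intro integral_mono integrable_norm) (auto simp: norm_mult intro!: mult_left_le_one_le norm_kexp_le_1)
  finally show ?thesis .
qed

lemma fwd_diff:
  assumes "Re w \<le> 0" "integrable lborel r" "integrable lborel s"
  shows "fwd w (\<lambda>y. r y - s y) x = fwd w r x - fwd w s x"
  unfolding fwd_def
  using integrable_kexp_mult[OF assms(1,2)] integrable_kexp_mult[OF assms(1,3)]
  by (simp add: right_diff_distrib)

text \<open>The kernel jumps only at 0, so the integrands converge for every y except y = x, and |r|
  dominates them.\<close>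

lemma continuous_fwd:
  assumes w: "Re w \<le> 0" and r: "integrable lborel r"
  shows "isCont (fwd w r) x"
  unfolding continuous_at_sequentially
proof (intro allI impI)
  fix X :: "nat \<Rightarrow> real" assume X: "X \<longlonglongrightarrow> x"
  have "(\<lambda>n. LINT y|lborel. kexp w (X n - y) * r y) \<longlonglongrightarrow> (LINT y|lborel. kexp w (x - y) * r y)"
  proof (rule integral_dominated_convergence[where w = "\<lambda>y. cmod (r y)"])
    show "integrable lborel (\<lambda>y. cmod (r y))" using r by simp
    have m: "(\<lambda>y. kexp w (x - y) * r y) \<in> borel_measurable lborel" for x
      using integrable_kexp_mult[OF w r, of x] by (rule borel_measurable_integrable)
    show "(\<lambda>y. kexp w (x - y) * r y) \<in> borel_measurable lborel" by (rule m)
    show "(\<lambda>y. kexp w (X n - y) * r y) \<in> borel_measurable lborel" for n by (rule m)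
    show "AE y in lborel. cmod (kexp w (X n - y) * r y) \<le> cmod (r y)" for n
      by (simp add: norm_mult mult_left_le_one_le norm_kexp_le_1 w)
    show "AE y in lborel. (\<lambda>n. kexp w (X n - y) * r y) \<longlonglongrightarrow> kexp w (x - y) * r y"
      using AE_lborel_singleton[of x]
    proof eventually_elim
      case (elim y)
      have X': "(\<lambda>n. X n - y) \<longlonglongrightarrow> x - y" by (intro tendsto_intros X)
      have "(\<lambda>n. kexp w (X n - y)) \<longlonglongrightarrow> kexp w (x - y)"
      proof (cases "y < x")
        case True
        then have "\<forall>\<^sub>F n in sequentially. X n - y > 0"
          by (intro order_tendstoD(1)[OF X']) simp
        then have "\<forall>\<^sub>F n in sequentially. exp (w * of_real (X n - y)) = kexp w (X n - y)"
          by eventually_elim (simp add: kexp_def)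
        moreover have "(\<lambda>n. exp (w * of_real (X n - y))) \<longlonglongrightarrow> exp (w * of_real (x - y))"
          by (intro tendsto_intros X)
        ultimately show ?thesis using True by (auto simp: kexp_def[of w "x - y"] intro: Lim_transform_eventually)
      next
        case False
        then have "\<forall>\<^sub>F n in sequentially. X n - y < 0"
          using elim by (intro order_tendstoD(2)[OF X']) simp
        then have "\<forall>\<^sub>F n in sequentially. kexp w (X n - y) = 0"
          by eventually_elim (simp add: kexp_def)
        then show ?thesis using False elim
          by (auto simp: kexp_def[of w "x - y"] intro: tendsto_eventually)
      qed
      then show ?case by (intro tendsto_intros)
    qed
  qed
  then show "((fwd w r) \<circ> X) \<longlonglongrightarrow> fwd w r x" by (simp add: fwd_def o_def)
qed

lemma tendsto_fwd_at_top:
  assumes w: "Re w < 0" and r: "integrable lborel r"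
  shows "(fwd w r \<longlongrightarrow> 0) at_top"
proof -
  have "((\<lambda>x. LINT y|lborel. kexp w (x - y) * r y) \<longlongrightarrow> (LINT (y::real)|lborel. 0)) at_top"
  proof (rule integral_dominated_convergence_at_top[where w = "\<lambda>y. cmod (r y)"])
    show "(\<lambda>y. kexp w (x - y) * r y) \<in> borel_measurable lborel" for x
      using integrable_kexp_mult[OF _ r, of w] w by auto
    have "((\<lambda>x. kexp w (x - y) * r y) \<longlongrightarrow> 0 * r y) at_top" for y
      by (intro tendsto_intros filterlim_compose[OF kexp_at_top[OF w]])
        (simp add: filterlim_at_top_add_at_top filterlim_tendsto_add_at_top[OF tendsto_const[of "-y"] filterlim_ident, simplified])
    then show "AE y in lborel. ((\<lambda>x. kexp w (x - y) * r y) \<longlongrightarrow> 0) at_top" by simp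
    show "\<forall>\<^sub>F x in at_top. AE y in lborel. cmod (kexp w (x - y) * r y) \<le> cmod (r y)"
      using w by (simp add: norm_mult mult_left_le_one_le norm_kexp_le_1)
  qed (use r in auto)
  then show ?thesis by (simp add: fwd_def[abs_def])
qed

lemma tendsto_fwd_at_bot:
  assumes w: "Re w < 0" and r: "integrable lborel r"
  shows "(fwd w r \<longlongrightarrow> 0) at_bot"
proof -
  have "((\<lambda>x. LINT y|lborel. kexp w (- x - y) * r y) \<longlongrightarrow> (LINT (y::real)|lborel. 0)) at_top"
  proof (rule integral_dominated_convergence_at_top[where w = "\<lambda>y. cmod (r y)"])
    show "(\<lambda>y. kexp w (- x - y) * r y) \<in> borel_measurable lborel" for x
      using integrable_kexp_mult[OF _ r, of w] w by auto
    have "((\<lambda>x. kexp w (- x - y) * r y) \<longlongrightarrow> 0) at_top" for y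
      by (rule tendsto_eventually) (use eventually_gt_at_top[of "-y"] in \<open>eventually_elim, simp add: kexp_def\<close>)
    then show "AE y in lborel. ((\<lambda>x. kexp w (- x - y) * r y) \<longlongrightarrow> 0) at_top" by simp
    show "\<forall>\<^sub>F x in at_top. AE y in lborel. cmod (kexp w (- x - y) * r y) \<le> cmod (r y)"
      using w by (simp add: norm_mult mult_left_le_one_le norm_kexp_le_1)
  qed (use r in auto)
  then show ?thesis by (simp add: fwd_def[abs_def] filterlim_at_bot_mirror)
qed

lemma integrable_kexp_pair:
  assumes w: "Re w < 0" and r: "integrable lborel r"
  shows "integrable (lborel \<Otimes>\<^sub>M lborel) (\<lambda>(y, x). kexp w (x - y) * r y)"
proof (rule lborel_pair.Fubini_integrable)
  have [measurable]: "r \<in> borel_measurable borel" using r by auto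
  show "(\<lambda>(y, x). kexp w (x - y) * r y) \<in> borel_measurable (lborel \<Otimes>\<^sub>M lborel)" by measurable
  have i: "integrable lborel (\<lambda>x. kexp w (x - y))" for y
    using lborel_integrable_real_affine[OF integrable_kexp[OF w], of 1 "-y"] by simp
  have "(LINT x|lborel. cmod (kexp w (x - y))) = (LINT x|lborel. cmod (kexp w x))" for y
    using lborel_integral_real_affine[of 1 "\<lambda>x. cmod (kexp w x)" "-y"] by simp
  then show "integrable lborel (\<lambda>y. LINT x|lborel. cmod (case (y, x) of (y, x) \<Rightarrow> kexp w (x - y) * r y))"
    using r by (simp add: norm_mult)
  show "AE y in lborel. integrable lborel (\<lambda>x. case (y, x) of (y, x) \<Rightarrow> kexp w (x - y) * r y)"
    using i by simp
qed

lemma integrable_fwd: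
  assumes w: "Re w < 0" and r: "integrable lborel r"
  shows "integrable lborel (fwd w r)"
  using lborel_pair.integrable_snd[OF integrable_kexp_pair[OF assms]] by (simp add: fwd_def[abs_def])

text \<open>For x \<ge> y the integrand is the derivative of \<phi>(x) exp(w (x - y)), so only the
  boundary term at x = y survives.\<close>

lemma integral_kexp_test:
  fixes \<phi> \<phi>' :: "real \<Rightarrow> real"
  assumes d: "\<And>x. (\<phi> has_real_derivative \<phi>' x) (at x)" and c: "continuous_on UNIV \<phi>'"
    and s: "\<And>x. R < \<bar>x\<bar> \<Longrightarrow> \<phi> x = 0" "\<And>x. R < \<bar>x\<bar> \<Longrightarrow> \<phi>' x = 0"
  shows "(LINT x|lborel. (of_real (\<phi>' x) + w * of_real (\<phi> x)) * kexp w (x - y)) = - of_real (\<phi> y)"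
proof -
  \<comment> \<open>Beyond both y and the support, so that \<phi>(b) = 0 and nothing is lost by
    integrating only up to b; for y far to the right, b = y and both sides vanish.\<close>
  define b where "b = max y (\<bar>R\<bar> + 1)"
  let ?f = "\<lambda>x. (of_real (\<phi>' x) + w * of_real (\<phi> x)) * exp (w * of_real (x - y))"
  let ?F = "\<lambda>x. of_real (\<phi> x) * exp (w * of_real (x - y))"
  have c0: "continuous_on UNIV \<phi>"
    using d by (meson DERIV_continuous continuous_at_imp_continuous_on)
  have "has_bochner_integral lborel (\<lambda>x. indicator {y..b} x *\<^sub>R ?f x) (?F b - ?F y)"
  proof (rule has_bochner_integral_FTC_Icc)
    show "y \<le> b" by (simp add: b_def)
    show "(?F has_vector_derivative ?f x) (at x within {y..b})" for x
    proof -
      have "((\<lambda>t. complex_of_real (\<phi> t)) has_vector_derivative of_real (\<phi>' x)) (at x)"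
        using d by (simp add: has_vector_derivative_complex_iff)
      moreover have "((\<lambda>t. exp (w * of_real (t - y))) has_vector_derivative w * exp (w * of_real (x - y))) (at x)"
        unfolding of_real_diff
        by (rule has_vector_derivative_real_field[where f = "\<lambda>t. exp (w * (t - of_real y))"])
          (auto intro!: derivative_eq_intros)
      ultimately have "(?F has_vector_derivative (of_real (\<phi> x) * (w * exp (w * of_real (x - y))) + of_real (\<phi>' x) * exp (w * of_real (x - y)))) (at x)"
        by (rule has_vector_derivative_mult)
      then show ?thesis
        by (rule has_vector_derivative_at_within[OF has_vector_derivative_eq_rhs]) (simp add: algebra_simps)
    qed
    show "continuous_on {y..b} ?f"
      by (intro continuous_intros continuous_on_subset[OF c] continuous_on_subset[OF c0]) auto
  qed
  moreover have "(\<lambda>x. indicator {y..b} x *\<^sub>R ?f x) = (\<lambda>x. (of_real (\<phi>' x) + w * of_real (\<phi> x)) * kexp w (x - y))"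
    using s by (auto simp: fun_eq_iff kexp_def indicator_def b_def)
  moreover have "\<phi> b = 0" using s(1)[of b] by (simp add: b_def)
  ultimately show ?thesis by (simp add: has_bochner_integral_integral_eq)
qed

section \<open>The free resolvent\<close>

text \<open>The derivative is an argument rather than \<open>deriv \<phi>\<close>, so that the
  reflected pair and the pair formed by \<open>deriv \<phi>\<close> and its derivative are
  instances.\<close>

definition C1c :: "(real \<Rightarrow> real) \<Rightarrow> (real \<Rightarrow> real) \<Rightarrow> bool" where
  "C1c \<phi> \<phi>' \<longleftrightarrow> (\<forall>x. (\<phi> has_real_derivative \<phi>' x) (at x)) \<and> continuous_on UNIV \<phi>' \<and>
     (\<exists>R. \<forall>x. R < \<bar>x\<bar> \<longrightarrow> \<phi> x = 0 \<and> \<phi>' x = 0)"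

lemma bounded_if_continuous_support:
  fixes f :: "real \<Rightarrow> 'a::real_normed_vector"
  assumes "continuous_on UNIV f" "\<And>x. R < \<bar>x\<bar> \<Longrightarrow> f x = 0"
  obtains B where "\<And>x. norm (f x) \<le> B"
proof -
  have "bounded (f ` {-R..R})"
    by (intro compact_imp_bounded compact_continuous_image continuous_on_subset[OF assms(1)]) auto
  then obtain B where B: "\<And>x. x \<in> {-R..R} \<Longrightarrow> norm (f x) \<le> B"
    unfolding bounded_iff by blast
  have "norm (f x) \<le> max B 0" for x
    using B[of x] assms(2)[of x] by (cases "\<bar>x\<bar> \<le> R") (auto simp: abs_le_iff)
  then show ?thesis by (rule that)
qed

lemma C1c_continuous: "C1c \<phi> \<phi>' \<Longrightarrow> continuous_on UNIV \<phi>"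
  unfolding C1c_def by (meson DERIV_continuous continuous_at_imp_continuous_on)

lemma C1c_bounded:
  assumes "C1c \<phi> \<phi>'"
  obtains B where "\<And>x. \<bar>\<phi> x\<bar> \<le> B" "\<And>x. \<bar>\<phi>' x\<bar> \<le> B"
proof -
  obtain R where R: "\<And>x. R < \<bar>x\<bar> \<Longrightarrow> \<phi> x = 0 \<and> \<phi>' x = 0" using assms by (auto simp: C1c_def)
  obtain B1 where "\<And>x. norm (\<phi> x) \<le> B1"
    using bounded_if_continuous_support[OF C1c_continuous[OF assms], of R] R by metis
  moreover obtain B2 where "\<And>x. norm (\<phi>' x) \<le> B2"
    using bounded_if_continuous_support[of \<phi>' R] R assms unfolding C1c_def by metis
  ultimately show ?thesis using that[of "max B1 B2"] by (simp add: max.coboundedI1 max.coboundedI2)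
qed

lemma C1c_reflect:
  assumes "C1c \<phi> \<phi>'" shows "C1c (\<lambda>x. \<phi> (- x)) (\<lambda>x. - \<phi>' (- x))"
  unfolding C1c_def
proof (intro conjI allI)
  show "((\<lambda>x. \<phi> (- x)) has_real_derivative - \<phi>' (- x)) (at x)" for x
  proof -
    have "(\<phi> has_real_derivative \<phi>' (- x)) (at (- x))" using assms by (simp add: C1c_def)
    then show ?thesis
      by (rule DERIV_chain2[THEN DERIV_cong]) (auto intro!: derivative_eq_intros)
  qed
  show "continuous_on UNIV (\<lambda>x. - \<phi>' (- x))"
    using assms unfolding C1c_def
    by (auto intro!: continuous_on_minus intro: continuous_on_compose2[OF _ continuous_on_minus[OF continuous_on_id]])
  show "\<exists>R. \<forall>x. R < \<bar>x\<bar> \<longrightarrow> \<phi> (- x) = 0 \<and> - \<phi>' (- x) = 0"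
    using assms unfolding C1c_def by (metis abs_minus_cancel neg_equal_0_iff_equal)
qed

lemma integrable_C1c_mult:
  fixes r :: "real \<Rightarrow> complex"
  assumes "C1c \<phi> \<phi>'" "integrable lborel r"
  shows "integrable lborel (\<lambda>x. of_real (\<phi> x) * r x)" "integrable lborel (\<lambda>x. of_real (\<phi>' x) * r x)"
proof -
  obtain B where B: "\<And>x. \<bar>\<phi> x\<bar> \<le> B" "\<And>x. \<bar>\<phi>' x\<bar> \<le> B" using C1c_bounded[OF assms(1)] by blast
  have [measurable]: "\<phi> \<in> borel_measurable borel" "\<phi>' \<in> borel_measurable borel"
    using assms(1) C1c_continuous[OF assms(1)] by (auto simp: C1c_def intro!: borel_measurable_continuous_onI)
  show "integrable lborel (\<lambda>x. of_real (\<phi> x) * r x)" "integrable lborel (\<lambda>x. of_real (\<phi>' x) * r x)"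
    by (rule integrable_mult_bounded[OF assms(2), of _ B]; use B in simp)+
qed

text \<open>The distributional form of y' = w y + r, for r merely integrable. Fubini moves the test
  function onto the kernel, where \<open>integral_kexp_test\<close> evaluates it.\<close>

lemma fwd_weak:
  assumes \<phi>: "C1c \<phi> \<phi>'" and w: "Re w < 0" and r: "integrable lborel r"
  shows "(LINT x|lborel. of_real (\<phi>' x) * fwd w r x) =
    - (LINT x|lborel. of_real (\<phi> x) * r x) - w * (LINT x|lborel. of_real (\<phi> x) * fwd w r x)"
proof -
  obtain B where B: "\<And>x. \<bar>\<phi> x\<bar> \<le> B" "\<And>x. \<bar>\<phi>' x\<bar> \<le> B" using C1c_bounded[OF \<phi>] by blast
  obtain R where R: "\<And>x. R < \<bar>x\<bar> \<Longrightarrow> \<phi> x = 0 \<and> \<phi>' x = 0" using \<phi> by (auto simp: C1c_def)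
  let ?\<psi> = "\<lambda>x. of_real (\<phi>' x) + w * of_real (\<phi> x)"
  have [measurable]: "\<phi> \<in> borel_measurable borel" "\<phi>' \<in> borel_measurable borel"
    using \<phi> C1c_continuous[OF \<phi>] by (auto simp: C1c_def intro!: borel_measurable_continuous_onI)
  have \<psi>B: "cmod (?\<psi> x) \<le> B + cmod w * B" for x
    using B[of x] by (intro norm_triangle_mono) (auto simp: norm_mult intro: mult_left_mono)
  have "integrable (lborel \<Otimes>\<^sub>M lborel) (\<lambda>p. ?\<psi> (snd p) * (case p of (y, x) \<Rightarrow> kexp w (x - y) * r y))"
    by (rule integrable_mult_bounded[OF integrable_kexp_pair[OF w r], of _ "B + cmod w * B"])
      (use \<psi>B in auto)
  then have F: "integrable (lborel \<Otimes>\<^sub>M lborel) (\<lambda>(y, x). ?\<psi> x * (kexp w (x - y) * r y))"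
    by (simp add: case_prod_beta')
  have f: "integrable lborel (fwd w r)" by (rule integrable_fwd[OF w r])
  have "(LINT x|lborel. of_real (\<phi>' x) * fwd w r x) + w * (LINT x|lborel. of_real (\<phi> x) * fwd w r x)
    = (LINT x|lborel. ?\<psi> x * fwd w r x)"
    using integrable_C1c_mult[OF \<phi> f] by (simp add: distrib_right mult.assoc)
  also have "\<dots> = (LINT x|lborel. LINT y|lborel. ?\<psi> x * (kexp w (x - y) * r y))"
    by (simp add: fwd_def)
  also have "\<dots> = (LINT y|lborel. LINT x|lborel. ?\<psi> x * (kexp w (x - y) * r y))"
    by (rule lborel_pair.Fubini_integral[OF F])
  also have "\<dots> = (LINT y|lborel. (LINT x|lborel. ?\<psi> x * kexp w (x - y)) * r y)"
    by (simp flip: mult.assoc)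
  also have "\<dots> = (LINT y|lborel. - of_real (\<phi> y) * r y)"
    using \<phi> R by (subst integral_kexp_test[where R = R]) (auto simp: C1c_def)
  finally show ?thesis by (simp add: algebra_simps eq_diff_eq)
qed

lemma bwd_weak:
  assumes \<phi>: "C1c \<phi> \<phi>'" and w: "Re w < 0" and r: "integrable lborel r"
  shows "(LINT x|lborel. of_real (\<phi>' x) * bwd w r x) =
    (LINT x|lborel. of_real (\<phi> x) * r x) + w * (LINT x|lborel. of_real (\<phi> x) * bwd w r x)"
proof -
  have *: "(LINT x|lborel. of_real (\<theta> (- x)) * fwd w (\<lambda>y. r (- y)) x) = (LINT x|lborel. of_real (\<theta> x) * bwd w r x)"
    for \<theta> :: "real \<Rightarrow> real"
    using integral_reflect[of "\<lambda>x. of_real (\<theta> x) * bwd w r x"] by (simp add: bwd_eq_fwd)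
  show ?thesis
    using fwd_weak[OF C1c_reflect[OF \<phi>] w integrable_reflect[OF r]] *[of \<phi>'] *[of \<phi>]
      integral_reflect[of "\<lambda>x. of_real (\<phi> x) * r x"]
    by (simp add: algebra_simps add_eq_0_iff)
qed

lemma fwd_derivative:
  assumes w: "Re w < 0" and r: "integrable lborel r" and c: "continuous_on UNIV r"
  shows "(fwd w r has_vector_derivative w * fwd w r x + r x) (at x)"
proof -
  define a where "a = x - 1"
  let ?g = "\<lambda>y. exp (- w * of_real y) * r y"
  have [measurable]: "r \<in> borel_measurable borel" using r by auto
  have r': "continuous_on S r" for S by (rule continuous_on_subset[OF c]) simp
  have g: "continuous_on S ?g" for S
    by (rule continuous_on_mult[OF _ r']) (intro continuous_intros)
  \<comment> \<open>Duhamel's formula from the base point a: the dependence on t is now through a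
    smooth factor and a primitive, so the fundamental theorem of calculus applies.\<close>
  have *: "fwd w r t = exp (w * of_real t) * (exp (- w * of_real a) * fwd w r a + integral {a..t} ?g)"
    if t: "t \<in> {a<..}" for t
  proof -
    have i: "set_integrable lborel {a..t} ?g"
      by (rule borel_integrable_atLeastAtMost') (rule g)
    have "fwd w r t = (LINT y|lborel. exp (w * of_real (t - a)) * (kexp w (a - y) * r y)
         + exp (w * of_real t) * (indicator {a..t} y *\<^sub>R ?g y))"
      unfolding fwd_def
    proof (rule integral_cong_AE)
      show "AE y in lborel. kexp w (t - y) * r y = exp (w * of_real (t - a)) * (kexp w (a - y) * r y)
         + exp (w * of_real t) * (indicator {a..t} y *\<^sub>R ?g y)"
        using AE_lborel_singleton[of a]
      proof eventually_elim
        case (elim y)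
        have "exp (w * of_real (t - a)) * exp (w * of_real (a - y)) = exp (w * of_real (t - y))"
          unfolding exp_add[symmetric] by (rule arg_cong[where f = exp]) (simp add: algebra_simps)
        moreover have "exp (w * of_real t) * exp (- w * of_real y) = exp (w * of_real (t - y))"
          unfolding exp_add[symmetric] by (rule arg_cong[where f = exp]) (simp add: algebra_simps)
        ultimately show ?case
          using elim t by (cases "y < a"; cases "y \<le> t") (simp_all add: kexp_def mult.assoc[symmetric])
      qed
    qed measurable
    also have "\<dots> = exp (w * of_real (t - a)) * fwd w r a + exp (w * of_real t) * integral {a..t} ?g"
      using integrable_kexp_mult[OF less_imp_le[OF w] r, of a] i set_borel_integral_eq_integral(2)[OF i]
      unfolding fwd_def set_integrable_def set_lebesgue_integral_def
      by (simp only: Bochner_Integration.integral_add integrable_mult_right integral_mult_right_zero)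
    also have "exp (w * of_real (t - a)) = exp (w * of_real t) * exp (- w * of_real a)"
      unfolding exp_add[symmetric] by (rule arg_cong[where f = exp]) (simp add: algebra_simps)
    finally show ?thesis by (simp only: distrib_left mult.assoc)
  qed
  have d1: "((\<lambda>t. integral {a..t} ?g) has_vector_derivative ?g x) (at x)"
  proof -
    have "((\<lambda>t. integral {a..t} ?g) has_vector_derivative ?g x) (at x within {a..x+1})"
      by (rule integral_has_vector_derivative[OF g]) (auto simp: a_def)
    moreover have "at x within {a..x+1} = at x"
      by (rule at_within_interior) (auto simp: a_def)
    ultimately show ?thesis by simp
  qed
  have d2: "((\<lambda>t. exp (w * of_real t)) has_vector_derivative w * exp (w * of_real x)) (at x)"
    by (rule has_vector_derivative_real_field[where f = "\<lambda>t. exp (w * t)"])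
      (auto intro!: derivative_eq_intros)
  have "((\<lambda>t. exp (w * of_real t) * (exp (- w * of_real a) * fwd w r a + integral {a..t} ?g)) has_vector_derivative
     (exp (w * of_real x) * ?g x + (w * exp (w * of_real x)) * (exp (- w * of_real a) * fwd w r a + integral {a..x} ?g))) (at x)"
    by (rule has_vector_derivative_mult[OF d2 has_vector_derivative_add[OF has_vector_derivative_const d1, unfolded add_0]])
  moreover have "exp (w * of_real x) * ?g x = r x" by (simp flip: exp_add mult.assoc)
  moreover have "(w * exp (w * of_real x)) * (exp (- w * of_real a) * fwd w r a + integral {a..x} ?g) = w * fwd w r x"
    by (subst *) (auto simp: a_def)
  ultimately have "((\<lambda>t. exp (w * of_real t) * (exp (- w * of_real a) * fwd w r a + integral {a..t} ?g)) has_vector_derivative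
     w * fwd w r x + r x) (at x)" by (simp only: add.commute[of "r x"])
  then show ?thesis
  proof (rule has_vector_derivative_transform_within_open)
    show "open {a<..}" by simp
    show "x \<in> {a<..}" by (simp add: a_def)
  qed (rule *[symmetric])
qed

lemma bwd_derivative:
  assumes w: "Re w < 0" and r: "integrable lborel r" and c: "continuous_on UNIV r"
  shows "(bwd w r has_vector_derivative - w * bwd w r x - r x) (at x)"
proof -
  have c': "continuous_on UNIV (\<lambda>y. r (- y))"
    by (rule continuous_on_compose2[OF c continuous_on_minus[OF continuous_on_id]]) simp
  have "((fwd w (\<lambda>y. r (- y)) \<circ> uminus) has_vector_derivative (-1) *\<^sub>R (w * fwd w (\<lambda>y. r (- y)) (- x) + r x)) (at x)"
    by (rule vector_diff_chain_at)
      (use fwd_derivative[OF w integrable_reflect[OF r] c', of "-x"] in \<open>auto intro!: derivative_eq_intros\<close>)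
  then show ?thesis by (simp add: bwd_eq_fwd[abs_def] o_def)
qed

definition green :: "complex \<Rightarrow> (real \<Rightarrow> complex) \<Rightarrow> real \<Rightarrow> complex" where
  "green w r x = - ((fwd w r x + bwd w r x) / (2 * w))"

text \<open>The derivative of \<open>green w r\<close>, written with the bounded kernel - sgn(x - y)
  exp(w |x - y|) / 2. It is available for every integrable r, as a weak derivative in general and as
  a classical one for continuous r.\<close>

definition dgreen :: "complex \<Rightarrow> (real \<Rightarrow> complex) \<Rightarrow> real \<Rightarrow> complex" where
  "dgreen w r x = - ((fwd w r x - bwd w r x) / 2)"

context
  fixes w :: complex and r :: "real \<Rightarrow> complex"
  assumes w: "Re w < 0" and r: "integrable lborel r"
begin

lemma w_nz: "w \<noteq> 0" using w by auto

lemma norm_bwd_le: "cmod (bwd w r x) \<le> (LINT y|lborel. cmod (r y))"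
  using norm_fwd_le[OF _ integrable_reflect[OF r], of w "-x"] w integral_reflect[of "\<lambda>x. cmod (r x)"]
  by (simp add: bwd_eq_fwd)

lemma continuous_bwd: "isCont (bwd w r) x"
  unfolding bwd_eq_fwd[abs_def]
  by (rule isCont_o2[OF isCont_minus[OF continuous_ident] continuous_fwd[OF _ integrable_reflect[OF r]]])
    (use w in simp)

lemma integrable_bwd: "integrable lborel (bwd w r)"
  unfolding bwd_eq_fwd[abs_def]
  by (intro integrable_reflect[of "fwd _ _"] integrable_fwd w r integrable_reflect)

lemma tendsto_bwd: "(bwd w r \<longlongrightarrow> 0) at_top" "(bwd w r \<longlongrightarrow> 0) at_bot"
  unfolding bwd_eq_fwd[abs_def]
  by (intro filterlim_compose[OF tendsto_fwd_at_bot[OF w integrable_reflect[OF r]]]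
      filterlim_compose[OF tendsto_fwd_at_top[OF w integrable_reflect[OF r]]]
      filterlim_uminus_at_bot_at_top filterlim_uminus_at_top_at_bot)+

lemma norm_green_le: "cmod (green w r x) \<le> (LINT y|lborel. cmod (r y)) / cmod w"
proof -
  have "cmod (fwd w r x + bwd w r x) \<le> 2 * (LINT y|lborel. cmod (r y))"
    using norm_triangle_ineq[of "fwd w r x" "bwd w r x"] norm_bwd_le[of x] norm_fwd_le[OF _ r, of w x] w by simp
  then show ?thesis using w_nz by (simp add: green_def norm_divide norm_mult field_simps)
qed

lemma norm_dgreen_le: "cmod (dgreen w r x) \<le> (LINT y|lborel. cmod (r y))"
  using norm_triangle_ineq4[of "fwd w r x" "bwd w r x"] norm_bwd_le[of x] norm_fwd_le[OF _ r, of w x] w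
  by (simp add: dgreen_def norm_divide norm_minus_commute)

lemma continuous_green: "continuous_on S (green w r)" "continuous_on S (dgreen w r)"
  unfolding green_def[abs_def] dgreen_def[abs_def]
  using w_nz w by (auto intro!: continuous_intros continuous_at_imp_continuous_on continuous_bwd continuous_fwd r)

lemma integrable_green: "integrable lborel (green w r)" "integrable lborel (dgreen w r)"
  unfolding green_def[abs_def] dgreen_def[abs_def]
  using integrable_bwd integrable_fwd[OF w r] by auto

lemma tendsto_green:
  "(green w r \<longlongrightarrow> 0) at_top" "(green w r \<longlongrightarrow> 0) at_bot"
  "(dgreen w r \<longlongrightarrow> 0) at_top" "(dgreen w r \<longlongrightarrow> 0) at_bot"
  unfolding green_def[abs_def] dgreen_def[abs_def]
  using w_nz tendsto_bwd tendsto_fwd_at_top[OF w r] tendsto_fwd_at_bot[OF w r]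
  by (auto intro!: tendsto_eq_intros)

lemma green_derivative:
  assumes c: "continuous_on UNIV r"
  shows "(green w r has_vector_derivative dgreen w r x) (at x)"
    and "(dgreen w r has_vector_derivative w\<^sup>2 * green w r x - r x) (at x)"
proof -
  note d = fwd_derivative[OF w r c, of x] bwd_derivative[OF w r c, of x]
  have "((\<lambda>x. (- 1 / (2 * w)) * (fwd w r x + bwd w r x)) has_vector_derivative
     (- 1 / (2 * w)) * ((w * fwd w r x + r x) + (- w * bwd w r x - r x))) (at x)"
    by (intro has_vector_derivative_mult_right has_vector_derivative_add d)
  moreover have "(- 1 / (2 * w)) * ((w * fwd w r x + r x) + (- w * bwd w r x - r x)) = dgreen w r x"
    using w_nz by (simp add: dgreen_def field_simps)
  ultimately show "(green w r has_vector_derivative dgreen w r x) (at x)"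
    by (simp add: green_def[abs_def])
  have "((\<lambda>x. (- 1 / 2) * (fwd w r x - bwd w r x)) has_vector_derivative
     (- 1 / 2) * ((w * fwd w r x + r x) - (- w * bwd w r x - r x))) (at x)"
    by (intro has_vector_derivative_mult_right has_vector_derivative_diff d)
  moreover have "(- 1 / 2) * ((w * fwd w r x + r x) - (- w * bwd w r x - r x)) = w\<^sup>2 * green w r x - r x"
    using w_nz by (simp add: green_def field_simps power2_eq_square)
  ultimately show "(dgreen w r has_vector_derivative w\<^sup>2 * green w r x - r x) (at x)"
    by (simp add: dgreen_def[abs_def])
qed

lemma green_weak:
  assumes \<phi>: "C1c \<phi> \<phi>'"
  shows "(LINT x|lborel. of_real (\<phi>' x) * green w r x) = - (LINT x|lborel. of_real (\<phi> x) * dgreen w r x)"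
    and "(LINT x|lborel. of_real (\<phi>' x) * dgreen w r x) =
      (LINT x|lborel. of_real (\<phi> x) * r x) - w\<^sup>2 * (LINT x|lborel. of_real (\<phi> x) * green w r x)"
proof -
  note i = integrable_C1c_mult[OF \<phi> integrable_fwd[OF w r]] integrable_C1c_mult[OF \<phi> integrable_bwd]
  have g: "(LINT x|lborel. of_real (\<theta> x) * green w r x) = (- 1 / (2 * w)) *
      ((LINT x|lborel. of_real (\<theta> x) * fwd w r x) + (LINT x|lborel. of_real (\<theta> x) * bwd w r x))"
    and dg: "(LINT x|lborel. of_real (\<theta> x) * dgreen w r x) = (- 1 / 2) *
      ((LINT x|lborel. of_real (\<theta> x) * fwd w r x) - (LINT x|lborel. of_real (\<theta> x) * bwd w r x))"
    if "\<theta> = \<phi> \<or> \<theta> = \<phi>'" for \<theta>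
  proof -
    have i': "integrable lborel (\<lambda>x. of_real (\<theta> x) * fwd w r x)" "integrable lborel (\<lambda>x. of_real (\<theta> x) * bwd w r x)"
      using that i by auto
    have "(LINT x|lborel. of_real (\<theta> x) * green w r x) = (LINT x|lborel. (- 1 / (2 * w)) *
      (of_real (\<theta> x) * fwd w r x + of_real (\<theta> x) * bwd w r x))"
      by (rule Bochner_Integration.integral_cong) (auto simp: green_def field_simps w_nz)
    then show "(LINT x|lborel. of_real (\<theta> x) * green w r x) = (- 1 / (2 * w)) *
      ((LINT x|lborel. of_real (\<theta> x) * fwd w r x) + (LINT x|lborel. of_real (\<theta> x) * bwd w r x))"
      using i' by (simp only: integral_mult_right_zero Bochner_Integration.integral_add)
    have "(LINT x|lborel. of_real (\<theta> x) * dgreen w r x) = (LINT x|lborel. (- 1 / 2) *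
      (of_real (\<theta> x) * fwd w r x - of_real (\<theta> x) * bwd w r x))"
      by (rule Bochner_Integration.integral_cong) (auto simp: dgreen_def field_simps w_nz)
    then show "(LINT x|lborel. of_real (\<theta> x) * dgreen w r x) = (- 1 / 2) *
      ((LINT x|lborel. of_real (\<theta> x) * fwd w r x) - (LINT x|lborel. of_real (\<theta> x) * bwd w r x))"
      using i' by (simp only: integral_mult_right_zero Bochner_Integration.integral_diff)
  qed
  note fb = fwd_weak[OF \<phi> w r] bwd_weak[OF \<phi> w r]
  show "(LINT x|lborel. of_real (\<phi>' x) * green w r x) = - (LINT x|lborel. of_real (\<phi> x) * dgreen w r x)"
    unfolding g[of \<phi>', simplified] dg[of \<phi>, simplified] fb using w_nz by (simp add: field_simps)
  show "(LINT x|lborel. of_real (\<phi>' x) * dgreen w r x) =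
      (LINT x|lborel. of_real (\<phi> x) * r x) - w\<^sup>2 * (LINT x|lborel. of_real (\<phi> x) * green w r x)"
    unfolding g[of \<phi>, simplified] dg[of \<phi>', simplified] fb
    using w_nz by (simp add: field_simps power2_eq_square)
qed

end

lemma green_diff:
  assumes "Re w < 0" "integrable lborel r" "integrable lborel s"
  shows "green w (\<lambda>y. r y - s y) x = green w r x - green w s x"
  using assms by (simp add: green_def bwd_eq_fwd fwd_diff integrable_reflect add_divide_distrib diff_divide_distrib)

lemma green_cong_AE:
  assumes "AE x in lborel. r x = s x" "r \<in> borel_measurable borel" "s \<in> borel_measurable borel"
  shows "green w r = green w s" "dgreen w r = dgreen w s"
proof -
  have "fwd w r x = fwd w s x" "bwd w r x = bwd w s x" for x
    unfolding fwd_def bwd_def using assms by (auto intro!: integral_cong_AE)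
  then show "green w r = green w s" "dgreen w r = dgreen w s"
    by (auto simp: green_def dgreen_def fun_eq_iff)
qed

section \<open>The a priori estimate\<close>

lemma integral_derivative_eq_0:
  fixes J j :: "real \<Rightarrow> 'a::euclidean_space"
  assumes "\<And>x. (J has_vector_derivative j x) (at x)" "continuous_on UNIV j" "integrable lborel j"
    and "(J \<longlongrightarrow> 0) at_bot" "(J \<longlongrightarrow> 0) at_top"
  shows "(LINT x|lborel. j x) = 0"
proof -
  have "(LBINT x=-\<infinity>..\<infinity>. j x) = 0 - 0"
    by (rule interval_integral_FTC_integrable)
      (use assms in \<open>auto simp: ereal_tendsto_simps continuous_on_eq_continuous_at set_integrable_def\<close>)
  then show ?thesis
    by (simp add: interval_lebesgue_integral_def set_lebesgue_integral_def)
qed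

lemma set_integral_split_at:
  fixes f :: "real \<Rightarrow> real"
  assumes "integrable lborel f"
  shows "(LINT y:{..x}|lborel. f y) + (LINT y:{x..}|lborel. f y) = (LINT y|lborel. f y)"
proof -
  have i: "integrable lborel (\<lambda>y. indicator A y *\<^sub>R f y)" if "A \<in> sets borel" for A
    using that assms by (intro integrable_mult_indicator) auto
  have "(LINT y|lborel. f y) = (LINT y|lborel. indicator {..x} y *\<^sub>R f y + indicator {x..} y *\<^sub>R f y)"
  proof (rule integral_cong_AE)
    show "AE y in lborel. f y = indicator {..x} y *\<^sub>R f y + indicator {x..} y *\<^sub>R f y"
      using AE_lborel_singleton[of x] by eventually_elim (auto simp: indicator_def)
  qed (use assms in auto)
  then show ?thesis
    using i[of "{..x}"] i[of "{x..}"] by (simp add: set_lebesgue_integral_def)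
qed

text \<open>The usual inequality on [y, x], with y sent to minus infinity: F vanishes there, so no
  initial value remains.\<close>

lemma gronwall_left:
  fixes F F' a \<tau> :: "real \<Rightarrow> real"
  assumes F: "\<And>x. (F has_real_derivative F' x) (at x)" and le: "\<And>x. F' x \<le> a x * F x + \<tau> x"
    and F0: "\<And>x. 0 \<le> F x" and a0: "\<And>x. 0 \<le> a x" and \<tau>0: "\<And>x. 0 \<le> \<tau> x"
    and ac: "continuous_on UNIV a" and \<tau>c: "continuous_on UNIV \<tau>"
    and ai: "integrable lborel a" and \<tau>i: "integrable lborel \<tau>"
    and lim: "(F \<longlongrightarrow> 0) at_bot"
  shows "F x \<le> exp (LINT y:{..x}|lborel. a y) * (LINT y:{..x}|lborel. \<tau> y)"
proof -
  have prim: "\<exists>B. (\<forall>t\<in>{y..x}. (B has_real_derivative b t) (at t)) \<and> B x - B y \<le> (LINT t:{..x}|lborel. b t)"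
    if "y \<le> x" and bc: "continuous_on UNIV b" and bi: "integrable lborel b" and b0: "\<And>t. 0 \<le> b t"
    for y and b :: "real \<Rightarrow> real"
  proof -
    \<comment> \<open>One unit of room on each side makes y and x interior points, where the
      derivative is two-sided.\<close>
    obtain B where B: "\<And>t. t \<in> {y-1..x+1} \<Longrightarrow> (B has_vector_derivative b t) (at t within {y-1..x+1})"
      using antiderivative_continuous[OF continuous_on_subset[OF bc subset_UNIV]] by metis
    have "at t within {y-1..x+1} = at t" if "t \<in> {y..x}" for t
      using that by (intro at_within_interior) auto
    then have d: "(B has_vector_derivative b t) (at t)" if "t \<in> {y..x}" for t
      using B[of t] that by force
    have "has_bochner_integral lborel (\<lambda>t. indicator {y..x} t *\<^sub>R b t) (B x - B y)"
    proof (rule has_bochner_integral_FTC_Icc[OF \<open>y \<le> x\<close>])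
      show "(B has_vector_derivative b t) (at t within {y..x})" if "y \<le> t" "t \<le> x" for t
        using that by (auto intro: has_vector_derivative_at_within[OF d])
      show "continuous_on {y..x} b" by (rule continuous_on_subset[OF bc]) simp
    qed
    then have "B x - B y = (LINT t|lborel. indicator {y..x} t *\<^sub>R b t)"
      by (simp add: has_bochner_integral_integral_eq)
    also have "\<dots> \<le> (LINT t:{..x}|lborel. b t)"
      unfolding set_lebesgue_integral_def
      by (intro integral_mono integrable_mult_indicator bi) (auto simp: indicator_def b0)
    finally show ?thesis using d
      by (intro exI[of _ B]) (simp add: has_real_derivative_iff_has_vector_derivative)
  qed
  let ?A = "LINT y:{..x}|lborel. a y" and ?T = "LINT y:{..x}|lborel. \<tau> y"
  have "F x \<le> exp ?A * (F y + ?T)" if y: "y \<le> x" for y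
  proof -
    obtain \<alpha> where \<alpha>: "\<And>t. t \<in> {y..x} \<Longrightarrow> (\<alpha> has_real_derivative a t) (at t)" "\<alpha> x - \<alpha> y \<le> ?A"
      using prim[OF y ac ai a0] by blast
    obtain \<beta> where \<beta>: "\<And>t. t \<in> {y..x} \<Longrightarrow> (\<beta> has_real_derivative \<tau> t) (at t)" "\<beta> x - \<beta> y \<le> ?T"
      using prim[OF y \<tau>c \<tau>i \<tau>0] by blast
    have mono: "\<alpha> y \<le> \<alpha> t" if "t \<in> {y..x}" for t
      by (rule DERIV_nonneg_imp_nondecreasing[where f = \<alpha>]) (use that \<alpha>(1) a0 in force)+
    \<comment> \<open>The integrating factor is normalised to 1 at t = y and is at most 1
      afterwards. Dropping it from the forcing term only enlarges the bound, which makes H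
      nonincreasing.\<close>
    let ?H = "\<lambda>t. F t * exp (\<alpha> y - \<alpha> t) - \<beta> t"
    have "?H x \<le> ?H y"
    proof (rule DERIV_nonpos_imp_nonincreasing[OF y])
      fix t assume "y \<le> t" "t \<le> x"
      then have t: "t \<in> {y..x}" by simp
      have "(?H has_real_derivative (F' t - a t * F t) * exp (\<alpha> y - \<alpha> t) - \<tau> t) (at t)"
        by (auto intro!: derivative_eq_intros F \<alpha>(1) \<beta>(1) t simp: algebra_simps)
      moreover have "(F' t - a t * F t) * exp (\<alpha> y - \<alpha> t) \<le> \<tau> t * 1"
        using le[of t] mono[OF t] \<tau>0[of t]
        by (intro order_trans[OF mult_right_mono[of _ "\<tau> t"] mult_left_mono]) auto
      ultimately show "\<exists>z. (?H has_real_derivative z) (at t) \<and> z \<le> 0" by force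
    qed
    then have "F x * exp (\<alpha> y - \<alpha> x) \<le> F y + ?T" using \<beta>(2) by simp
    then have "F x \<le> (F y + ?T) * exp (\<alpha> x - \<alpha> y)"
      by (simp add: exp_diff field_simps)
    moreover have "0 \<le> F y + ?T"
      using F0[of y] \<tau>0 by (auto simp: set_lebesgue_integral_def intro!: add_nonneg_nonneg Bochner_Integration.integral_nonneg)
    then have "(F y + ?T) * exp (\<alpha> x - \<alpha> y) \<le> (F y + ?T) * exp ?A"
      using \<alpha>(2) by (intro mult_left_mono) auto
    ultimately show ?thesis by (simp add: mult.commute)
  qed
  then have "\<forall>\<^sub>F y in at_bot. F x \<le> exp ?A * (F y + ?T)"
    using eventually_le_at_bot[of x] by (rule eventually_mono[rotated])
  moreover have "((\<lambda>y. exp ?A * (F y + ?T)) \<longlongrightarrow> exp ?A * (0 + ?T)) at_bot"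
    by (intro tendsto_intros lim)
  ultimately show ?thesis
    using tendsto_lowerbound[of "\<lambda>y. exp ?A * (F y + ?T)" _ at_bot "F x"] by auto
qed

lemma gronwall_right:
  fixes F F' a \<tau> :: "real \<Rightarrow> real"
  assumes F: "\<And>x. (F has_real_derivative F' x) (at x)" and le: "\<And>x. - F' x \<le> a x * F x + \<tau> x"
    and F0: "\<And>x. 0 \<le> F x" and a0: "\<And>x. 0 \<le> a x" and \<tau>0: "\<And>x. 0 \<le> \<tau> x"
    and ac: "continuous_on UNIV a" and \<tau>c: "continuous_on UNIV \<tau>"
    and ai: "integrable lborel a" and \<tau>i: "integrable lborel \<tau>"
    and lim: "(F \<longlongrightarrow> 0) at_top"
  shows "F x \<le> exp (LINT y:{x..}|lborel. a y) * (LINT y:{x..}|lborel. \<tau> y)"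
proof -
  have refl: "(LINT y:{..-x}|lborel. b (- y)) = (LINT y:{x..}|lborel. b y)" for b :: "real \<Rightarrow> real"
  proof -
    have "indicator {x..} (- y) = (indicator {..-x} y :: real)" for y by (auto simp: indicator_def)
    then show ?thesis
      using integral_reflect[of "\<lambda>y. indicator {x..} y *\<^sub>R b y"] by (simp add: set_lebesgue_integral_def)
  qed
  have c: "continuous_on UNIV (\<lambda>x. b (- x))" if "continuous_on UNIV b" for b :: "real \<Rightarrow> real"
    by (rule continuous_on_compose2[OF that continuous_on_minus[OF continuous_on_id]]) simp
  have "F (- (- x)) \<le> exp (LINT y:{..-x}|lborel. a (- y)) * (LINT y:{..-x}|lborel. \<tau> (- y))"
  proof (rule gronwall_left[where F = "\<lambda>x. F (- x)" and F' = "\<lambda>x. - F' (- x)"])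
    show "((\<lambda>x. F (- x)) has_real_derivative - F' (- x)) (at x)" for x
      by (rule DERIV_chain2[OF F, THEN DERIV_cong]) (auto intro!: derivative_eq_intros)
    show "((\<lambda>x. F (- x)) \<longlongrightarrow> 0) at_bot"
      using lim by (simp add: filterlim_at_top_mirror)
  qed (use assms in \<open>auto intro!: c integrable_reflect\<close>)
  then show ?thesis by (simp add: refl)
qed

text \<open>
  Running Gronwall's inequality from both ends and taking the geometric mean halves both the
  exponent and the forcing term.
\<close>

lemma gronwall_two_sided:
  fixes F F' a \<tau> :: "real \<Rightarrow> real"
  assumes F: "\<And>x. (F has_real_derivative F' x) (at x)" and le: "\<And>x. \<bar>F' x\<bar> \<le> a x * F x + \<tau> x"
    and F0: "\<And>x. 0 \<le> F x" and a0: "\<And>x. 0 \<le> a x" and \<tau>0: "\<And>x. 0 \<le> \<tau> x"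
    and ac: "continuous_on UNIV a" and \<tau>c: "continuous_on UNIV \<tau>"
    and ai: "integrable lborel a" and \<tau>i: "integrable lborel \<tau>"
    and lim: "(F \<longlongrightarrow> 0) at_bot" "(F \<longlongrightarrow> 0) at_top"
  shows "F x \<le> exp ((LINT y|lborel. a y) / 2) * (LINT y|lborel. \<tau> y) / 2"
proof (rule power2_le_imp_le)
  let ?A = "LINT y|lborel. a y" and ?T = "LINT y|lborel. \<tau> y"
  let ?A1 = "LINT y:{..x}|lborel. a y" and ?A2 = "LINT y:{x..}|lborel. a y"
  let ?T1 = "LINT y:{..x}|lborel. \<tau> y" and ?T2 = "LINT y:{x..}|lborel. \<tau> y"
  have l: "F x \<le> exp ?A1 * ?T1"
    by (rule gronwall_left[OF F abs_le_D1[OF le]]) (use assms in auto)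
  have r: "F x \<le> exp ?A2 * ?T2"
    by (rule gronwall_right[OF F abs_le_D2[OF le]]) (use assms in auto)
  have A: "?A1 + ?A2 = ?A" and T: "?T1 + ?T2 = ?T"
    using ai \<tau>i by (auto intro: set_integral_split_at)
  have "(F x)\<^sup>2 \<le> (exp ?A1 * ?T1) * (exp ?A2 * ?T2)"
    unfolding power2_eq_square using l r F0[of x] by (intro mult_mono) auto
  also have "\<dots> = exp ?A * (?T1 * ?T2)" by (simp add: A[symmetric] exp_add)
  also have "\<dots> \<le> exp ?A * (?T\<^sup>2 / 4)"
  proof (rule mult_left_mono)
    have "0 \<le> (?T1 - ?T2)\<^sup>2" by simp
    then show "?T1 * ?T2 \<le> ?T\<^sup>2 / 4" unfolding T[symmetric] by (simp add: power2_eq_square algebra_simps)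
  qed simp
  also have "\<dots> = (exp (?A / 2) * ?T / 2)\<^sup>2"
    by (simp add: power_mult_distrib power_divide flip: exp_double)
  finally show "(F x)\<^sup>2 \<le> (exp (?A / 2) * ?T / 2)\<^sup>2" .
  show "0 \<le> exp (?A / 2) * ?T / 2" using \<tau>0 by (simp add: Bochner_Integration.integral_nonneg)
qed

text \<open>Obtained by solving the last inequality of \<open>apriori_continuous\<close> for S:
  exp(A/2) is the two-sided Gronwall factor, exp(A) the weight \<mu>, 7/2 = 2 + 3/2 collects the
  forcing terms, and exp(-1), the maximum of x exp(-x), comes from the absorbed term.\<close>

definition apriori_const :: "real \<Rightarrow> real" where
  "apriori_const A = exp (A / 2) * (7 / 2 + exp A) / (2 - exp (-1))"

lemma exp_minus_1_less_2: "exp (-1) < (2::real)"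
  by (rule less_trans[of _ 1]) auto

lemma mult_exp_minus_le: "x * exp (- x) \<le> exp (-1 :: real)"
proof -
  have "x \<le> exp (x - 1)" using exp_ge_add_one_self[of "x - 1"] by simp
  then have "x * exp (- x) \<le> exp (x - 1) * exp (- x)" by (intro mult_right_mono) auto
  then show ?thesis by (simp flip: exp_add)
qed

lemma apriori_const_mono: "A \<le> B \<Longrightarrow> apriori_const A \<le> apriori_const B"
  unfolding apriori_const_def using exp_minus_1_less_2
  by (intro divide_right_mono mult_mono) (auto simp: add_nonneg_nonneg)

lemma apriori_const_pos: "0 < apriori_const A"
  unfolding apriori_const_def using exp_minus_1_less_2
  by (intro divide_pos_pos mult_pos_pos add_pos_pos) auto

lemma mult_apriori_const_le: "A * apriori_const A \<le> exp (2 * A)"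
proof -
  \<comment> \<open>After division by exp(2A) the two terms are at most (7/2)(2/3)/e and 2/e,
    together 13/(3e). This is at most 2 - 1/e exactly when e \<ge> 8/3.\<close>
  have e: "(8/3::real) \<le> exp 1" using abs_le_D2[OF e_approx_32] by simp
  have 1: "A * exp (- A / 2) \<le> 2 * exp (-1)"
    using mult_exp_minus_le[of "A/2"] by simp
  have 2: "A * exp (- 3 * A / 2) \<le> 2/3 * exp (-1)"
    using mult_exp_minus_le[of "3*A/2"] by simp
  have "A * (exp (A / 2) * (7 / 2 + exp A)) =
      exp (2 * A) * (7/2 * (A * exp (- 3 * A / 2)) + A * exp (- A / 2))"
    by (simp add: algebra_simps mult_exp_exp)
  also have "\<dots> \<le> exp (2 * A) * (2 - exp (-1))"
  proof (rule mult_left_mono)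
    have "exp (-1) \<le> (3/8::real)" using e by (simp add: exp_minus divide_simps)
    then show "7/2 * (A * exp (- 3 * A / 2)) + A * exp (- A / 2) \<le> 2 - exp (-1)"
      using 1 2 by simp
  qed simp
  finally show ?thesis
    using exp_minus_1_less_2 by (simp add: apriori_const_def pos_divide_le_eq)
qed

text \<open>All quantities are bounded through S, the supremum of sqrt(F), and the estimate closes
  as a quadratic inequality in S. The bound B makes S finite, so that the A S^2 term can be absorbed
  and a factor S cancelled; the decay at infinity removes the boundary terms.\<close>

lemma apriori_continuous:
  fixes V :: "real \<Rightarrow> real" and f u g :: "real \<Rightarrow> complex" and E \<epsilon> :: real
  assumes \<epsilon>: "0 < \<epsilon>" "2 * \<epsilon> \<le> E"
    and Vc: "continuous_on UNIV V" and fc: "continuous_on UNIV f"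
    and Vi: "integrable lborel V" and fi: "integrable lborel f"
    and u': "\<And>x. (u has_vector_derivative g x) (at x)"
    and g': "\<And>x. (g has_vector_derivative (of_real (V x) - Complex E \<epsilon>) * u x - f x) (at x)"
    and ui: "integrable lborel u" and gi: "integrable lborel g"
    and uB: "\<And>x. cmod (u x) \<le> B" and gB: "\<And>x. cmod (g x) \<le> B"
    and u0: "(u \<longlongrightarrow> 0) at_bot" "(u \<longlongrightarrow> 0) at_top"
    and g0: "(g \<longlongrightarrow> 0) at_bot" "(g \<longlongrightarrow> 0) at_top"
  shows "sqrt E * cmod (u x) \<le> apriori_const ((LINT x|lborel. \<bar>V x\<bar>) / sqrt E) * (LINT x|lborel. cmod (f x))"
proof -
  have E: "0 < E" using \<epsilon> by simp
  define q where "q = sqrt E"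
  have q: "0 < q" "q * q = E" using E by (auto simp: q_def)
  have uc: "continuous_on UNIV u" and gc: "continuous_on UNIV g"
    using u' g' by (auto intro!: continuous_at_imp_continuous_on has_vector_derivative_continuous)
  define N \<Phi> A where "N = (LINT x|lborel. \<bar>V x\<bar>)" and "\<Phi> = (LINT x|lborel. cmod (f x))" and "A = N / q"
  have \<Phi>0: "0 \<le> \<Phi>" by (simp add: \<Phi>_def)
  have N0: "0 \<le> N" by (simp add: N_def)
  have A0: "0 \<le> A" using N0 q by (simp add: A_def)
  define F where "F x = (cmod (g x))\<^sup>2 + E * (cmod (u x))\<^sup>2" for x
  define S where "S = sqrt (SUP x. F x)"
  have F0: "0 \<le> F x" for x using E by (simp add: F_def)
  have "F x \<le> B\<^sup>2 + E * B\<^sup>2" for x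
    unfolding F_def using E uB[of x] gB[of x]
    by (intro add_mono mult_left_mono power_mono) auto
  then have bdd: "bdd_above (range F)" by (auto intro!: bdd_aboveI)
  then have SUP0: "0 \<le> (SUP x. F x)"
    using cSUP_upper2[OF bdd, of 0 0] F0 by simp
  then have S0: "0 \<le> S" and S2: "S\<^sup>2 = (SUP x. F x)" by (auto simp: S_def)
  have FS: "F x \<le> S\<^sup>2" for x unfolding S2 by (rule cSUP_upper[OF _ bdd]) simp
  have gS: "cmod (g x) \<le> S" for x
    by (rule power2_le_imp_le[OF _ S0]) (use FS[of x] E in \<open>simp add: F_def; smt (verit) mult_nonneg_nonneg zero_le_power2\<close>)
  have uS: "q * cmod (u x) \<le> S" for x
    by (rule power2_le_imp_le[OF _ S0])
      (use FS[of x] q in \<open>simp add: F_def power_mult_distrib power2_eq_square[of q]; smt (verit) zero_le_power2\<close>)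
  have uS': "cmod (u x) \<le> S / q" for x using uS[of x] q by (simp add: field_simps)
  define U2 G2 VU FU where "U2 = (LINT x|lborel. (cmod (u x))\<^sup>2)" and "G2 = (LINT x|lborel. (cmod (g x))\<^sup>2)"
    and "VU = (LINT x|lborel. V x * (cmod (u x))\<^sup>2)" and "FU = (LINT x|lborel. f x * cnj (u x))"
  have [measurable]: "u \<in> borel_measurable borel" "g \<in> borel_measurable borel" "f \<in> borel_measurable borel"
    "V \<in> borel_measurable borel"
    using uc gc fc Vc by (auto intro!: borel_measurable_continuous_onI)
  have iU: "integrable lborel (\<lambda>x. (cmod (u x))\<^sup>2)"
    using integrable_mult_bounded[of lborel "\<lambda>x. cmod (u x)" "\<lambda>x. cmod (u x)" B] ui uB
    by (simp add: power2_eq_square)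
  have iG: "integrable lborel (\<lambda>x. (cmod (g x))\<^sup>2)"
    using integrable_mult_bounded[of lborel "\<lambda>x. cmod (g x)" "\<lambda>x. cmod (g x)" B] gi gB
    by (simp add: power2_eq_square)
  have u2B: "(cmod (u x))\<^sup>2 \<le> (S / q)\<^sup>2" for x using uS'[of x] by (intro power_mono) auto
  have iV: "integrable lborel (\<lambda>x. V x * (cmod (u x))\<^sup>2)"
    using integrable_mult_bounded[of lborel V "\<lambda>x. (cmod (u x))\<^sup>2" "(S/q)\<^sup>2"] Vi u2B
    by (simp add: mult.commute)
  have iF: "integrable lborel (\<lambda>x. f x * cnj (u x))"
  proof -
    have "(\<lambda>x. cnj (u x)) \<in> borel_measurable lborel"
      using uc by (auto intro!: borel_measurable_continuous_onI continuous_intros)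
    then show ?thesis
      using integrable_mult_bounded[of lborel f "\<lambda>x. cnj (u x)" B] fi uB by (simp add: mult.commute)
  qed
  have FUle: "cmod FU \<le> \<Phi> * S / q"
  proof -
    have *: "cmod (f x * cnj (u x)) \<le> cmod (f x) * (S / q)" for x
      unfolding norm_mult complex_mod_cnj by (intro mult_left_mono uS') simp
    have "cmod FU \<le> (LINT x|lborel. cmod (f x * cnj (u x)))" unfolding FU_def by (rule integral_norm_bound)
    also have "\<dots> \<le> (LINT x|lborel. cmod (f x) * (S / q))"
      using iF fi by (intro integral_mono integrable_norm integrable_mult_left *) auto
    finally show ?thesis using fi by (simp add: \<Phi>_def)
  qed
  have VUle: "\<bar>VU\<bar> \<le> N * (S / q)\<^sup>2"
  proof -
    have "\<bar>VU\<bar> \<le> (LINT x|lborel. \<bar>V x * (cmod (u x))\<^sup>2\<bar>)"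
      unfolding VU_def using integral_norm_bound[of lborel "\<lambda>x. V x * (cmod (u x))\<^sup>2"] by simp
    also have "\<dots> \<le> (LINT x|lborel. \<bar>V x\<bar> * (S / q)\<^sup>2)"
      using iV Vi u2B by (intro integral_mono integrable_abs integrable_mult_left) (auto simp: abs_mult intro: mult_left_mono)
    finally show ?thesis using Vi by (simp add: N_def)
  qed
  \<comment> \<open>The derivative of g cnj(u) integrates to 0. The imaginary part isolates
    \<epsilon> ||u||^2; the real part then expresses ||g||^2 through ||u||^2.\<close>
  have energy: "of_real VU - Complex E \<epsilon> * of_real U2 - FU + of_real G2 = 0"
  proof -
    let ?j = "\<lambda>x. of_real (V x * (cmod (u x))\<^sup>2) - Complex E \<epsilon> * of_real ((cmod (u x))\<^sup>2) - f x * cnj (u x) + complex_of_real ((cmod (g x))\<^sup>2)"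
    have "(LINT x|lborel. ?j x) = 0"
    proof (rule integral_derivative_eq_0)
      show "((\<lambda>x. g x * cnj (u x)) has_vector_derivative ?j x) (at x)" for x
        using has_vector_derivative_mult[OF g'[of x] has_vector_derivative_cnj[OF u'[of x]]]
        by (rule has_vector_derivative_eq_rhs)
          (simp only: of_real_mult complex_norm_square, simp add: algebra_simps)
      show "continuous_on UNIV ?j" by (intro continuous_intros uc gc fc Vc)
      show "integrable lborel ?j"
        using iV iF iU iG by (intro Bochner_Integration.integrable_add Bochner_Integration.integrable_diff integrable_mult_right integrable_of_real)
      show "((\<lambda>x. g x * cnj (u x)) \<longlongrightarrow> 0) at_bot" "((\<lambda>x. g x * cnj (u x)) \<longlongrightarrow> 0) at_top"
        using tendsto_mult[OF g0(1) tendsto_cnj[OF u0(1)]] tendsto_mult[OF g0(2) tendsto_cnj[OF u0(2)]] by auto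
    qed
    moreover have "(LINT x|lborel. ?j x) = of_real VU - Complex E \<epsilon> * of_real U2 - FU + of_real G2"
      unfolding VU_def U2_def FU_def G2_def integral_complex_of_real[symmetric]
      by (simp only: Bochner_Integration.integral_add Bochner_Integration.integral_diff integral_mult_right_zero
          Bochner_Integration.integrable_add Bochner_Integration.integrable_diff integrable_mult_right
          integrable_of_real iV iF iU iG)
    ultimately show ?thesis by simp
  qed
  have U2le: "\<epsilon> * U2 \<le> \<Phi> * S / q"
  proof -
    have "\<epsilon> * U2 = - Im FU" using arg_cong[OF energy, of Im] by simp
    then show ?thesis using abs_Im_le_cmod[of FU] FUle by linarith
  qed
  \<comment> \<open>The term E ||u||^2 is paid for by the bound on \<epsilon> ||u||^2; the other two
    use \<epsilon> \<le> E/2. Hence 3/2 = 1 + 1/2 in front of \<Phi> S and 1/2 in front of A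
    S^2.\<close>
  have G2le: "\<epsilon> * G2 \<le> q * (3/2 * \<Phi> * S + A * S\<^sup>2 / 2)"
  proof -
    have "G2 = E * U2 - VU + Re FU" using arg_cong[OF energy, of Re] by simp
    then have "G2 \<le> E * U2 + N * (S / q)\<^sup>2 + \<Phi> * S / q"
      using abs_Re_le_cmod[of FU] FUle VUle by linarith
    then have "\<epsilon> * G2 \<le> \<epsilon> * (E * U2 + N * (S / q)\<^sup>2 + \<Phi> * S / q)" using \<epsilon> by simp
    also have "\<dots> = E * (\<epsilon> * U2) + \<epsilon> * (N * (S / q)\<^sup>2 + \<Phi> * S / q)" by (simp add: algebra_simps)
    also have "\<dots> \<le> E * (\<Phi> * S / q) + E / 2 * (N * (S / q)\<^sup>2 + \<Phi> * S / q)"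
      using U2le E \<epsilon> N0 \<Phi>0 S0 q by (intro add_mono mult_left_mono mult_right_mono) auto
    also have "\<dots> = q * (3/2 * \<Phi> * S + A * S\<^sup>2 / 2)"
      using q unfolding q(2)[symmetric] A_def by (simp add: field_simps power2_eq_square)
    finally show ?thesis .
  qed
  \<comment> \<open>The weight in the inequality \<open>2 \<bar>u\<bar> \<bar>g\<bar> \<le> \<mu> q \<bar>u\<bar>\<^sup>2 + \<bar>g\<bar>\<^sup>2 / (\<mu> q)\<close>; the choice \<open>exp A\<close> makes the
    \<open>A S\<^sup>2\<close> term absorbable for every \<open>A\<close>.\<close>
  define \<mu> where "\<mu> = exp A"
  have \<mu>: "1 \<le> \<mu>" using A0 by (simp add: \<mu>_def)
  define \<tau> where "\<tau> x = \<epsilon> * (\<mu> * q * (cmod (u x))\<^sup>2 + (cmod (g x))\<^sup>2 / (\<mu> * q)) + 2 * S * cmod (f x)" for x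
  have \<tau>i: "integrable lborel \<tau>" unfolding \<tau>_def[abs_def] using iU iG fi by auto
  have "(LINT x|lborel. \<tau> x) = \<epsilon> * (\<mu> * q * U2 + G2 / (\<mu> * q)) + 2 * S * \<Phi>"
    unfolding \<tau>_def[abs_def] U2_def G2_def \<Phi>_def using iU iG fi by simp
  also have "\<dots> = \<mu> * q * (\<epsilon> * U2) + (\<epsilon> * G2) / (\<mu> * q) + 2 * S * \<Phi>" by (simp add: algebra_simps)
  also have "\<dots> \<le> \<mu> * q * (\<Phi> * S / q) + q * (3/2 * \<Phi> * S + A * S\<^sup>2 / 2) / (\<mu> * q) + 2 * S * \<Phi>"
    using U2le G2le \<mu> q S0 \<Phi>0 by (intro add_mono mult_left_mono divide_right_mono) auto
  also have "\<dots> = (2 + \<mu>) * \<Phi> * S + 3/2 * \<Phi> * S / \<mu> + A * S\<^sup>2 / (2 * \<mu>)"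
    using q \<mu> by (simp add: field_simps)
  also have "\<dots> \<le> (2 + \<mu>) * \<Phi> * S + 3/2 * \<Phi> * S + A * S\<^sup>2 / (2 * \<mu>)"
    using mult_left_mono[OF \<mu>, of "3/2 * \<Phi> * S"] \<mu> \<Phi>0 S0 by (simp add: divide_le_eq)
  finally have T: "(LINT x|lborel. \<tau> x) \<le> (7/2 + \<mu>) * \<Phi> * S + A * S\<^sup>2 / (2 * \<mu>)" by (simp add: algebra_simps)
  \<comment> \<open>The derivative of F after using the equation. The weight E in F cancels the real
    part of the spectral parameter, so that only V, \<epsilon> and f remain.\<close>
  define F' where "F' x = 2 * (V x * Re (u x * cnj (g x)) + \<epsilon> * Im (u x * cnj (g x)) - Re (f x * cnj (g x)))" for x
  have "F x \<le> exp ((LINT y|lborel. \<bar>V y\<bar> / q) / 2) * (LINT y|lborel. \<tau> y) / 2" for x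
  proof (rule gronwall_two_sided[of F F'])
    fix x
    have "F = (\<lambda>x. (Re (g x))\<^sup>2 + (Im (g x))\<^sup>2 + E * ((Re (u x))\<^sup>2 + (Im (u x))\<^sup>2))"
      by (simp add: fun_eq_iff F_def cmod_power2)
    then show "(F has_real_derivative F' x) (at x)"
      by (auto intro!: derivative_eq_intros u' g' simp: F'_def algebra_simps power2_eq_square)
    have ug: "2 * (q * cmod (u x)) * cmod (g x) \<le> F x"
      unfolding F_def q(2)[symmetric] using sum_squares_bound[of "q * cmod (u x)" "cmod (g x)"]
      by (simp add: power2_eq_square algebra_simps)
    have ug': "2 * cmod (u x) * cmod (g x) \<le> \<mu> * q * (cmod (u x))\<^sup>2 + (cmod (g x))\<^sup>2 / (\<mu> * q)"
      using sum_squares_bound[of "sqrt (\<mu> * q) * cmod (u x)" "cmod (g x) / sqrt (\<mu> * q)"] \<mu> q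
      by (simp add: power_mult_distrib power_divide)
    have "\<bar>F' x\<bar> \<le> 2 * (\<bar>V x * Re (u x * cnj (g x))\<bar> + \<bar>\<epsilon> * Im (u x * cnj (g x))\<bar> + \<bar>Re (f x * cnj (g x))\<bar>)"
      unfolding F'_def abs_mult[of 2] by (intro mult_mono) (auto simp: abs_if)
    also have "\<dots> \<le> 2 * (\<bar>V x\<bar> * (cmod (u x) * cmod (g x)) + \<epsilon> * (cmod (u x) * cmod (g x)) + cmod (f x) * cmod (g x))"
      using abs_Re_le_cmod[of "u x * cnj (g x)"] abs_Im_le_cmod[of "u x * cnj (g x)"] abs_Re_le_cmod[of "f x * cnj (g x)"] \<epsilon>
      unfolding abs_mult[of "V x"] abs_mult[of \<epsilon>]
      by (intro mult_left_mono add_mono) (auto simp: norm_mult)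
    also have "\<dots> = \<bar>V x\<bar> / q * (2 * (q * cmod (u x)) * cmod (g x)) + \<epsilon> * (2 * cmod (u x) * cmod (g x)) + 2 * cmod (g x) * cmod (f x)"
      using q by (simp add: algebra_simps)
    also have "\<dots> \<le> \<bar>V x\<bar> / q * F x + \<epsilon> * (\<mu> * q * (cmod (u x))\<^sup>2 + (cmod (g x))\<^sup>2 / (\<mu> * q)) + 2 * S * cmod (f x)"
      using ug ug' gS[of x] \<epsilon> q by (intro add_mono mult_left_mono mult_right_mono) auto
    finally show "\<bar>F' x\<bar> \<le> \<bar>V x\<bar> / q * F x + \<tau> x" by (simp add: \<tau>_def)
    show "0 \<le> \<tau> x" using \<epsilon> \<mu> q S0 by (simp add: \<tau>_def)
  next
    show "continuous_on UNIV \<tau>" unfolding \<tau>_def[abs_def] using \<mu> q by (intro continuous_intros uc gc fc) auto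
    show "continuous_on UNIV (\<lambda>x. \<bar>V x\<bar> / q)" using q by (intro continuous_intros Vc) auto
    have "((\<lambda>x. (cmod (g x))\<^sup>2 + E * (cmod (u x))\<^sup>2) \<longlongrightarrow> (cmod 0)\<^sup>2 + E * (cmod 0)\<^sup>2) at_bot"
      by (intro tendsto_intros u0 g0)
    then show "(F \<longlongrightarrow> 0) at_bot" by (simp add: F_def[abs_def])
    have "((\<lambda>x. (cmod (g x))\<^sup>2 + E * (cmod (u x))\<^sup>2) \<longlongrightarrow> (cmod 0)\<^sup>2 + E * (cmod 0)\<^sup>2) at_top"
      by (intro tendsto_intros u0 g0)
    then show "(F \<longlongrightarrow> 0) at_top" by (simp add: F_def[abs_def])
  qed (use F0 q Vi \<tau>i in auto)
  moreover have "(LINT y|lborel. \<bar>V y\<bar> / q) = A" by (simp add: A_def N_def)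
  ultimately have "S\<^sup>2 \<le> exp (A / 2) * (LINT y|lborel. \<tau> y) / 2"
    unfolding S2 by (intro cSUP_least) auto
  also have "\<dots> \<le> exp (A / 2) * ((7/2 + \<mu>) * \<Phi> * S + A * S\<^sup>2 / (2 * \<mu>)) / 2"
    using T by (intro divide_right_mono mult_left_mono) auto
  also have "\<dots> = exp (A / 2) * (7/2 + exp A) * \<Phi> * S / 2 + S\<^sup>2 / 2 * ((A / 2) * exp (- (A / 2)))"
  proof -
    have "exp (A / 2) / \<mu> = exp (- (A / 2))" unfolding \<mu>_def exp_diff[symmetric] by simp
    then show ?thesis by (simp add: \<mu>_def field_simps)
  qed
  \<comment> \<open>The coefficient of S^2 becomes at most 1/(2e) < 1, so this term can be moved to
    the left.\<close>
  also have "\<dots> \<le> exp (A / 2) * (7/2 + exp A) * \<Phi> * S / 2 + S\<^sup>2 / 2 * exp (-1)"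
    using mult_exp_minus_le[of "A / 2"] by (intro add_left_mono mult_left_mono) auto
  finally have "S * (S * (2 - exp (-1))) \<le> S * (exp (A / 2) * (7/2 + exp A) * \<Phi>)"
    by (simp add: algebra_simps power2_eq_square add_divide_distrib)
  then have "S * (2 - exp (-1)) \<le> exp (A / 2) * (7/2 + exp A) * \<Phi>"
    using S0 \<Phi>0 by (cases "S = 0") (auto simp: add_nonneg_nonneg)
  then have "S \<le> apriori_const A * \<Phi>"
    using exp_minus_1_less_2 by (simp add: apriori_const_def pos_le_divide_eq)
  then show ?thesis using uS[of x] unfolding q_def[symmetric] A_def N_def \<Phi>_def by linarith
qed

section \<open>Integrable potentials and existence of solutions\<close>

lemma approx_continuous_indicator:
  fixes A :: "real set"
  assumes A: "A \<in> sets borel" "emeasure lborel A < \<infinity>" and e: "0 < e"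
  shows "\<exists>g :: real \<Rightarrow> real. continuous_on UNIV g \<and> integrable lborel g \<and> (LINT x|lborel. \<bar>indicator A x - g x\<bar>) < e"
proof -
  obtain U where U: "open U" "A \<subseteq> U" "emeasure lborel (U - A) < ennreal (e / 2)"
    using outer_regular_lborel[OF A(1), of "e / 2"] e by auto
  have [measurable]: "A \<in> sets borel" "U \<in> sets borel" using A U by auto
  have "emeasure lborel U \<le> emeasure lborel A + emeasure lborel (U - A)"
    using emeasure_subadditive[of A lborel "U - A"] U(2) by (simp add: Un_absorb1)
  moreover have "emeasure lborel (U - A) < \<infinity>" using U(3) by (rule less_trans) simp
  then have "emeasure lborel A + emeasure lborel (U - A) < \<infinity>" using A(2) by simp
  ultimately have fin: "emeasure lborel U < \<infinity>" by (rule le_less_trans)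
  \<comment> \<open>\<open>infdist\<close> to the empty set is 0 by convention and would make every
    g n vanish; finite measure excludes U = UNIV.\<close>
  have ne: "- U \<noteq> {}"
  proof
    assume "- U = {}"
    then have "U = UNIV" by blast
    then show False using fin by simp
  qed
  have iU: "integrable lborel (indicator U :: real \<Rightarrow> real)" using fin by (intro integrable_real_indicator) auto
  define g where "g n x = min 1 (real n * infdist x (- U))" for n x
  have gc: "continuous_on UNIV (g n)" for n unfolding g_def[abs_def] by (intro continuous_intros)
  then have [measurable]: "g n \<in> borel_measurable borel" for n by (rule borel_measurable_continuous_onI)
  have g01: "0 \<le> g n x" "g n x \<le> indicator U x" for n x
    using infdist_zero[of x "- U"] by (auto simp: g_def infdist_nonneg indicator_def)
  have gi: "integrable lborel (g n)" for n
    by (rule Bochner_Integration.integrable_bound[OF iU]) (use g01 in auto)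
  have "(\<lambda>n. LINT x|lborel. \<bar>indicator U x - g n x\<bar>) \<longlonglongrightarrow> (LINT (x::real)|lborel. (0::real))"
  proof (rule integral_dominated_convergence[where w = "indicator U"])
    show "AE x in lborel. (\<lambda>n. \<bar>indicator U x - g n x\<bar>) \<longlonglongrightarrow> 0"
    proof (rule AE_I2)
      fix x
      show "(\<lambda>n. \<bar>indicator U x - g n x\<bar>) \<longlonglongrightarrow> 0"
      proof (cases "x \<in> U")
        case True
        then have "0 < infdist x (- U)"
          using ne U(1) by (simp add: infdist_pos_not_in_closed closed_Compl)
        then have "filterlim (\<lambda>n. infdist x (- U) * real n) at_top sequentially"
          by (intro filterlim_tendsto_pos_mult_at_top[OF tendsto_const] filterlim_real_sequentially)
        then have "\<forall>\<^sub>F n in sequentially. 1 \<le> infdist x (- U) * real n"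
          by (simp add: filterlim_at_top)
        then show ?thesis
          by (intro tendsto_eventually, eventually_elim) (use True in \<open>simp add: g_def mult.commute\<close>)
      next
        case False
        then have "g n x = 0" for n using g01[of n x] by simp
        then show ?thesis using False by simp
      qed
    qed
    show "AE x in lborel. norm \<bar>indicator U x - g n x\<bar> \<le> indicator U x" for n
      using g01[of n] by (auto simp: abs_le_iff algebra_simps)
  qed (use iU in auto)
  then have "\<forall>\<^sub>F n in sequentially. (LINT x|lborel. \<bar>indicator U x - g n x\<bar>) < e / 2"
    using e by (intro order_tendstoD(2)) auto
  then obtain n where n: "(LINT x|lborel. \<bar>indicator U x - g n x\<bar>) < e / 2"
    by (auto simp: eventually_sequentially)
  have iD: "integrable lborel (indicator (U - A) :: real \<Rightarrow> real)"
    using U(3) by (intro integrable_real_indicator) (auto intro: less_trans simp: less_top)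
  have "(LINT x|lborel. \<bar>indicator A x - g n x\<bar>) \<le> (LINT x|lborel. indicator (U - A) x + \<bar>indicator U x - g n x\<bar>)"
  proof (intro integral_mono)
    show "\<bar>indicator A x - g n x\<bar> \<le> indicator (U - A) x + \<bar>indicator U x - g n x\<bar>" for x
      using U(2) by (auto simp: indicator_def)
  qed (use A iU iD gi in \<open>auto intro!: integrable_abs Bochner_Integration.integrable_diff\<close>)
  also have "\<dots> = measure lborel (U - A) + (LINT x|lborel. \<bar>indicator U x - g n x\<bar>)"
    using iD iU gi[of n] by simp
  also have "measure lborel (U - A) \<le> e / 2"
    unfolding measure_def by (rule enn2real_leI) (use U(3) e in auto)
  finally have "(LINT x|lborel. \<bar>indicator A x - g n x\<bar>) < e" using n by linarith
  then show ?thesis using gc gi by blast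
qed

text \<open>Vector-valued so as to serve both the real potential and the complex data.\<close>

lemma approx_continuous_integrable:
  fixes f :: "real \<Rightarrow> 'a::{banach, second_countable_topology}"
  assumes "integrable lborel f" "0 < e"
  shows "\<exists>g. continuous_on UNIV g \<and> integrable lborel g \<and> (LINT x|lborel. norm (f x - g x)) < e"
  using assms
proof (induction arbitrary: e rule: integrable_induct)
  case (base A c)
  have "0 < e / (norm c + 1)" using base.prems by (simp add: add_nonneg_pos)
  then obtain g :: "real \<Rightarrow> real" where g: "continuous_on UNIV g" "integrable lborel g"
      "(LINT x|lborel. \<bar>indicator A x - g x\<bar>) < e / (norm c + 1)"
    using approx_continuous_indicator[of A "e / (norm c + 1)"] base.hyps by auto
  have "(LINT x|lborel. norm (indicator A x *\<^sub>R c - g x *\<^sub>R c)) = (LINT x|lborel. \<bar>indicator A x - g x\<bar> * norm c)"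
    by (simp flip: scaleR_left.diff)
  also have "\<dots> = (LINT x|lborel. \<bar>indicator A x - g x\<bar>) * norm c" by simp
  also have "\<dots> \<le> (LINT x|lborel. \<bar>indicator A x - g x\<bar>) * (norm c + 1)"
    by (intro mult_left_mono) (auto simp: Bochner_Integration.integral_nonneg)
  also have "\<dots> < e" using g(3) by (simp add: pos_less_divide_eq add_nonneg_pos)
  finally show ?case
    using g by (intro exI[of _ "\<lambda>x. g x *\<^sub>R c"]) (auto intro!: continuous_intros)
next
  case (add f1 f2)
  obtain g1 where g1: "continuous_on UNIV g1" "integrable lborel g1" "(LINT x|lborel. norm (f1 x - g1 x)) < e / 2"
    using add.IH(1)[of "e / 2"] add.prems by auto
  obtain g2 where g2: "continuous_on UNIV g2" "integrable lborel g2" "(LINT x|lborel. norm (f2 x - g2 x)) < e / 2"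
    using add.IH(2)[of "e / 2"] add.prems by auto
  have "(LINT x|lborel. norm (f1 x + f2 x - (g1 x + g2 x))) \<le> (LINT x|lborel. norm (f1 x - g1 x) + norm (f2 x - g2 x))"
  proof (rule integral_mono)
    show "norm (f1 x + f2 x - (g1 x + g2 x)) \<le> norm (f1 x - g1 x) + norm (f2 x - g2 x)" for x
      by (rule norm_diff_triangle_ineq)
  qed (use add.hyps g1 g2 in auto)
  also have "\<dots> < e" using add.hyps g1 g2 by simp
  finally show ?case
    using g1 g2 by (intro exI[of _ "\<lambda>x. g1 x + g2 x"]) (auto intro!: continuous_intros)
next
  case (lim f s)
  have "(\<lambda>i. LINT x|lborel. norm (f x - s i x)) \<longlonglongrightarrow> (LINT (x::real)|lborel. (0::real))"
  \<comment> \<open>The induction rule supplies |s i| \<le> 2 |f|, whence |f - s i| \<le> 3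
    |f|.\<close>
  proof (rule integral_dominated_convergence[where w = "\<lambda>x. 3 * norm (f x)"])
    show "AE x in lborel. (\<lambda>i. norm (f x - s i x)) \<longlonglongrightarrow> 0"
    proof (rule AE_I2)
      fix x :: real
      have "(\<lambda>i. norm (f x - s i x)) \<longlonglongrightarrow> norm (f x - f x)"
        using lim.hyps(2) by (intro tendsto_intros) auto
      then show "(\<lambda>i. norm (f x - s i x)) \<longlonglongrightarrow> 0" by simp
    qed
    show "AE x in lborel. norm (norm (f x - s i x)) \<le> 3 * norm (f x)" for i
    proof (rule AE_I2)
      show "norm (norm (f x - s i x)) \<le> 3 * norm (f x)" for x
        using norm_triangle_ineq4[of "f x" "s i x"] lim.hyps(3)[of x i] by simp
    qed
  qed (use lim.hyps in auto)
  then have "\<forall>\<^sub>F i in sequentially. (LINT x|lborel. norm (f x - s i x)) < e / 2"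
    using lim.prems by (intro order_tendstoD(2)) auto
  then obtain i where i: "(LINT x|lborel. norm (f x - s i x)) < e / 2"
    by (auto simp: eventually_sequentially)
  obtain g where g: "continuous_on UNIV g" "integrable lborel g" "(LINT x|lborel. norm (s i x - g x)) < e / 2"
    using lim.IH[of "e / 2" i] lim.prems by auto
  have "(LINT x|lborel. norm (f x - g x)) \<le> (LINT x|lborel. norm (f x - s i x) + norm (s i x - g x))"
  proof (rule integral_mono)
    show "norm (f x - g x) \<le> norm (f x - s i x) + norm (s i x - g x)" for x
      using norm_triangle_ineq[of "f x - s i x" "s i x - g x"] by simp
  qed (use lim.hyps g in auto)
  also have "\<dots> < e" using lim.hyps g i by simp
  finally show ?case using g by blast
qed

lemma integrable_potential_mult:
  fixes V :: "real \<Rightarrow> real" and u :: "real \<Rightarrow> complex"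
  assumes "integrable lborel V" "u \<in> borel_measurable borel" "\<And>x. cmod (u x) \<le> B"
  shows "integrable lborel (\<lambda>x. of_real (V x) * u x)"
    and "(LINT x|lborel. cmod (of_real (V x) * u x)) \<le> (LINT x|lborel. \<bar>V x\<bar>) * B"
proof -
  have "integrable lborel (\<lambda>x. u x * of_real (V x))"
    by (rule integrable_mult_bounded[where B = B]) (use assms in auto)
  then show i: "integrable lborel (\<lambda>x. of_real (V x) * u x)" by (simp add: mult.commute)
  have "(LINT x|lborel. cmod (of_real (V x) * u x)) \<le> (LINT x|lborel. \<bar>V x\<bar> * B)"
    using i assms by (intro integral_mono integrable_norm integrable_mult_left)
      (auto simp: norm_mult intro: mult_left_mono)
  then show "(LINT x|lborel. cmod (of_real (V x) * u x)) \<le> (LINT x|lborel. \<bar>V x\<bar>) * B" by simp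
qed

lemma continuous_apriori_const: "isCont apriori_const A"
proof -
  have "continuous_on UNIV apriori_const"
    unfolding apriori_const_def[abs_def] using exp_minus_1_less_2 by (intro continuous_intros) auto
  then show ?thesis by (simp add: continuous_on_eq_continuous_at)
qed

text \<open>The integral equation in place of the differential one: it makes sense for V and f
  merely integrable, and L^1 errors in the data become sup-norm errors in u. Equality at every x
  singles out the continuous representative.\<close>

definition is_solution :: "complex \<Rightarrow> (real \<Rightarrow> real) \<Rightarrow> (real \<Rightarrow> complex) \<Rightarrow> (real \<Rightarrow> complex) \<Rightarrow> bool" where
  "is_solution w V f u \<longleftrightarrow> continuous_on UNIV u \<and> bounded (range u) \<and>
     (\<forall>x. u x = green w (\<lambda>y. f y - of_real (V y) * u y) x)"

lemma is_solutionD: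
  assumes "is_solution w V f u"
  shows "continuous_on UNIV u" "bounded (range u)" "u x = green w (\<lambda>y. f y - of_real (V y) * u y) x"
    "u \<in> borel_measurable borel"
proof -
  show "continuous_on UNIV u" "bounded (range u)" "u x = green w (\<lambda>y. f y - of_real (V y) * u y) x"
    using assms unfolding is_solution_def by blast+
  then show "u \<in> borel_measurable borel" by (intro borel_measurable_continuous_onI)
qed

lemma is_solution_integrable:
  assumes "is_solution w V f u" "integrable lborel V"
  shows "integrable lborel (\<lambda>y. of_real (V y) * u y)"
proof -
  obtain B where "\<And>x. cmod (u x) \<le> B"
    using is_solutionD(2)[OF assms(1)] unfolding bounded_iff by blast
  then show ?thesis
    using integrable_potential_mult(1)[OF assms(2) is_solutionD(4)[OF assms(1)]] by blast
qed

context
  fixes w :: complex and E \<epsilon> :: real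
  assumes w: "Re w < 0" and w2: "w\<^sup>2 = - Complex E \<epsilon>" and \<epsilon>: "0 < \<epsilon>" "2 * \<epsilon> \<le> E"
begin

text \<open>No approximate problem is solved; the given u is perturbed instead. Inserting continuous
  V' and f' into the right-hand side changes it by d, small in L^1, hence changes u by e =
  \<open>green w d\<close>, uniformly small. The remainder v = u - e is a classical solution to
  which \<open>apriori_continuous\<close> applies, and \<delta> tends to 0.\<close>

lemma apriori:
  fixes V :: "real \<Rightarrow> real"
  assumes sol: "is_solution w V f u" and Vi: "integrable lborel V" and fi: "integrable lborel f"
  shows "sqrt E * cmod (u x) \<le> apriori_const ((LINT x|lborel. \<bar>V x\<bar>) / sqrt E) * (LINT x|lborel. cmod (f x))"
proof -
  define N \<Phi> where "N = (LINT x|lborel. \<bar>V x\<bar>)" and "\<Phi> = (LINT x|lborel. cmod (f x))"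
  have E: "0 < E" using \<epsilon> by simp
  have wn: "0 < cmod w" using w by auto
  note uc = is_solutionD(1)[OF sol] and ueq = is_solutionD(3)[OF sol]
  obtain B where B: "\<And>x. cmod (u x) \<le> B"
    using is_solutionD(2)[OF sol] unfolding bounded_iff by blast
  have B0: "0 \<le> B" using norm_ge_zero B order_trans by blast
  have um [measurable]: "u \<in> borel_measurable borel" using uc by (rule borel_measurable_continuous_onI)
  have step: "sqrt E * cmod (u x) \<le> sqrt E * (\<delta> * (1 + B) / cmod w) +
      apriori_const ((N + \<delta>) / sqrt E) * (\<Phi> + \<delta> + (N + \<delta>) * (\<delta> * (1 + B) / cmod w))" if \<delta>: "0 < \<delta>" for \<delta>
  proof -
    define \<eta> where "\<eta> = \<delta> * (1 + B) / cmod w"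
    obtain V' :: "real \<Rightarrow> real" where V': "continuous_on UNIV V'" "integrable lborel V'" "(LINT x|lborel. norm (V x - V' x)) < \<delta>"
      using approx_continuous_integrable[OF Vi \<delta>] by blast
    obtain f' where f': "continuous_on UNIV f'" "integrable lborel f'" "(LINT x|lborel. norm (f x - f' x)) < \<delta>"
      using approx_continuous_integrable[OF fi \<delta>] by blast
    have dV: "integrable lborel (\<lambda>x. V x - V' x)" using Vi V' by simp
    note Vu = integrable_potential_mult[OF Vi um B] and V'u = integrable_potential_mult[OF V'(2) um B]
      and dVu = integrable_potential_mult[OF dV um B]
    define d where "d y = (f y - f' y) - of_real (V y - V' y) * u y" for y
    have di: "integrable lborel d" unfolding d_def[abs_def] using fi f' dVu by simp
    have dn: "(LINT x|lborel. cmod (d x)) \<le> \<delta> * (1 + B)"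
    proof -
      have "(LINT x|lborel. cmod (d x)) \<le> (LINT x|lborel. cmod (f x - f' x) + cmod (of_real (V x - V' x) * u x))"
        using di fi f' dVu by (intro integral_mono) (auto simp: d_def norm_triangle_ineq4 simp del: of_real_diff)
      also have "\<dots> = (LINT x|lborel. cmod (f x - f' x)) + (LINT x|lborel. cmod (of_real (V x - V' x) * u x))"
        using fi f' dVu by (intro Bochner_Integration.integral_add) auto
      also have "\<dots> \<le> \<delta> + \<delta> * B"
      proof -
        have "(LINT x|lborel. \<bar>V x - V' x\<bar>) * B \<le> \<delta> * B" using V'(3) B0 by (intro mult_right_mono) auto
        then show ?thesis using dVu(2) f'(3) by linarith
      qed
      finally show ?thesis by (simp add: algebra_simps)
    qed
    define e where "e = green w d"
    have e\<eta>: "cmod (e x) \<le> \<eta>" for x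
      using norm_green_le[OF w di, of x] dn wn unfolding e_def \<eta>_def
      by (meson divide_right_mono norm_ge_zero order_trans)
    have ec: "continuous_on UNIV e" unfolding e_def by (rule continuous_green[OF w di])
    then have em: "e \<in> borel_measurable borel" by (rule borel_measurable_continuous_onI)
    define r where "r y = f' y - of_real (V' y) * u y" for y
    have ri: "integrable lborel r" unfolding r_def[abs_def] using f' V'u by simp
    have rc: "continuous_on UNIV r" unfolding r_def[abs_def] by (intro continuous_intros f' V' uc)
    define v where "v = green w r"
    have v: "v x = u x - e x" for x
    proof -
      have "green w (\<lambda>y. (f y - of_real (V y) * u y) - d y) x = u x - e x"
        unfolding e_def ueq[of x] by (rule green_diff[OF w]) (use fi Vu di in auto)
      moreover have "(\<lambda>y. (f y - of_real (V y) * u y) - d y) = r" by (auto simp: d_def r_def algebra_simps)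
      ultimately show ?thesis by (simp add: v_def)
    qed
    \<comment> \<open>Since u = v + e, the forcing f' - V' u equals f2 - V' v: v solves the equation
      with potential V' and data f2 exactly.\<close>
    define f2 where "f2 y = f' y - of_real (V' y) * e y" for y
    note V'e = integrable_potential_mult[OF V'(2) em e\<eta>]
    have f2i: "integrable lborel f2" unfolding f2_def[abs_def] using f' V'e by simp
    have "sqrt E * cmod (v x) \<le> apriori_const ((LINT x|lborel. \<bar>V' x\<bar>) / sqrt E) * (LINT x|lborel. cmod (f2 x))"
    proof (rule apriori_continuous[OF \<epsilon> V'(1) _ V'(2) f2i, where g = "dgreen w r" and u = v])
      show "continuous_on UNIV f2" unfolding f2_def[abs_def] by (intro continuous_intros f' V' ec)
      show "(v has_vector_derivative dgreen w r x) (at x)" for x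
        unfolding v_def by (rule green_derivative(1)[OF w ri rc])
      show "(dgreen w r has_vector_derivative (of_real (V' x) - Complex E \<epsilon>) * v x - f2 x) (at x)" for x
        by (rule has_vector_derivative_eq_rhs[OF green_derivative(2)[OF w ri rc]])
          (simp add: w2 v_def[symmetric], simp add: v f2_def r_def algebra_simps)
      let ?B = "(LINT y|lborel. cmod (r y)) / cmod w + (LINT y|lborel. cmod (r y))"
      show "cmod (v x) \<le> ?B" for x
        unfolding v_def by (intro add_increasing2[OF _ norm_green_le[OF w ri]]) auto
      show "cmod (dgreen w r x) \<le> ?B" for x
        using wn by (intro add_increasing[OF _ norm_dgreen_le[OF w ri]]) auto
    qed (unfold v_def, (rule integrable_green[OF w ri] tendsto_green[OF w ri])+)
    also have "\<dots> \<le> apriori_const ((N + \<delta>) / sqrt E) * (\<Phi> + \<delta> + (N + \<delta>) * \<eta>)"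
    proof -
      have N': "(LINT x|lborel. \<bar>V' x\<bar>) \<le> N + \<delta>"
      proof -
        have "(LINT x|lborel. \<bar>V' x\<bar>) \<le> (LINT x|lborel. \<bar>V x\<bar> + norm (V x - V' x))"
          using Vi V'(2) dV by (intro integral_mono) auto
        also have "\<dots> \<le> N + \<delta>" using Vi dV V'(3) by (simp add: N_def)
        finally show ?thesis .
      qed
      have \<eta>0: "0 \<le> \<eta>" using e\<eta> norm_ge_zero order_trans by blast
      have "(LINT x|lborel. cmod (f2 x)) \<le> (LINT x|lborel. cmod (f x) + (cmod (f x - f' x) + cmod (of_real (V' x) * e x)))"
      proof (rule integral_mono)
        fix x
        have "cmod (f2 x) \<le> cmod (f' x) + cmod (of_real (V' x) * e x)"
          unfolding f2_def by (rule norm_triangle_ineq4)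
        moreover have "cmod (f' x) \<le> cmod (f x) + cmod (f x - f' x)"
          using norm_triangle_ineq4[of "f x" "f x - f' x"] by simp
        ultimately show "cmod (f2 x) \<le> cmod (f x) + (cmod (f x - f' x) + cmod (of_real (V' x) * e x))" by linarith
      qed (use f2i fi f' V'e in \<open>auto intro!: Bochner_Integration.integrable_add\<close>)
      also have "\<dots> = \<Phi> + ((LINT x|lborel. cmod (f x - f' x)) + (LINT x|lborel. cmod (of_real (V' x) * e x)))"
        using fi f' V'e(1) by (simp add: \<Phi>_def del: norm_mult)
      also have "\<dots> \<le> \<Phi> + (\<delta> + (N + \<delta>) * \<eta>)"
        using f'(3) order_trans[OF V'e(2) mult_right_mono[OF N' \<eta>0]] by linarith
      finally show ?thesis
        using N' apriori_const_pos E
        by (intro mult_mono apriori_const_mono divide_right_mono) (auto intro: less_imp_le)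
    qed
    finally have *: "sqrt E * cmod (v x) \<le> apriori_const ((N + \<delta>) / sqrt E) * (\<Phi> + \<delta> + (N + \<delta>) * \<eta>)" .
    have "cmod (u x) \<le> cmod (e x) + cmod (v x)"
      using norm_triangle_ineq[of "e x" "v x"] by (simp add: v)
    then have "cmod (u x) \<le> \<eta> + cmod (v x)" using e\<eta>[of x] by linarith
    then have "sqrt E * cmod (u x) \<le> sqrt E * (\<eta> + cmod (v x))" using E by (intro mult_left_mono) auto
    with * show ?thesis unfolding \<eta>_def by (simp add: distrib_left)
  qed
  let ?G = "\<lambda>\<delta>. sqrt E * (\<delta> * (1 + B) / cmod w) +
      apriori_const ((N + \<delta>) / sqrt E) * (\<Phi> + \<delta> + (N + \<delta>) * (\<delta> * (1 + B) / cmod w))"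
  have "(?G \<longlongrightarrow> sqrt E * (0 * (1 + B) / cmod w) +
      apriori_const ((N + 0) / sqrt E) * (\<Phi> + 0 + (N + 0) * (0 * (1 + B) / cmod w))) (at_right 0)"
    using wn E by (intro tendsto_intros isCont_tendsto_compose[OF continuous_apriori_const]) auto
  moreover have "\<forall>\<^sub>F \<delta> in at_right 0. sqrt E * cmod (u x) \<le> ?G \<delta>"
    using eventually_at_right_less[of "0::real"] by eventually_elim (rule step)
  ultimately show ?thesis
    unfolding N_def[symmetric] \<Phi>_def[symmetric]
    using tendsto_lowerbound[of ?G _ "at_right 0" "sqrt E * cmod (u x)"] by simp
qed

lemma is_solution_diff:
  assumes "is_solution w V f1 u1" "is_solution w V f2 u2"
    and "integrable lborel V" "integrable lborel f1" "integrable lborel f2"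
  shows "is_solution w V (\<lambda>y. f1 y - f2 y) (\<lambda>y. u1 y - u2 y)"
proof -
  have "u1 x - u2 x = green w (\<lambda>y. f1 y - f2 y - of_real (V y) * (u1 y - u2 y)) x" for x
  proof -
    have "u1 x - u2 x = green w (\<lambda>y. (f1 y - of_real (V y) * u1 y) - (f2 y - of_real (V y) * u2 y)) x"
      unfolding is_solutionD(3)[OF assms(1), of x] is_solutionD(3)[OF assms(2), of x]
      by (rule green_diff[OF w, symmetric]; intro Bochner_Integration.integrable_diff assms is_solution_integrable[OF assms(1,3)] is_solution_integrable[OF assms(2,3)])
    moreover have "(\<lambda>y. (f1 y - of_real (V y) * u1 y) - (f2 y - of_real (V y) * u2 y)) =
        (\<lambda>y. f1 y - f2 y - of_real (V y) * (u1 y - u2 y))" by (auto simp: algebra_simps)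
    ultimately show ?thesis by simp
  qed
  moreover have "continuous_on UNIV (\<lambda>y. u1 y - u2 y)" "bounded (range (\<lambda>y. u1 y - u2 y))"
    using is_solutionD(1,2)[OF assms(1)] is_solutionD(1,2)[OF assms(2)]
    by (auto intro!: continuous_on_diff bounded_minus_comp)
  ultimately show ?thesis unfolding is_solution_def by blast
qed

text \<open>
  Method of continuity: the a priori bound is uniform along \<open>t V\<close> for \<open>0 \<le> t \<le> 1\<close>, so solvability
  propagates from \<open>t = 0\<close> to \<open>t = 1\<close> in finitely many contraction steps of fixed length.
\<close>

lemma solution_step:
  fixes V :: "real \<Rightarrow> real"
  assumes Vi: "integrable lborel V" and t: "0 \<le> t" "t \<le> 1" and s: "0 \<le> s"
    and small: "apriori_const ((LINT x|lborel. \<bar>V x\<bar>) / sqrt E) / sqrt E * (s * (LINT x|lborel. \<bar>V x\<bar>)) \<le> 1 / 2"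
    and ex: "\<And>f. integrable lborel f \<Longrightarrow> \<exists>u. is_solution w (\<lambda>x. t * V x) f u"
    and fi: "integrable lborel f"
  shows "\<exists>u. is_solution w (\<lambda>x. (t + s) * V x) f u"
proof -
  have E: "0 < E" using \<epsilon> by simp
  define N K where "N = (LINT x|lborel. \<bar>V x\<bar>)" and "K = apriori_const (N / sqrt E) / sqrt E"
  have K0: "0 \<le> K" using apriori_const_pos[of "N / sqrt E"] E by (simp add: K_def)
  have N0: "0 \<le> N" by (simp add: N_def)
  define R where "R f = (SOME u. is_solution w (\<lambda>x. t * V x) f u)" for f
  have R: "is_solution w (\<lambda>x. t * V x) f (R f)" if "integrable lborel f" for f
    unfolding R_def using ex[OF that] by (rule someI_ex)
  have tV: "integrable lborel (\<lambda>x. t * V x)" using Vi by simp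
  have bound: "cmod (u x) \<le> K * (LINT x|lborel. cmod (f x))"
    if "is_solution w (\<lambda>x. t * V x) f u" "integrable lborel f" for f u x
  proof -
    have "(LINT x|lborel. \<bar>t * V x\<bar>) = t * N" using t by (simp add: abs_mult N_def)
    also have "\<dots> \<le> N" using t N0 by (simp add: mult_left_le_one_le)
    finally have "apriori_const ((LINT x|lborel. \<bar>t * V x\<bar>) / sqrt E) \<le> apriori_const (N / sqrt E)"
      using E by (intro apriori_const_mono divide_right_mono) auto
    then have "sqrt E * cmod (u x) \<le> apriori_const (N / sqrt E) * (LINT x|lborel. cmod (f x))"
      using apriori[OF that(1) tV that(2), of x] by (meson mult_right_mono order_trans Bochner_Integration.integral_nonneg norm_ge_zero)
    then show ?thesis using E by (simp add: K_def field_simps)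
  qed
  \<comment> \<open>The increment s V is moved to the data: a fixed point of U \<mapsto> R (f - s V
    U) solves the problem at t + s. The a priori bound at t, applied to differences, gives the
    contraction factor 1/2.\<close>
  define rhs where "rhs U = (\<lambda>y. f y - of_real (s * V y) * apply_bcontfun U y)" for U :: "real \<Rightarrow>\<^sub>C complex"
  have sV: "integrable lborel (\<lambda>x. s * V x)" using Vi by simp
  have Um: "apply_bcontfun U \<in> borel_measurable borel" for U :: "real \<Rightarrow>\<^sub>C complex"
    by (intro borel_measurable_continuous_onI) simp
  have UB: "cmod (apply_bcontfun U x) \<le> norm U" for U :: "real \<Rightarrow>\<^sub>C complex" and x by (rule norm_bounded)
  have rhsi: "integrable lborel (rhs U)" for U
    unfolding rhs_def using fi integrable_potential_mult(1)[OF sV Um UB] by simp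
  define T where "T U = Bcontfun (R (rhs U))" for U :: "real \<Rightarrow>\<^sub>C complex"
  have T: "apply_bcontfun (T U) = R (rhs U)" for U
    unfolding T_def using is_solutionD(1,2)[OF R[OF rhsi[of U]]] by (intro Bcontfun_inverse) (simp add: bcontfun_def)
  have "\<exists>!U. T U = U"
  proof (rule banach_fix_type)
    show "(0::real) \<le> 1 / 2" "(1 / 2 :: real) < 1" by auto
    show "\<forall>U W. dist (T U) (T W) \<le> 1 / 2 * dist U W"
    proof (intro allI dist_bound)
      fix U W :: "real \<Rightarrow>\<^sub>C complex" and x
      have "is_solution w (\<lambda>x. t * V x) (\<lambda>y. rhs U y - rhs W y) (\<lambda>y. R (rhs U) y - R (rhs W) y)"
        by (intro is_solution_diff R rhsi tV)
      then have "cmod (R (rhs U) x - R (rhs W) x) \<le> K * (LINT x|lborel. cmod (rhs U x - rhs W x))"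
        using rhsi by (intro bound) auto
      also have "(\<lambda>x. cmod (rhs U x - rhs W x)) = (\<lambda>x. cmod (of_real (s * V x) * apply_bcontfun (U - W) x))"
        by (auto simp: rhs_def norm_minus_commute fun_eq_iff algebra_simps simp flip: norm_mult)
      also have "(LINT x|lborel. cmod (of_real (s * V x) * apply_bcontfun (U - W) x)) \<le> (LINT x|lborel. \<bar>s * V x\<bar>) * norm (U - W)"
        by (rule integrable_potential_mult(2)[OF sV Um UB])
      also have "K * ((LINT x|lborel. \<bar>s * V x\<bar>) * norm (U - W)) = K * (s * N) * norm (U - W)"
        using s by (simp add: abs_mult N_def)
      also have "\<dots> \<le> 1 / 2 * norm (U - W)"
        using small unfolding K_def N_def by (intro mult_right_mono) auto
      finally show "dist (apply_bcontfun (T U) x) (apply_bcontfun (T W) x) \<le> 1 / 2 * dist U W"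
        using K0 by (simp add: T dist_norm mult_left_mono)
    qed
  qed
  then obtain U where U: "T U = U" by blast
  have *: "is_solution w (\<lambda>x. t * V x) (rhs U) (apply_bcontfun U)"
    using R[OF rhsi[of U]] T[of U] U by simp
  have eq: "(\<lambda>y. f y - of_real ((t + s) * V y) * apply_bcontfun U y) =
      (\<lambda>y. rhs U y - of_real (t * V y) * apply_bcontfun U y)"
    by (simp add: rhs_def fun_eq_iff algebra_simps)
  have "is_solution w (\<lambda>x. (t + s) * V x) f (apply_bcontfun U)"
    using * unfolding is_solution_def eq .
  then show ?thesis by blast
qed

lemma solution_exists:
  fixes V :: "real \<Rightarrow> real"
  assumes Vi: "integrable lborel V" and fi: "integrable lborel f"
  shows "\<exists>u. is_solution w V f u"
proof -
  define C where "C = apriori_const ((LINT x|lborel. \<bar>V x\<bar>) / sqrt E) / sqrt E * (LINT x|lborel. \<bar>V x\<bar>)"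
  obtain M :: nat where M: "2 * C < real M" using reals_Archimedean2 by blast
  \<comment> \<open>The successor keeps the denominator positive. As C is formed with the full
    potential, one step length 1/M' serves every stage.\<close>
  define M' where "M' = Suc M"
  have sm: "apriori_const ((LINT x|lborel. \<bar>V x\<bar>) / sqrt E) / sqrt E * (1 / real M' * (LINT x|lborel. \<bar>V x\<bar>)) \<le> 1 / 2"
  proof -
    have "C / real M' \<le> 1 / 2" using M by (simp add: M'_def field_simps)
    then show ?thesis by (simp add: C_def)
  qed
  have "\<exists>u. is_solution w (\<lambda>x. real n / real M' * V x) f u" if "n \<le> M'" "integrable lborel f" for n f
    using that
  proof (induction n arbitrary: f)
    case 0
    have "bounded (range (green w f))"
      unfolding bounded_iff using norm_green_le[OF w 0(2)] by blast
    then have "is_solution w (\<lambda>x. real 0 / real M' * V x) f (green w f)"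
      using continuous_green[OF w 0(2)] by (simp add: is_solution_def)
    then show ?case by blast
  next
    case (Suc n)
    have "\<exists>u. is_solution w (\<lambda>x. (real n / real M' + 1 / real M') * V x) f u"
      by (rule solution_step[OF Vi _ _ _ sm]) (use Suc in \<open>auto simp: M'_def\<close>)
    moreover have "real n / real M' + 1 / real M' = real (Suc n) / real M'" by (simp add: add_divide_distrib)
    ultimately show ?case by simp
  qed
  from this[of M' f] fi show ?thesis by (simp add: M'_def)
qed

end

section \<open>Test functions and weak uniqueness\<close>

definition smooth :: "(real \<Rightarrow> real) \<Rightarrow> bool" where
  "smooth f \<longleftrightarrow> (\<forall>n. (deriv ^^ n) f differentiable_on UNIV)"

text \<open>Smoothness of a product then follows by rule induction, without the Leibniz formula.\<close>

inductive_set gen_alg :: "(real \<Rightarrow> real) set \<Rightarrow> (real \<Rightarrow> real) set" for G where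
  base: "g \<in> G \<Longrightarrow> g \<in> gen_alg G"
| const: "(\<lambda>x. c) \<in> gen_alg G"
| add: "f \<in> gen_alg G \<Longrightarrow> g \<in> gen_alg G \<Longrightarrow> (\<lambda>x. f x + g x) \<in> gen_alg G"
| mult: "f \<in> gen_alg G \<Longrightarrow> g \<in> gen_alg G \<Longrightarrow> (\<lambda>x. f x * g x) \<in> gen_alg G"
| affine: "f \<in> gen_alg G \<Longrightarrow> (\<lambda>x. f (a * x + b)) \<in> gen_alg G"

lemma gen_alg_deriv:
  assumes G: "\<And>g. g \<in> G \<Longrightarrow> \<exists>g' \<in> gen_alg G. \<forall>x. (g has_real_derivative g' x) (at x)"
    and f: "f \<in> gen_alg G"
  shows "\<exists>f' \<in> gen_alg G. \<forall>x. (f has_real_derivative f' x) (at x)"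
  using f
proof (induction rule: gen_alg.induct)
  case (base g) then show ?case by (rule G)
next
  case (const c) show ?case by (rule bexI[OF _ gen_alg.const[of 0]]) simp
next
  case (add f g)
  then obtain f' g' where "f' \<in> gen_alg G" "g' \<in> gen_alg G"
    and *: "\<And>x. (f has_real_derivative f' x) (at x)" "\<And>x. (g has_real_derivative g' x) (at x)" by blast
  then show ?case
    by (intro bexI[of _ "\<lambda>x. f' x + g' x"] allI DERIV_add * gen_alg.add)
next
  case (mult f g)
  then obtain f' g' where "f' \<in> gen_alg G" "g' \<in> gen_alg G"
    and *: "\<And>x. (f has_real_derivative f' x) (at x)" "\<And>x. (g has_real_derivative g' x) (at x)" by blast
  then show ?case using mult.hyps
    by (intro bexI[of _ "\<lambda>x. f' x * g x + g' x * f x"] allI DERIV_mult * gen_alg.add gen_alg.mult)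
next
  case (affine f a b)
  then obtain f' where f': "f' \<in> gen_alg G" and *: "\<And>x. (f has_real_derivative f' x) (at x)" by blast
  have "((\<lambda>x. f (a * x + b)) has_real_derivative f' (a * x + b) * a) (at x)" for x
    by (rule DERIV_chain2[OF *]) (auto intro!: derivative_eq_intros)
  then show ?case
    by (intro bexI[OF _ gen_alg.mult[OF gen_alg.affine[OF f'] gen_alg.const[of a]]] allI)
qed

text \<open>The algebra is closed under \<open>deriv\<close> once the derivatives of its generators
  lie in it, so all iterated derivatives of f stay among differentiable functions.\<close>

lemma smooth_gen_alg:
  assumes G: "\<And>g. g \<in> G \<Longrightarrow> \<exists>g' \<in> gen_alg G. \<forall>x. (g has_real_derivative g' x) (at x)"
    and f: "f \<in> gen_alg G"
  shows "smooth f"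
proof -
  have d: "deriv g \<in> gen_alg G \<and> g differentiable_on UNIV" if g: "g \<in> gen_alg G" for g
  proof -
    obtain g' where g': "g' \<in> gen_alg G" "\<And>x. (g has_real_derivative g' x) (at x)"
      using gen_alg_deriv[OF G g] by blast
    then have "deriv g = g'" by (auto intro: DERIV_imp_deriv)
    moreover have "g differentiable_on UNIV"
      using g'(2) by (auto simp: differentiable_on_def real_differentiable_def intro: has_field_derivative_at_within)
    ultimately show ?thesis using g'(1) by simp
  qed
  have "(deriv ^^ n) f \<in> gen_alg G" for n by (induction n) (use f d in auto)
  then show ?thesis using d by (auto simp: smooth_def)
qed

lemma smooth_DERIV: "smooth f \<Longrightarrow> ((deriv ^^ n) f has_real_derivative (deriv ^^ Suc n) f x) (at x)"
proof -
  assume "smooth f"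
  then have "(deriv ^^ n) f differentiable (at x)" by (auto simp: smooth_def differentiable_on_def)
  then show ?thesis by (simp add: DERIV_deriv_iff_real_differentiable)
qed

lemma smooth_mult_affine:
  assumes "smooth f" "smooth g"
  shows "smooth (\<lambda>x. f (a * x + b) * g (c * x + d))"
proof (rule smooth_gen_alg)
  let ?G = "range (\<lambda>n. (deriv ^^ n) f) \<union> range (\<lambda>n. (deriv ^^ n) g)"
  show "\<exists>h' \<in> gen_alg ?G. \<forall>x. (h has_real_derivative h' x) (at x)" if "h \<in> ?G" for h
    using that smooth_DERIV[OF assms(1)] smooth_DERIV[OF assms(2)] by (blast intro: gen_alg.base)
  have "f \<in> ?G" "g \<in> ?G" using rangeI[of "\<lambda>n. (deriv ^^ n) f" 0] rangeI[of "\<lambda>n. (deriv ^^ n) g" 0] by auto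
  then show "(\<lambda>x. f (a * x + b) * g (c * x + d)) \<in> gen_alg ?G"
    by (rule gen_alg.mult[OF gen_alg.affine gen_alg.affine, OF gen_alg.base gen_alg.base])
qed

text \<open>The standard smooth non-analytic function is \<open>flat 0\<close>. The whole family is
  taken because differentiating \<open>flat n\<close> leads to \<open>flat (n + 1)\<close> and
  \<open>flat (n + 2)\<close>, which is what \<open>gen_alg\<close> requires.\<close>

definition flat :: "nat \<Rightarrow> real \<Rightarrow> real" where
  "flat n x = (if 0 < x then (1 / x) ^ n * exp (- (1 / x)) else 0)"

lemma flat_tendsto_0: "(flat n \<longlongrightarrow> 0) (at 0)"
proof -
  have "((\<lambda>y::real. y ^ n / exp y) \<longlongrightarrow> 0) at_top" by (rule tendsto_power_div_exp_0)
  then have "((\<lambda>x::real. inverse x ^ n / exp (inverse x)) \<longlongrightarrow> 0) (at_right 0)"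
    by (rule filterlim_compose[OF _ filterlim_inverse_at_top_right])
  then have "(flat n \<longlongrightarrow> 0) (at_right 0)"
    by (rule Lim_transform_eventually)
      (use eventually_at_right_less[of "0::real"] in \<open>eventually_elim, simp add: flat_def exp_minus divide_inverse\<close>)
  moreover have "(flat n \<longlongrightarrow> 0) (at_left 0)"
    by (rule tendsto_eventually) (auto simp: flat_def eventually_at_filter)
  ultimately show ?thesis by (simp add: filterlim_split_at)
qed

lemma flat_DERIV: "(flat n has_real_derivative (- real n * flat (Suc n) x + flat (Suc (Suc n)) x)) (at x)"
proof (cases x "0::real" rule: linorder_cases)
  case less
  have "((\<lambda>x. 0) has_real_derivative 0) (at x)" by simp
  then have "(flat n has_real_derivative 0) (at x)"
    by (rule has_field_derivative_transform_within_open[where S = "{..<0}"]) (use less in \<open>auto simp: flat_def\<close>)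
  then show ?thesis using less by (simp add: flat_def)
next
  case equal
  \<comment> \<open>At 0 the difference quotient of \<open>flat n\<close> is
    \<open>flat (Suc n)\<close> itself, which tends to 0.\<close>
  have "((\<lambda>h. (flat n (0 + h) - flat n 0) / h) \<longlongrightarrow> 0) (at 0)"
    using flat_tendsto_0[of "Suc n"]
    by (rule Lim_transform_eventually) (auto simp: flat_def eventually_at_filter)
  then show ?thesis using equal by (simp add: DERIV_def flat_def)
next
  case greater
  have "((\<lambda>x. (1 / x) ^ n * exp (- (1 / x))) has_real_derivative
      (- real n * flat (Suc n) x + flat (Suc (Suc n)) x)) (at x)"
  proof -
    have i: "((\<lambda>x. 1 / x) has_real_derivative - ((1 / x)\<^sup>2)) (at x)"
      using greater by (auto intro!: derivative_eq_intros simp: power2_eq_square)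
    have p: "((\<lambda>x. (1 / x) ^ n) has_real_derivative - real n * (1 / x) ^ Suc n) (at x)"
    proof (cases n)
      case (Suc k)
      show ?thesis
        unfolding Suc by (rule DERIV_cong[OF DERIV_power_Suc[OF i]]) (use greater in \<open>simp add: power2_eq_square field_simps\<close>)
    qed simp
    have e: "((\<lambda>x. exp (- (1 / x))) has_real_derivative exp (- (1 / x)) * (1 / x)\<^sup>2) (at x)"
      by (rule DERIV_cong[OF DERIV_fun_exp[OF DERIV_minus[OF i]]]) simp
    show ?thesis
      by (rule DERIV_cong[OF DERIV_mult[OF p e]]) (use greater in \<open>simp add: flat_def power2_eq_square mult_ac\<close>)
  qed
  then show ?thesis
    by (rule has_field_derivative_transform_within_open[where S = "{0<..}"]) (use greater in \<open>auto simp: flat_def\<close>)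
qed

lemma smooth_flat: "smooth (flat n)"
proof (rule smooth_gen_alg)
  show "flat n \<in> gen_alg (range flat)" by (intro gen_alg.base rangeI)
  fix g assume "g \<in> range flat"
  then obtain k where k: "g = flat k" by blast
  have "(\<lambda>x. - real k * flat (Suc k) x + flat (Suc (Suc k)) x) \<in> gen_alg (range flat)"
    by (intro gen_alg.add gen_alg.mult gen_alg.const gen_alg.base rangeI)
  then show "\<exists>g' \<in> gen_alg (range flat). \<forall>x. (g has_real_derivative g' x) (at x)"
    unfolding k by (rule bexI[rotated]) (intro allI flat_DERIV)
qed

text \<open>Supported in [a, b]; the sharpness c is a parameter because the bumps tend to the
  indicator of the open interval as c grows.\<close>

definition bump :: "real \<Rightarrow> real \<Rightarrow> real \<Rightarrow> real \<Rightarrow> real" where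
  "bump c a b x = flat 0 (c * (x - a)) * flat 0 (c * (b - x))"

lemma test_function_smooth: "test_function \<phi> \<longleftrightarrow> smooth \<phi> \<and> (\<exists>R. \<forall>x. R < \<bar>x\<bar> \<longrightarrow> \<phi> x = 0)"
proof
  assume t: "test_function \<phi>"
  then have "bounded {x. \<phi> x \<noteq> 0}"
    unfolding test_function_def by (blast intro: bounded_subset[OF compact_imp_bounded closure_subset])
  then obtain R where "\<And>x. \<phi> x \<noteq> 0 \<Longrightarrow> \<bar>x\<bar> \<le> R" unfolding bounded_iff by auto
  then show "smooth \<phi> \<and> (\<exists>R. \<forall>x. R < \<bar>x\<bar> \<longrightarrow> \<phi> x = 0)"
    using t by (auto simp: test_function_def smooth_def intro!: exI[of _ R] dest: leD)
next
  assume s: "smooth \<phi> \<and> (\<exists>R. \<forall>x. R < \<bar>x\<bar> \<longrightarrow> \<phi> x = 0)"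
  then obtain R where R: "\<And>x. R < \<bar>x\<bar> \<Longrightarrow> \<phi> x = 0" by blast
  have "bounded {x. \<phi> x \<noteq> 0}" unfolding bounded_iff by (rule exI[of _ R]) (use R in force)
  then show "test_function \<phi>" using s by (simp add: test_function_def smooth_def)
qed

lemma bump_eq_0: "0 < c \<Longrightarrow> x \<notin> {a<..<b} \<Longrightarrow> bump c a b x = 0"
proof -
  assume "0 < c" "x \<notin> {a<..<b}"
  then have "c * (x - a) \<le> 0 \<or> c * (b - x) \<le> 0" by (auto simp: mult_le_0_iff)
  then show ?thesis by (auto simp: bump_def flat_def)
qed

lemma test_function_bump:
  assumes "0 < c" shows "test_function (bump c a b)"
  unfolding test_function_smooth
proof
  have "smooth (\<lambda>x. flat 0 (c * x + (- c * a)) * flat 0 ((- c) * x + c * b))"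
    by (rule smooth_mult_affine[OF smooth_flat smooth_flat])
  moreover have "(\<lambda>x. flat 0 (c * x + (- c * a)) * flat 0 ((- c) * x + c * b)) = bump c a b"
    by (simp add: bump_def fun_eq_iff algebra_simps)
  ultimately show "smooth (bump c a b)" by simp
  have "bump c a b x = 0" if "\<bar>a\<bar> + \<bar>b\<bar> < \<bar>x\<bar>" for x
  proof -
    have "x \<notin> {a<..<b}" using that by auto
    then show ?thesis using assms by (intro bump_eq_0)
  qed
  then show "\<exists>R. \<forall>x. R < \<bar>x\<bar> \<longrightarrow> bump c a b x = 0" by blast
qed

lemma bump_bounds: "0 \<le> bump c a b x" "bump c a b x \<le> 1"
proof -
  have "0 \<le> flat 0 x" "flat 0 x \<le> 1" for x by (auto simp: flat_def)
  then show "0 \<le> bump c a b x" "bump c a b x \<le> 1" by (auto simp: bump_def mult_le_one)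
qed

lemma bump_tendsto: "(\<lambda>n. bump (real (Suc n)) a b x) \<longlonglongrightarrow> indicator {a<..<b} x"
proof (cases "x \<in> {a<..<b}")
  case True
  have f: "(\<lambda>n. flat 0 (real (Suc n) * t)) \<longlonglongrightarrow> 1" if "0 < t" for t
  proof -
    have "(\<lambda>n. exp (- (inverse (real (Suc n)) * inverse t))) \<longlonglongrightarrow> exp (- (0 * inverse t))"
      by (intro tendsto_intros LIMSEQ_inverse_real_of_nat)
    moreover have "flat 0 (real (Suc n) * t) = exp (- (inverse (real (Suc n)) * inverse t))" for n
      using that by (simp add: flat_def divide_inverse del: of_nat_Suc)
    ultimately show ?thesis by simp
  qed
  show ?thesis
    using tendsto_mult[OF f[of "x - a"] f[of "b - x"]] True by (simp add: bump_def)
next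
  case False
  then show ?thesis by (simp add: bump_eq_0 del: of_nat_Suc)
qed

lemma test_function_deriv:
  assumes "test_function \<phi>"
  shows "test_function (deriv \<phi>)" "C1c \<phi> (deriv \<phi>)"
proof -
  obtain R where s: "smooth \<phi>" and R: "\<And>x. R < \<bar>x\<bar> \<Longrightarrow> \<phi> x = 0"
    using assms by (auto simp: test_function_smooth)
  have d: "(\<phi> has_real_derivative deriv \<phi> x) (at x)" for x using smooth_DERIV[OF s, of 0 x] by simp
  have s': "smooth (deriv \<phi>)"
    using s unfolding smooth_def by (metis comp_apply funpow_Suc_right)
  have dc: "continuous_on UNIV (deriv \<phi>)"
    using s' unfolding smooth_def by (metis differentiable_imp_continuous_on funpow_0)
  have R': "deriv \<phi> x = 0" if "R < \<bar>x\<bar>" for x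
  proof (rule DERIV_imp_deriv)
    have "open {x::real. R < \<bar>x\<bar>}" by (intro open_Collect_less continuous_intros)
    then show "(\<phi> has_real_derivative 0) (at x)"
      by (rule has_field_derivative_transform_within_open[OF DERIV_const]) (use that R in auto)
  qed
  show "test_function (deriv \<phi>)" unfolding test_function_smooth using s' R' by blast
  show "C1c \<phi> (deriv \<phi>)" unfolding C1c_def using d dc R R' by blast
qed

text \<open>Bumps converge boundedly to indicators, so d has integral 0 over every bounded open
  interval. Induction over Borel sets extends this to all of them, which forces d to vanish almost
  everywhere.\<close>

lemma fundamental_lemma:
  fixes d :: "real \<Rightarrow> complex"
  assumes [measurable]: "d \<in> borel_measurable borel"
    and loc: "\<And>N :: nat. integrable lborel (\<lambda>x. indicator {- real N..real N} x *\<^sub>R d x)"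
    and test: "\<And>\<psi>. test_function \<psi> \<Longrightarrow> (LINT x|lborel. \<psi> x *\<^sub>R d x) = 0"
  shows "AE x in lborel. d x = 0"
proof -
  have loc': "integrable lborel (\<lambda>x. indicator {a..b} x *\<^sub>R d x)" for a b :: real
  proof -
    obtain N :: nat where "\<bar>a\<bar> + \<bar>b\<bar> < real N" using reals_Archimedean2 by blast
    then have "(\<lambda>x. indicator {a..b} x *\<^sub>R d x) = (\<lambda>x. indicator {a..b} x *\<^sub>R (indicator {- real N..real N} x *\<^sub>R d x))"
      by (auto simp: fun_eq_iff indicator_def)
    then show ?thesis using integrable_mult_indicator[OF _ loc[of N], of "{a..b}"] by simp
  qed
  have int0: "(LINT x|lborel. indicator {a<..<b} x *\<^sub>R d x) = 0" for a b :: real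
  proof -
    have lim: "(\<lambda>n. LINT x|lborel. bump (real (Suc n)) a b x *\<^sub>R d x) \<longlonglongrightarrow> (LINT x|lborel. indicator {a<..<b} x *\<^sub>R d x)"
    proof (rule integral_dominated_convergence[where w = "\<lambda>x. norm (indicator {a..b} x *\<^sub>R d x)"])
      show "(\<lambda>x. bump (real (Suc n)) a b x *\<^sub>R d x) \<in> borel_measurable lborel" for n
      proof -
        have "bump (real (Suc n)) a b \<in> borel_measurable borel"
          using C1c_continuous[OF test_function_deriv(2)[OF test_function_bump]]
          by (intro borel_measurable_continuous_onI) simp
        then show ?thesis by measurable
      qed
      show "AE x in lborel. norm (bump (real (Suc n)) a b x *\<^sub>R d x) \<le> norm (indicator {a..b} x *\<^sub>R d x)" for n
      proof (rule AE_I2)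
        fix x
        show "norm (bump (real (Suc n)) a b x *\<^sub>R d x) \<le> norm (indicator {a..b} x *\<^sub>R d x)"
          using bump_bounds[of "real (Suc n)" a b x] bump_eq_0[of "real (Suc n)" x a b]
          by (cases "x \<in> {a<..<b}") (auto simp: mult_left_le_one_le simp del: of_nat_Suc)
      qed
      show "AE x in lborel. (\<lambda>n. bump (real (Suc n)) a b x *\<^sub>R d x) \<longlonglongrightarrow> indicator {a<..<b} x *\<^sub>R d x"
        by (intro AE_I2 tendsto_scaleR bump_tendsto tendsto_const)
      show "integrable lborel (\<lambda>x. norm (indicator {a..b} x *\<^sub>R d x))" by (intro integrable_norm loc')
    qed measurable
    have "(LINT x|lborel. bump (real (Suc n)) a b x *\<^sub>R d x) = 0" for n
      by (intro test test_function_bump) simp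
    with lim show ?thesis by (simp only: LIMSEQ_const_iff)
  qed
  \<comment> \<open>Truncation makes the function integrable on the whole line, as the complement
    and countable-union cases require.\<close>
  have "AE x in lborel. indicator {- real N<..<real N} x *\<^sub>R d x = 0" for N :: nat
  proof (rule sigma_finite_measure.density_zero[OF sigma_finite_lborel])
    let ?d = "\<lambda>x. indicator {- real N<..<real N} x *\<^sub>R d x"
    have "?d = (\<lambda>x. indicator {- real N<..<real N} x *\<^sub>R (indicator {- real N..real N} x *\<^sub>R d x))"
      by (auto simp: fun_eq_iff indicator_def)
    then show di: "integrable lborel ?d"
      using integrable_mult_indicator[OF _ loc[of N], of "{- real N<..<real N}"] by simp
    fix A :: "real set" assume "A \<in> sets lborel"
    then have "A \<in> sets borel" by simp
    then show "set_lebesgue_integral lborel A ?d = 0"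
    proof (induction rule: borel_set_induct)
      case empty show ?case by (simp add: set_lebesgue_integral_def)
    next
      case (interval a b)
      have "set_lebesgue_integral lborel {a..b} ?d = (LINT x|lborel. indicator {max a (- real N)<..<min b (real N)} x *\<^sub>R d x)"
        unfolding set_lebesgue_integral_def
      proof (rule integral_cong_AE)
        show "AE x in lborel. indicator {a..b} x *\<^sub>R ?d x = indicator {max a (- real N)<..<min b (real N)} x *\<^sub>R d x"
          using AE_lborel_singleton[of a] AE_lborel_singleton[of b]
          by eventually_elim (auto simp: indicator_def)
      qed measurable
      then show ?case by (simp only: int0)
    next
      case (compl A)
      have "set_lebesgue_integral lborel (- A) ?d + set_lebesgue_integral lborel A ?d = (LINT x|lborel. ?d x)"
        using set_integral_Un[of "- A" A lborel ?d] integrable_mult_indicator[OF _ di] compl.hyps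
        by (simp add: set_integrable_def set_lebesgue_integral_def)
      then show ?case using compl.IH by (simp only: int0) simp
    next
      case (union F)
      have "set_lebesgue_integral lborel (\<Union> (range F)) ?d = (\<Sum>i. set_lebesgue_integral lborel (F i) ?d)"
      proof (rule lebesgue_integral_countable_add)
        show "set_integrable lborel (\<Union> (range F)) ?d"
          unfolding set_integrable_def by (rule integrable_mult_indicator[OF _ di]) (use union in auto)
      qed (use union in \<open>auto simp: disjoint_family_on_def\<close>)
      then show ?case using union by simp
    qed
  qed
  then have "AE x in lborel. \<forall>N::nat. indicator {- real N<..<real N} x *\<^sub>R d x = 0"
    unfolding AE_all_countable by blast
  then show ?thesis
  proof eventually_elim
    case (elim x)
    obtain N :: nat where "\<bar>x\<bar> < real N" using reals_Archimedean2 by blast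
    then show ?case using elim[rule_format, of N] by (simp add: abs_less_iff)
  qed
qed

lemma integrable_test_function:
  assumes "test_function \<psi>"
  shows "integrable lborel (\<lambda>x. complex_of_real (\<psi> x))"
proof -
  obtain R where R: "\<And>x. R < \<bar>x\<bar> \<Longrightarrow> \<psi> x = 0" using assms by (auto simp: test_function_smooth)
  have "integrable lborel (\<lambda>x. complex_of_real (indicator {-R..R} x))"
    by (intro integrable_of_real integrable_real_indicator) (auto simp: emeasure_lborel_Icc_eq)
  then have "integrable lborel (\<lambda>x. of_real (\<psi> x) * complex_of_real (indicator {-R..R} x))"
    by (rule integrable_C1c_mult(1)[OF test_function_deriv(2)[OF assms]])
  moreover have "(\<lambda>x. of_real (\<psi> x) * complex_of_real (indicator {-R..R} x)) = (\<lambda>x. of_real (\<psi> x))"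
    using R by (force simp: fun_eq_iff indicator_def)
  ultimately show ?thesis by simp
qed

section \<open>Weak uniqueness for the free equation by duality\<close>

definition green_test :: "complex \<Rightarrow> (real \<Rightarrow> real) \<Rightarrow> real \<Rightarrow> complex" where
  "green_test w \<psi> = green w (\<lambda>x. of_real (\<psi> x))"

definition dgreen_test :: "complex \<Rightarrow> (real \<Rightarrow> real) \<Rightarrow> real \<Rightarrow> complex" where
  "dgreen_test w \<psi> = dgreen w (\<lambda>x. of_real (\<psi> x))"

context
  fixes w :: complex and \<psi> :: "real \<Rightarrow> real"
  assumes w: "Re w < 0" and \<psi>: "test_function \<psi>"
begin

lemma green_test_derivative:
  "(green_test w \<psi> has_vector_derivative dgreen_test w \<psi> x) (at x)" "(dgreen_test w \<psi> has_vector_derivative w\<^sup>2 * green_test w \<psi> x - of_real (\<psi> x)) (at x)"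
  unfolding green_test_def dgreen_test_def
  by (rule green_derivative[OF w integrable_test_function[OF \<psi>]],
      intro continuous_intros C1c_continuous[OF test_function_deriv(2)[OF \<psi>]])+

text \<open>The equation y'' = w^2 y - \<psi> expresses second derivatives through y and \<psi>. The
  real and imaginary parts of y and y', with all derivatives of \<psi>, therefore generate an
  algebra closed under differentiation.\<close>

lemma smooth_green_test: "smooth (\<lambda>x. Re (green_test w \<psi> x))" "smooth (\<lambda>x. Im (green_test w \<psi> x))"
proof -
  let ?G = "{\<lambda>x. Re (green_test w \<psi> x), \<lambda>x. Im (green_test w \<psi> x), \<lambda>x. Re (dgreen_test w \<psi> x), \<lambda>x. Im (dgreen_test w \<psi> x)} \<union> range (\<lambda>n. (deriv ^^ n) \<psi>)"
  have s: "smooth \<psi>" using \<psi> by (simp add: test_function_smooth)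
  have mem: "(\<lambda>x. Re (green_test w \<psi> x)) \<in> gen_alg ?G" "(\<lambda>x. Im (green_test w \<psi> x)) \<in> gen_alg ?G"
    "(\<lambda>x. Re (dgreen_test w \<psi> x)) \<in> gen_alg ?G" "(\<lambda>x. Im (dgreen_test w \<psi> x)) \<in> gen_alg ?G" "\<psi> \<in> gen_alg ?G"
    using rangeI[of "\<lambda>n. (deriv ^^ n) \<psi>" 0] by (auto intro: gen_alg.base)
  note d = green_test_derivative[unfolded has_vector_derivative_complex_iff]
  have "\<exists>g' \<in> gen_alg ?G. \<forall>x. (g has_real_derivative g' x) (at x)" if "g \<in> ?G" for g
  proof -
    consider "g = (\<lambda>x. Re (green_test w \<psi> x))" | "g = (\<lambda>x. Im (green_test w \<psi> x))" | "g = (\<lambda>x. Re (dgreen_test w \<psi> x))" | "g = (\<lambda>x. Im (dgreen_test w \<psi> x))"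
      | n where "g = (deriv ^^ n) \<psi>" using \<open>g \<in> ?G\<close> by blast
    then show ?thesis
    proof cases
      case 1
      show ?thesis unfolding 1 by (rule bexI[rotated, OF mem(3)]) (use d(1) in simp)
    next
      case 2
      show ?thesis unfolding 2 by (rule bexI[rotated, OF mem(4)]) (use d(1) in simp)
    next
      case 3
      have "(\<lambda>x. Re (w\<^sup>2) * Re (green_test w \<psi> x) + (- Im (w\<^sup>2) * Im (green_test w \<psi> x) + (-1) * \<psi> x)) \<in> gen_alg ?G"
        by (intro gen_alg.add gen_alg.mult gen_alg.const mem)
      then show ?thesis unfolding 3 by (rule bexI[rotated]) (use d(2) in \<open>simp add: algebra_simps\<close>)
    next
      case 4
      have "(\<lambda>x. Re (w\<^sup>2) * Im (green_test w \<psi> x) + Im (w\<^sup>2) * Re (green_test w \<psi> x)) \<in> gen_alg ?G"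
        by (intro gen_alg.add gen_alg.mult gen_alg.const mem)
      then show ?thesis unfolding 4 by (rule bexI[rotated]) (use d(2) in \<open>simp add: algebra_simps\<close>)
    next
      case (5 n)
      have "(deriv ^^ Suc n) \<psi> \<in> gen_alg ?G" by (rule gen_alg.base) blast
      then show ?thesis unfolding 5 by (rule bexI[rotated]) (intro allI smooth_DERIV[OF s])
    qed
  qed
  then show "smooth (\<lambda>x. Re (green_test w \<psi> x))" "smooth (\<lambda>x. Im (green_test w \<psi> x))"
    using smooth_gen_alg mem(1,2) by metis+
qed

text \<open>The weak equation is tested with F(x) = \<phi>(c x) y(x), where y is
  \<open>green_test w \<psi>\<close>. In F'' - w^2 F the terms in w^2 cancel; what is left is the
  cut-off \<psi> and the terms in which a derivative falls on the cutoff, carrying c or c^2.\<close>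

lemma green_test_weak:
  fixes \<phi> :: "real \<Rightarrow> real" and d :: "real \<Rightarrow> complex"
  assumes \<phi>: "test_function \<phi>" and dm [measurable]: "d \<in> borel_measurable borel"
    and dB: "\<And>x. cmod (d x) \<le> B"
    and weak: "\<And>\<phi>. test_function \<phi> \<Longrightarrow> (LINT x|lborel. (of_real ((deriv ^^ 2) \<phi> x) - w\<^sup>2 * of_real (\<phi> x)) * d x) = 0"
    and c: "0 < c"
  shows "(LINT x|lborel. (of_real (c\<^sup>2 * (deriv ^^ 2) \<phi> (c * x)) * green_test w \<psi> x + 2 * of_real (c * deriv \<phi> (c * x)) * dgreen_test w \<psi> x
    - of_real (\<phi> (c * x)) * of_real (\<psi> x)) * d x) = 0"
proof -
  let ?P = "\<lambda>x. \<phi> (c * x)" and ?P1 = "\<lambda>x. c * deriv \<phi> (c * x)" and ?P2 = "\<lambda>x. c\<^sup>2 * (deriv ^^ 2) \<phi> (c * x)"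
  have s: "smooth \<phi>" using \<phi> by (simp add: test_function_smooth)
  obtain R where R: "\<And>x. R < \<bar>x\<bar> \<Longrightarrow> \<phi> x = 0" using \<phi> by (auto simp: test_function_smooth)
  have P: "(?P has_real_derivative ?P1 x) (at x)" "(?P1 has_real_derivative ?P2 x) (at x)" for x
  proof -
    have "((\<lambda>x. f (c * x)) has_real_derivative f' * c) (at x)" if "(f has_real_derivative f') (at (c * x))" for f f'
      by (rule DERIV_chain2[where g = "\<lambda>x. c * x", OF that]) (auto intro!: derivative_eq_intros)
    from this[OF smooth_DERIV[OF s, of 0 "c * x"]] DERIV_cmult[OF this[OF smooth_DERIV[OF s, of 1 "c * x"]], of c]
    show "(?P has_real_derivative ?P1 x) (at x)" "(?P1 has_real_derivative ?P2 x) (at x)"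
      by (simp_all add: power2_eq_square numeral_2_eq_2 mult.assoc mult.commute)
  qed
  let ?F = "\<lambda>x. of_real (?P x) * green_test w \<psi> x" and ?F1 = "\<lambda>x. of_real (?P1 x) * green_test w \<psi> x + of_real (?P x) * dgreen_test w \<psi> x"
  let ?F2 = "\<lambda>x. of_real (?P2 x) * green_test w \<psi> x + 2 * of_real (?P1 x) * dgreen_test w \<psi> x + of_real (?P x) * (w\<^sup>2 * green_test w \<psi> x - of_real (\<psi> x))"
  have of_real: "((\<lambda>x. complex_of_real (p x)) has_vector_derivative of_real p') (at x)"
    if "(p has_real_derivative p') (at x)" for p p' x
    using that by (simp add: has_vector_derivative_complex_iff)
  have F1: "(?F has_vector_derivative ?F1 x) (at x)" for x
    using has_vector_derivative_mult[OF of_real[OF P(1)[of x]] green_test_derivative(1)[of x]]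
    by (simp add: add.commute)
  have F2: "(?F1 has_vector_derivative ?F2 x) (at x)" for x
    using has_vector_derivative_add[OF has_vector_derivative_mult[OF of_real[OF P(2)[of x]] green_test_derivative(1)[of x]]
      has_vector_derivative_mult[OF of_real[OF P(1)[of x]] green_test_derivative(2)[of x]]]
    by (rule has_vector_derivative_eq_rhs) (simp add: algebra_simps)
  have t: "test_function (\<lambda>x. Re (?F x))" "test_function (\<lambda>x. Im (?F x))"
  proof -
    have "?P x = 0" if "R / c < \<bar>x\<bar>" for x
      using that c by (intro R) (simp add: abs_mult field_simps)
    then have z: "\<exists>R. \<forall>x. R < \<bar>x\<bar> \<longrightarrow> ?P x = 0" by blast
    have "smooth (\<lambda>x. \<phi> (c * x + 0) * Re (green_test w \<psi> (1 * x + 0)))" "smooth (\<lambda>x. \<phi> (c * x + 0) * Im (green_test w \<psi> (1 * x + 0)))"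
      by (rule smooth_mult_affine[OF s smooth_green_test(1)], rule smooth_mult_affine[OF s smooth_green_test(2)])
    then have "smooth (\<lambda>x. Re (?F x))" "smooth (\<lambda>x. Im (?F x))" by simp_all
    then show "test_function (\<lambda>x. Re (?F x))" "test_function (\<lambda>x. Im (?F x))"
      unfolding test_function_smooth using z by auto
  qed
  have dd: "(deriv ^^ 2) (\<lambda>x. Re (?F x)) = (\<lambda>x. Re (?F2 x))" "(deriv ^^ 2) (\<lambda>x. Im (?F x)) = (\<lambda>x. Im (?F2 x))"
  proof -
    note D1 = F1[unfolded has_vector_derivative_complex_iff] and D2 = F2[unfolded has_vector_derivative_complex_iff]
    have "deriv (\<lambda>x. Re (?F x)) = (\<lambda>x. Re (?F1 x))" "deriv (\<lambda>x. Im (?F x)) = (\<lambda>x. Im (?F1 x))"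
      using D1 by (blast intro: DERIV_imp_deriv)+
    moreover have "deriv (\<lambda>x. Re (?F1 x)) = (\<lambda>x. Re (?F2 x))" "deriv (\<lambda>x. Im (?F1 x)) = (\<lambda>x. Im (?F2 x))"
      using D2 by (blast intro: DERIV_imp_deriv)+
    ultimately show "(deriv ^^ 2) (\<lambda>x. Re (?F x)) = (\<lambda>x. Re (?F2 x))" "(deriv ^^ 2) (\<lambda>x. Im (?F x)) = (\<lambda>x. Im (?F2 x))"
      by (simp_all add: numeral_2_eq_2)
  qed
  have int: "integrable lborel (\<lambda>x. (of_real ((deriv ^^ 2) \<theta> x) - w\<^sup>2 * of_real (\<theta> x)) * d x)" if "test_function \<theta>" for \<theta>
  proof -
    have "integrable lborel (\<lambda>x. complex_of_real ((deriv ^^ 2) \<theta> x) - w\<^sup>2 * of_real (\<theta> x))"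
      using integrable_test_function[OF that] integrable_test_function[OF test_function_deriv(1)[OF test_function_deriv(1)[OF that]]]
      by (simp add: numeral_2_eq_2)
    then have "integrable lborel (\<lambda>x. d x * (complex_of_real ((deriv ^^ 2) \<theta> x) - w\<^sup>2 * of_real (\<theta> x)))"
      by (rule integrable_mult_bounded[where B = B]) (use dB in auto)
    then show ?thesis by (simp add: mult.commute)
  qed
  \<comment> \<open>Test functions are real, so F is tested through its real and imaginary parts and
    the two identities are recombined.\<close>
  have "0 = (LINT x|lborel. (of_real (Re (?F2 x)) - w\<^sup>2 * of_real (Re (?F x))) * d x)
      + \<i> * (LINT x|lborel. (of_real (Im (?F2 x)) - w\<^sup>2 * of_real (Im (?F x))) * d x)"
    using weak[OF t(1)] weak[OF t(2)] by (simp only: dd) simp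
  also have "\<dots> = (LINT x|lborel. (of_real (Re (?F2 x)) - w\<^sup>2 * of_real (Re (?F x))) * d x +
      \<i> * ((of_real (Im (?F2 x)) - w\<^sup>2 * of_real (Im (?F x))) * d x))"
    using int[OF t(1)] int[OF t(2)] unfolding dd
    by (simp only: Bochner_Integration.integral_add integrable_mult_right integral_mult_right_zero)
  also have "\<dots> = (LINT x|lborel. (?F2 x - w\<^sup>2 * ?F x) * d x)"
  proof (rule Bochner_Integration.integral_cong[OF refl])
    have *: "(of_real (Re a) - z * of_real (Re b)) * e + \<i> * ((of_real (Im a) - z * of_real (Im b)) * e) = (a - z * b) * e"
      for a b z e :: complex
    proof -
      have "(a - z * b) * e = ((of_real (Re a) + \<i> * of_real (Im a)) - z * (of_real (Re b) + \<i> * of_real (Im b))) * e"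
        by (simp only: complex_eq[symmetric])
      then show ?thesis by (simp add: algebra_simps)
    qed
    show "(of_real (Re (?F2 x)) - w\<^sup>2 * of_real (Re (?F x))) * d x +
      \<i> * ((of_real (Im (?F2 x)) - w\<^sup>2 * of_real (Im (?F x))) * d x) = (?F2 x - w\<^sup>2 * ?F x) * d x" for x
      by (rule *)
  qed
  finally show ?thesis by (simp add: algebra_simps)
qed

end

text \<open>
  The decaying solution \<open>y\<close> of \<open>y'' - w\<^sup>2 y = - \<psi>\<close> is not compactly supported; it is cut off by
  \<open>\<kappa>(x / n)\<close>, and the commutator terms vanish in the limit.
\<close>

lemma weak_uniqueness:
  fixes d :: "real \<Rightarrow> complex"
  assumes w: "Re w < 0" and dm [measurable]: "d \<in> borel_measurable borel"
    and dB: "\<And>x. cmod (d x) \<le> B"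
    and weak: "\<And>\<phi>. test_function \<phi> \<Longrightarrow> (LINT x|lborel. (of_real ((deriv ^^ 2) \<phi> x) - w\<^sup>2 * of_real (\<phi> x)) * d x) = 0"
  shows "AE x in lborel. d x = 0"
proof (rule fundamental_lemma[OF dm])
  show "integrable lborel (\<lambda>x. indicator {- real N..real N} x *\<^sub>R d x)" for N :: nat
  proof -
    have "integrable lborel (\<lambda>x. d x * complex_of_real (indicator {- real N..real N} x))"
      by (rule integrable_mult_bounded[where B = B], intro integrable_of_real integrable_real_indicator)
        (use dB in \<open>auto simp: emeasure_lborel_Icc_eq\<close>)
    then show ?thesis by (simp add: scaleR_conv_of_real mult.commute)
  qed
  fix \<psi> assume \<psi>: "test_function \<psi>"
  define \<kappa> where "\<kappa> = bump 1 (-1) 1"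
  have \<kappa>: "test_function \<kappa>" unfolding \<kappa>_def by (rule test_function_bump) simp
  \<comment> \<open>The cutoff is not normalised to 1 at the origin; the value \<kappa>(0) survives
    the limit and is cancelled at the end.\<close>
  have \<kappa>0: "\<kappa> 0 \<noteq> 0" by (simp add: \<kappa>_def bump_def flat_def)
  note C = test_function_deriv(2)[OF \<kappa>] test_function_deriv(2)[OF test_function_deriv(1)[OF \<kappa>]]
  obtain K1 where K1: "\<And>x. \<bar>\<kappa> x\<bar> \<le> K1" "\<And>x. \<bar>deriv \<kappa> x\<bar> \<le> K1" using C1c_bounded[OF C(1)] by blast
  obtain K2 where K2: "\<And>x. \<bar>deriv (deriv \<kappa>) x\<bar> \<le> K2" using C1c_bounded[OF C(2)] by blast
  have B0: "0 \<le> B" using dB norm_ge_zero order_trans by blast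
  have K0: "0 \<le> K1" "0 \<le> K2" using K1(1)[of 0] K2[of 0] by linarith+
  let ?c = "\<lambda>n. inverse (real (Suc n))"
  let ?y = "green_test w \<psi>" and ?y' = "dgreen_test w \<psi>"
  have yi: "integrable lborel ?y" "integrable lborel ?y'"
    unfolding green_test_def dgreen_test_def by (rule integrable_green[OF w integrable_test_function[OF \<psi>]])+
  have [measurable]: "?y \<in> borel_measurable borel" "?y' \<in> borel_measurable borel" using yi by auto
  have [measurable]: "\<psi> \<in> borel_measurable borel"
    using C1c_continuous[OF test_function_deriv(2)[OF \<psi>]] by (rule borel_measurable_continuous_onI)
  have \<kappa>c: "continuous_on UNIV \<kappa>" "continuous_on UNIV (deriv \<kappa>)" "continuous_on UNIV (deriv (deriv \<kappa>))"
    using C C1c_continuous[OF C(1)] by (auto simp: C1c_def)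
  then have [measurable]: "\<kappa> \<in> borel_measurable borel" "deriv \<kappa> \<in> borel_measurable borel" "deriv (deriv \<kappa>) \<in> borel_measurable borel"
    by (auto intro: borel_measurable_continuous_onI)
  let ?I = "\<lambda>n x. (of_real ((?c n)\<^sup>2 * deriv (deriv \<kappa>) (?c n * x)) * ?y x + 2 * of_real (?c n * deriv \<kappa> (?c n * x)) * ?y' x
    - of_real (\<kappa> (?c n * x)) * of_real (\<psi> x)) * d x"
  \<comment> \<open>As d is only bounded, the domination rests on the integrability of y, y' and
    \<psi>. The scale tends to 0, which kills the commutator terms and leaves - \<kappa>(0) \<psi>
    d.\<close>
  have lim: "(\<lambda>n. LINT x|lborel. ?I n x) \<longlonglongrightarrow> (LINT x|lborel. - of_real (\<kappa> 0) * (of_real (\<psi> x) * d x))"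
  proof (rule integral_dominated_convergence[where w = "\<lambda>x. (K2 * cmod (?y x) + 2 * K1 * cmod (?y' x) + K1 * cmod (of_real (\<psi> x))) * B"])
    show "integrable lborel (\<lambda>x. (K2 * cmod (?y x) + 2 * K1 * cmod (?y' x) + K1 * cmod (of_real (\<psi> x))) * B)"
      by (intro integrable_mult_left Bochner_Integration.integrable_add integrable_mult_right integrable_norm
          yi integrable_test_function \<psi>)
    show "AE x in lborel. cmod (?I n x) \<le> (K2 * cmod (?y x) + 2 * K1 * cmod (?y' x) + K1 * cmod (of_real (\<psi> x))) * B" for n
    proof (rule AE_I2)
      fix x
      have c: "0 \<le> ?c n" "?c n \<le> 1" by (auto simp: field_simps)
      have 1: "\<bar>(?c n)\<^sup>2 * deriv (deriv \<kappa>) (?c n * x)\<bar> \<le> K2"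
        unfolding abs_mult using K2[of "?c n * x"] c by (intro order_trans[OF mult_left_le_one_le]) (auto simp: power_le_one)
      have 2: "\<bar>?c n * deriv \<kappa> (?c n * x)\<bar> \<le> K1"
        unfolding abs_mult using K1(2)[of "?c n * x"] c by (intro order_trans[OF mult_left_le_one_le]) auto
      show "cmod (?I n x) \<le> (K2 * cmod (?y x) + 2 * K1 * cmod (?y' x) + K1 * cmod (of_real (\<psi> x))) * B"
        unfolding norm_mult[of _ "d x"]
      proof (intro mult_mono dB order_trans[OF norm_triangle_ineq4] add_mono order_trans[OF norm_triangle_ineq])
        show "cmod (of_real ((?c n)\<^sup>2 * deriv (deriv \<kappa>) (?c n * x)) * ?y x) \<le> K2 * cmod (?y x)"
          unfolding norm_mult norm_of_real by (intro mult_right_mono 1) simp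
        show "cmod (2 * of_real (?c n * deriv \<kappa> (?c n * x)) * ?y' x) \<le> 2 * K1 * cmod (?y' x)"
          unfolding norm_mult[of _ "?y' x"] norm_mult[of 2] norm_of_real by (intro mult_right_mono mult_mono 2) auto
        show "cmod (of_real (\<kappa> (?c n * x)) * of_real (\<psi> x)) \<le> K1 * cmod (of_real (\<psi> x))"
          unfolding norm_mult norm_of_real by (intro mult_right_mono K1) simp
      qed (use K0 B0 in auto)
    qed
    show "AE x in lborel. (\<lambda>n. ?I n x) \<longlonglongrightarrow> - of_real (\<kappa> 0) * (of_real (\<psi> x) * d x)"
    proof (rule AE_I2)
      fix x
      have c0: "?c \<longlonglongrightarrow> 0" by (rule LIMSEQ_inverse_real_of_nat)
      have lim: "(\<lambda>n. f (?c n * x)) \<longlonglongrightarrow> f 0" if "continuous_on UNIV f" for f :: "real \<Rightarrow> real"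
      proof -
        have "(\<lambda>n. ?c n * x) \<longlonglongrightarrow> 0" using tendsto_mult[OF c0 tendsto_const[of x]] by simp
        then show ?thesis
          using that by (intro isCont_tendsto_compose[of 0 f]) (auto simp: continuous_on_eq_continuous_at)
      qed
      have "(\<lambda>n. ?I n x) \<longlonglongrightarrow> (of_real (0\<^sup>2 * deriv (deriv \<kappa>) 0) * ?y x + 2 * of_real (0 * deriv \<kappa> 0) * ?y' x
          - of_real (\<kappa> 0) * of_real (\<psi> x)) * d x"
        by (intro tendsto_intros c0 lim \<kappa>c)
      then show "(\<lambda>n. ?I n x) \<longlonglongrightarrow> - of_real (\<kappa> 0) * (of_real (\<psi> x) * d x)"
        by (simp add: mult.assoc)
    qed
  qed measurable
  have "(LINT x|lborel. ?I n x) = 0" for n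
    using green_test_weak[OF w \<psi> \<kappa> dm dB weak, of "?c n"] by (simp add: numeral_2_eq_2)
  with lim have "(LINT x|lborel. - of_real (\<kappa> 0) * (of_real (\<psi> x) * d x)) = 0"
    by (simp only: LIMSEQ_const_iff)
  then show "(LINT x|lborel. \<psi> x *\<^sub>R d x) = 0"
    using \<kappa>0 by (simp add: scaleR_conv_of_real)
qed

section \<open>The resolvent on \<open>L\<^sup>2\<close>\<close>

lemma lebesgue_borel_representative:
  fixes f :: "real \<Rightarrow> complex"
  assumes "f \<in> borel_measurable lebesgue"
  obtains g where "g \<in> borel_measurable borel" "AE x in lborel. f x = g x"
proof -
  have "(\<lambda>x. Re (f x)) \<in> borel_measurable lebesgue" "(\<lambda>x. Im (f x)) \<in> borel_measurable lebesgue"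
    using assms by measurable
  then obtain a b where ab: "a \<in> borel_measurable lborel" "AE x in lborel. Re (f x) = a x"
      "b \<in> borel_measurable lborel" "AE x in lborel. Im (f x) = b x"
    using completion_ex_borel_measurable_real by metis
  show ?thesis
  proof (rule that[of "\<lambda>x. of_real (a x) + \<i> * of_real (b x)"])
    show "(\<lambda>x. of_real (a x) + \<i> * of_real (b x)) \<in> borel_measurable borel" using ab by simp
    show "AE x in lborel. f x = of_real (a x) + \<i> * of_real (b x)"
      using ab(2,4) by eventually_elim (simp add: complex_eq_iff)
  qed
qed

lemma integrable_lebesgue_cong:
  fixes f :: "real \<Rightarrow> 'a::{banach, second_countable_topology}"
  assumes "f \<in> borel_measurable lebesgue" "g \<in> borel_measurable borel" "AE x in lborel. f x = g x"
  shows "integrable lebesgue f \<longleftrightarrow> integrable lborel g" "(LINT x|lebesgue. f x) = (LINT x|lborel. g x)"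
proof -
  have ae: "AE x in lebesgue. f x = g x" by (rule AE_completion[OF assms(3)])
  have g: "g \<in> borel_measurable lebesgue" using assms(2) by (intro measurable_completion) simp
  show "integrable lebesgue f \<longleftrightarrow> integrable lborel g"
    using integrable_cong_AE[OF assms(1) g ae] assms(2) by (simp add: integrable_completion)
  show "(LINT x|lebesgue. f x) = (LINT x|lborel. g x)"
    using integral_cong_AE[OF assms(1) g ae] assms(2) by (simp add: integral_completion)
qed

lemma lebesgue_scaleR_integral:
  fixes f g :: "real \<Rightarrow> complex"
  assumes "f \<in> borel_measurable lebesgue" "g \<in> borel_measurable borel" "AE x in lborel. f x = g x"
    and "\<phi> \<in> borel_measurable borel"
  shows "(LINT x|lebesgue. \<phi> x *\<^sub>R f x) = (LINT x|lborel. of_real (\<phi> x) * g x)"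
proof (rule integrable_lebesgue_cong(2))
  show "(\<lambda>x. \<phi> x *\<^sub>R f x) \<in> borel_measurable lebesgue"
    by (rule borel_measurable_scaleR[OF measurable_completion assms(1)]) (use assms(4) in simp)
  show "(\<lambda>x. of_real (\<phi> x) * g x) \<in> borel_measurable borel" using assms by measurable
  show "AE x in lborel. \<phi> x *\<^sub>R f x = of_real (\<phi> x) * g x"
    using assms(3) by eventually_elim (simp add: scaleR_conv_of_real)
qed

lemma L2_borel_representative:
  assumes "f \<in> L2"
  obtains g where "g \<in> borel_measurable borel" "AE x in lborel. f x = g x" "integrable lborel (\<lambda>x. (cmod (g x))\<^sup>2)"
proof -
  have f: "f \<in> borel_measurable lebesgue" "integrable lebesgue (\<lambda>x. (cmod (f x))\<^sup>2)" using assms by (auto simp: L2_def)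
  obtain g where [measurable]: "g \<in> borel_measurable borel" and g: "AE x in lborel. f x = g x"
    using lebesgue_borel_representative[OF f(1)] by blast
  have "AE x in lborel. (cmod (f x))\<^sup>2 = (cmod (g x))\<^sup>2" using g by eventually_elim simp
  then have "integrable lborel (\<lambda>x. (cmod (g x))\<^sup>2)"
    using integrable_lebesgue_cong(1)[of "\<lambda>x. (cmod (f x))\<^sup>2" "\<lambda>x. (cmod (g x))\<^sup>2"] f by simp
  then show ?thesis by (intro that[OF _ g]) auto
qed

lemma L2_add:
  assumes "f \<in> L2" "g \<in> L2" shows "(\<lambda>x. f x + g x) \<in> L2"
proof -
  have [measurable]: "f \<in> borel_measurable lebesgue" "g \<in> borel_measurable lebesgue"
    and i: "integrable lebesgue (\<lambda>x. (cmod (f x))\<^sup>2)" "integrable lebesgue (\<lambda>x. (cmod (g x))\<^sup>2)"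
    using assms by (auto simp: L2_def)
  have "integrable lebesgue (\<lambda>x. (cmod (f x + g x))\<^sup>2)"
  proof (rule Bochner_Integration.integrable_bound)
    show "integrable lebesgue (\<lambda>x. 2 * (cmod (f x))\<^sup>2 + 2 * (cmod (g x))\<^sup>2)" using i by simp
    have "(cmod (f x + g x))\<^sup>2 \<le> 2 * (cmod (f x))\<^sup>2 + 2 * (cmod (g x))\<^sup>2" for x
    proof -
      have "(cmod (f x + g x))\<^sup>2 \<le> (cmod (f x) + cmod (g x))\<^sup>2" by (intro power_mono norm_triangle_ineq) simp
      also have "\<dots> \<le> 2 * (cmod (f x))\<^sup>2 + 2 * (cmod (g x))\<^sup>2"
        using sum_squares_bound[of "cmod (f x)" "cmod (g x)"] by (simp add: power2_sum)
      finally show ?thesis .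
    qed
    then show "AE x in lebesgue. norm ((cmod (f x + g x))\<^sup>2) \<le> norm (2 * (cmod (f x))\<^sup>2 + 2 * (cmod (g x))\<^sup>2)"
      by simp
  qed measurable
  then show ?thesis by (simp add: L2_def)
qed

lemma L2_cmult: "f \<in> L2 \<Longrightarrow> (\<lambda>x. c * f x) \<in> L2"
  by (auto simp: L2_def norm_mult power_mult_distrib)

lemma integrable_bounded_L2_Linfty:
  fixes u :: "real \<Rightarrow> complex"
  assumes i: "integrable lborel u" and B: "\<And>x. cmod (u x) \<le> B"
  shows "u \<in> L2 \<inter> Linfty"
proof -
  have [measurable]: "u \<in> borel_measurable borel" using i by auto
  have "integrable lborel (\<lambda>x. cmod (u x) * cmod (u x))"
    by (rule integrable_mult_bounded[where B = B]) (use i B in auto)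
  then have "integrable lebesgue (\<lambda>x. (cmod (u x))\<^sup>2)"
    by (subst integrable_completion) (auto simp: power2_eq_square)
  moreover have "u \<in> borel_measurable lebesgue" by (intro measurable_completion) simp
  moreover have "AE x in lebesgue. cmod (u x) \<le> B" using B by simp
  ultimately show ?thesis unfolding L2_def Linfty_def by blast
qed

text \<open>Identifies the function picked by \<open>SOME\<close> in \<open>schroedinger\<close>, up
  to a null set. Square integrable functions are locally integrable by |a| \<le> 1 + |a|^2, so
  \<open>fundamental_lemma\<close> applies.\<close>

lemma L2_distr_unique:
  assumes f: "f \<in> L2" and g: "g \<in> L2"
    and eq: "\<And>\<phi>. test_function \<phi> \<Longrightarrow> (LINT x|lebesgue. \<phi> x *\<^sub>R f x) = (LINT x|lebesgue. \<phi> x *\<^sub>R g x)"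
  shows "AE x in lborel. f x = g x"
proof -
  have loc: "integrable lborel (\<lambda>x. indicator {- R..R} x *\<^sub>R a x)"
    if [measurable]: "a \<in> borel_measurable borel" and a: "integrable lborel (\<lambda>x. (cmod (a x))\<^sup>2)"
    for a :: "real \<Rightarrow> complex" and R :: real
  proof (rule Bochner_Integration.integrable_bound)
    show "integrable lborel (\<lambda>x. indicator {-R..R} x + (cmod (a x))\<^sup>2)"
      using a by (intro Bochner_Integration.integrable_add integrable_real_indicator) (auto simp: emeasure_lborel_Icc_eq)
    have "cmod (a x) \<le> 1 + (cmod (a x))\<^sup>2" for x
    proof -
      have "2 * cmod (a x) \<le> 1 + (cmod (a x))\<^sup>2" using sum_squares_bound[of 1 "cmod (a x)"] by simp
      then show ?thesis using norm_ge_zero[of "a x"] by linarith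
    qed
    then show "AE x in lborel. norm (indicator {- R..R} x *\<^sub>R a x) \<le> norm (indicator {-R..R} x + (cmod (a x))\<^sup>2)"
      by (auto simp: indicator_def)
  qed simp
  obtain a where am [measurable]: "a \<in> borel_measurable borel" and a: "AE x in lborel. f x = a x" "integrable lborel (\<lambda>x. (cmod (a x))\<^sup>2)"
    using L2_borel_representative[OF f] by blast
  obtain b where bm [measurable]: "b \<in> borel_measurable borel" and b: "AE x in lborel. g x = b x" "integrable lborel (\<lambda>x. (cmod (b x))\<^sup>2)"
    using L2_borel_representative[OF g] by blast
  have m: "f \<in> borel_measurable lebesgue" "g \<in> borel_measurable lebesgue" using f g by (auto simp: L2_def)
  have "AE x in lborel. a x - b x = 0"
  proof (rule fundamental_lemma)
    show "integrable lborel (\<lambda>x. indicator {- real N..real N} x *\<^sub>R (a x - b x))" for N :: nat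
      using loc[OF am a(2)] loc[OF bm b(2)] by (simp add: scaleR_diff_right)
    fix \<phi> assume \<phi>: "test_function \<phi>"
    obtain R where R: "\<And>x. R < \<bar>x\<bar> \<Longrightarrow> \<phi> x = 0" using \<phi> by (auto simp: test_function_smooth)
    note C = test_function_deriv(2)[OF \<phi>]
    have [measurable]: "\<phi> \<in> borel_measurable borel"
      using C1c_continuous[OF C] by (rule borel_measurable_continuous_onI)
    have i: "integrable lborel (\<lambda>x. of_real (\<phi> x) * c x)"
      if "c \<in> borel_measurable borel" "integrable lborel (\<lambda>x. (cmod (c x))\<^sup>2)" for c :: "real \<Rightarrow> complex"
    proof -
      have "(\<lambda>x. of_real (\<phi> x) * (indicator {- R..R} x *\<^sub>R c x)) = (\<lambda>x. of_real (\<phi> x) * c x)"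
        using R by (force simp: fun_eq_iff indicator_def)
      then show ?thesis using integrable_C1c_mult(1)[OF C loc[OF that, of R]] by simp
    qed
    have "(LINT x|lborel. of_real (\<phi> x) * a x) = (LINT x|lborel. of_real (\<phi> x) * b x)"
      using eq[OF \<phi>] lebesgue_scaleR_integral[OF m(1) am a(1), of \<phi>] lebesgue_scaleR_integral[OF m(2) bm b(1), of \<phi>]
      by simp
    then show "(LINT x|lborel. \<phi> x *\<^sub>R (a x - b x)) = 0"
      using i[OF am a(2)] i[OF bm b(2)] by (simp add: scaleR_conv_of_real right_diff_distrib)
  qed measurable
  then show ?thesis using a(1) b(1) by eventually_elim simp
qed

text \<open>The source term of - u'' - (z / h^2) u = (f - V u) / h^2, written in the shape that
  \<open>is_solution\<close> has for the rescaled V and f.\<close>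

definition rhs0 :: "real \<Rightarrow> (real \<Rightarrow> real) \<Rightarrow> (real \<Rightarrow> complex) \<Rightarrow> (real \<Rightarrow> complex) \<Rightarrow> real \<Rightarrow> complex" where
  "rhs0 h V f u y = f y / (of_real h)\<^sup>2 - of_real (V y / h\<^sup>2) * u y"

lemma rhs0_eq: "rhs0 h V f u = (\<lambda>y. inverse ((of_real h)\<^sup>2) * (f y - of_real (V y) * u y))"
  by (auto simp: rhs0_def fun_eq_iff divide_inverse algebra_simps)

text \<open>
  \<open>V0\<close> and \<open>f0\<close> are Borel representatives: Fubini's theorem, used for \<open>green\<close>, needs \<open>lborel\<close>.
\<close>

context
  fixes V :: "real \<Rightarrow> real" and V0 :: "real \<Rightarrow> real" and f f0 :: "real \<Rightarrow> complex" and h :: real and z w :: complex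
  assumes h: "0 < h" and w: "Re w < 0" and w2: "w\<^sup>2 = - z / (of_real h)\<^sup>2"
    and Vm: "V \<in> borel_measurable lebesgue" and V0: "AE x in lborel. V x = V0 x" "integrable lborel V0"
    and f: "f \<in> L2" and f0: "AE x in lborel. f x = f0 x" "integrable lborel f0"
begin

lemma z_eq: "z = - (of_real h)\<^sup>2 * w\<^sup>2"
  using w2 h by simp

lemma V0_measurable [measurable]: "V0 \<in> borel_measurable borel" using V0(2) by auto
lemma f0_measurable [measurable]: "f0 \<in> borel_measurable borel" using f0(2) by auto
lemma schroedinger_someI:
  assumes "\<exists>g \<in> L2. schroedinger_distr h V u g"
  shows "schroedinger h V u \<in> L2" "schroedinger_distr h V u (schroedinger h V u)"
proof -
  have "\<exists>g. g \<in> L2 \<and> schroedinger_distr h V u g" using assms by blast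
  from someI_ex[OF this] show "schroedinger h V u \<in> L2" "schroedinger_distr h V u (schroedinger h V u)"
    by (simp_all add: schroedinger_def)
qed

context
  fixes u u0 :: "real \<Rightarrow> complex" and B :: real
  assumes um: "u \<in> borel_measurable lebesgue" and u0m [measurable]: "u0 \<in> borel_measurable borel"
    and uu0: "AE x in lborel. u x = u0 x" and u0B: "\<And>x. cmod (u0 x) \<le> B"
begin

lemma V0u0: "integrable lborel (\<lambda>x. of_real (V0 x) * u0 x)"
  by (rule integrable_potential_mult(1)[OF V0(2) u0m u0B])

lemma integrable_rhs0: "integrable lborel (rhs0 h V0 f0 u0)"
  unfolding rhs0_eq using f0(2) V0u0 by simp

lemma integrable_test_u0:
  assumes \<phi>: "test_function \<phi>"
  shows "integrable lborel (\<lambda>x. of_real (\<phi> x) * u0 x)"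
    "integrable lborel (\<lambda>x. of_real ((deriv ^^ 2) \<phi> x) * u0 x)"
proof -
  have *: "integrable lborel (\<lambda>x. of_real (\<theta> x) * u0 x)" if "test_function \<theta>" for \<theta>
    using integrable_mult_bounded[OF integrable_test_function[OF that], of u0 B] u0B by (simp add: mult.commute)
  show "integrable lborel (\<lambda>x. of_real (\<phi> x) * u0 x)" by (rule *[OF \<phi>])
  show "integrable lborel (\<lambda>x. of_real ((deriv ^^ 2) \<phi> x) * u0 x)"
    using *[OF test_function_deriv(1)[OF test_function_deriv(1)[OF \<phi>]]] by (simp add: numeral_2_eq_2)
qed

text \<open>The equation P u = f + z u divided by - h^2, i.e. u'' - w^2 u = - \<open>rhs0\<close>,
  passing from \<open>lebesgue\<close> to Borel representatives. Both the uniqueness and the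
  existence argument go through this form.\<close>

lemma schroedinger_distr_iff:
  assumes Wm: "W \<in> borel_measurable lebesgue" and W: "AE x in lborel. W x = f x + z * u x"
  shows "schroedinger_distr h V u W \<longleftrightarrow> (\<forall>\<phi>. test_function \<phi> \<longrightarrow>
    (LINT x|lborel. of_real ((deriv ^^ 2) \<phi> x) * u0 x) - w\<^sup>2 * (LINT x|lborel. of_real (\<phi> x) * u0 x) =
    - (LINT x|lborel. of_real (\<phi> x) * rhs0 h V0 f0 u0 x))"
proof -
  have "(- (h\<^sup>2 *\<^sub>R (LINT x|lebesgue. (deriv ^^ 2) \<phi> x *\<^sub>R u x))
       + (LINT x|lebesgue. \<phi> x *\<^sub>R (V x *\<^sub>R u x)) = (LINT x|lebesgue. \<phi> x *\<^sub>R W x)) \<longleftrightarrow>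
    ((LINT x|lborel. of_real ((deriv ^^ 2) \<phi> x) * u0 x) - w\<^sup>2 * (LINT x|lborel. of_real (\<phi> x) * u0 x) =
    - (LINT x|lborel. of_real (\<phi> x) * rhs0 h V0 f0 u0 x))"
    if \<phi>: "test_function \<phi>" for \<phi>
  proof -
    note C = test_function_deriv(2)[OF \<phi>]
    have [measurable]: "\<phi> \<in> borel_measurable borel"
      using C1c_continuous[OF C] by (rule borel_measurable_continuous_onI)
    have [measurable]: "(deriv ^^ 2) \<phi> \<in> borel_measurable borel"
      using C1c_continuous[OF test_function_deriv(2)[OF test_function_deriv(1)[OF test_function_deriv(1)[OF \<phi>]]]]
      by (simp add: numeral_2_eq_2 borel_measurable_continuous_onI)
    let ?A = "LINT x|lborel. of_real ((deriv ^^ 2) \<phi> x) * u0 x" and ?U = "LINT x|lborel. of_real (\<phi> x) * u0 x"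
      and ?P = "LINT x|lborel. of_real (\<phi> x) * (of_real (V0 x) * u0 x)" and ?F = "LINT x|lborel. of_real (\<phi> x) * f0 x"
    have A: "(LINT x|lebesgue. (deriv ^^ 2) \<phi> x *\<^sub>R u x) = ?A"
      by (rule lebesgue_scaleR_integral[OF um u0m uu0]) measurable
    have P: "(LINT x|lebesgue. \<phi> x *\<^sub>R (V x *\<^sub>R u x)) = ?P"
    proof (rule lebesgue_scaleR_integral)
      show "(\<lambda>x. V x *\<^sub>R u x) \<in> borel_measurable lebesgue" using Vm um by measurable
      show "AE x in lborel. V x *\<^sub>R u x = of_real (V0 x) * u0 x"
        using V0(1) uu0 by eventually_elim (simp add: scaleR_conv_of_real)
    qed measurable
    note iF = integrable_C1c_mult(1)[OF C f0(2)] and iP = integrable_C1c_mult(1)[OF C V0u0]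
      and iU = integrable_test_u0(1)[OF \<phi>]
    have W': "(LINT x|lebesgue. \<phi> x *\<^sub>R W x) = ?F + z * ?U"
    proof -
      have "(LINT x|lebesgue. \<phi> x *\<^sub>R W x) = (LINT x|lborel. of_real (\<phi> x) * (f0 x + z * u0 x))"
      proof (rule lebesgue_scaleR_integral[OF Wm])
        show "AE x in lborel. W x = f0 x + z * u0 x" using W f0(1) uu0 by eventually_elim simp
      qed measurable
      also have "\<dots> = (LINT x|lborel. of_real (\<phi> x) * f0 x + z * (of_real (\<phi> x) * u0 x))"
        by (simp add: algebra_simps)
      finally show ?thesis
        using iF iU by (simp only: Bochner_Integration.integral_add integrable_mult_right integral_mult_right_zero)
    qed
    have r: "(LINT x|lborel. of_real (\<phi> x) * rhs0 h V0 f0 u0 x) = inverse ((of_real h)\<^sup>2) * (?F - ?P)"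
    proof -
      have "(LINT x|lborel. of_real (\<phi> x) * rhs0 h V0 f0 u0 x) =
          (LINT x|lborel. inverse ((of_real h)\<^sup>2) * (of_real (\<phi> x) * f0 x - of_real (\<phi> x) * (of_real (V0 x) * u0 x)))"
        unfolding rhs0_eq by (simp add: algebra_simps)
      then show ?thesis
        using iF iP by (simp only: Bochner_Integration.integral_diff integral_mult_right_zero)
    qed
    show ?thesis
      unfolding A P W' r z_eq using h by (auto simp: scaleR_conv_of_real field_simps)
  qed
  then show ?thesis unfolding schroedinger_distr_def by blast
qed

end

lemma is_solution_rhs0:
  "is_solution w (\<lambda>x. V0 x / h\<^sup>2) (\<lambda>x. f0 x / (of_real h)\<^sup>2) u0 \<longleftrightarrow>
    continuous_on UNIV u0 \<and> bounded (range u0) \<and> (\<forall>x. u0 x = green w (rhs0 h V0 f0 u0) x)"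
  unfolding is_solution_def rhs0_def[abs_def] ..

text \<open>Boundedness of u makes the source term integrable, so Y = \<open>green\<close> of it
  solves the same distributional equation as u. Their difference is a bounded weak solution of the
  free equation, and \<open>weak_uniqueness\<close> removes it.\<close>

lemma resolvent_solution_unique:
  assumes u: "u \<in> schroedinger_dom h V" and eq: "AE x in lebesgue. schroedinger h V u x - z * u x = f x"
  shows "\<exists>u0. is_solution w (\<lambda>x. V0 x / h\<^sup>2) (\<lambda>x. f0 x / (of_real h)\<^sup>2) u0 \<and> (AE x in lborel. u x = u0 x)"
proof -
  have um: "u \<in> borel_measurable lebesgue" and "u \<in> Linfty" and ex: "\<exists>g \<in> L2. schroedinger_distr h V u g"
    using u by (auto simp: schroedinger_dom_def L2_def)
  then obtain B where B: "AE x in lborel. cmod (u x) \<le> B" by (auto simp: Linfty_def AE_completion_iff)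
  obtain u1 where [measurable]: "u1 \<in> borel_measurable borel" and u1: "AE x in lborel. u x = u1 x"
    using lebesgue_borel_representative[OF um] by blast
  \<comment> \<open>Truncation turns the almost-everywhere bound from \<open>Linfty\<close> into one
    valid at every point.\<close>
  define u2 where "u2 x = (if cmod (u1 x) \<le> B then u1 x else 0)" for x
  have u2m [measurable]: "u2 \<in> borel_measurable borel" unfolding u2_def[abs_def] by measurable
  have u2B: "cmod (u2 x) \<le> max B 0" for x by (auto simp: u2_def le_max_iff_disj)
  have uu2: "AE x in lborel. u x = u2 x" using B u1 by eventually_elim (simp add: u2_def)
  note W = schroedinger_someI[OF ex]
  have "AE x in lborel. schroedinger h V u x = f x + z * u x"
    using eq unfolding AE_completion_iff by eventually_elim (simp add: algebra_simps)
  then have id: "(LINT x|lborel. of_real ((deriv ^^ 2) \<phi> x) * u2 x) - w\<^sup>2 * (LINT x|lborel. of_real (\<phi> x) * u2 x) =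
    - (LINT x|lborel. of_real (\<phi> x) * rhs0 h V0 f0 u2 x)" if "test_function \<phi>" for \<phi>
    using schroedinger_distr_iff[OF um u2m uu2 u2B, of "schroedinger h V u"] W that by (auto simp: L2_def)
  have ri: "integrable lborel (rhs0 h V0 f0 u2)" by (rule integrable_rhs0[OF um u2m uu2 u2B])
  define Y where "Y = green w (rhs0 h V0 f0 u2)"
  have Yc: "continuous_on UNIV Y" unfolding Y_def by (rule continuous_green[OF w ri])
  have Ym [measurable]: "Y \<in> borel_measurable borel" using Yc by (rule borel_measurable_continuous_onI)
  have Ym': "Y \<in> borel_measurable lebesgue" by (intro measurable_completion) simp
  have YY: "AE x in lborel. Y x = Y x" by simp
  let ?BY = "(LINT y|lborel. cmod (rhs0 h V0 f0 u2 y)) / cmod w"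
  have YB: "cmod (Y x) \<le> ?BY" for x unfolding Y_def by (rule norm_green_le[OF w ri])
  have "AE x in lborel. u2 x - Y x = 0"
  proof (rule weak_uniqueness[OF w])
    show "cmod (u2 x - Y x) \<le> max B 0 + ?BY" for x
      by (rule order_trans[OF norm_triangle_ineq4 add_mono[OF u2B YB]])
    fix \<phi> assume \<phi>: "test_function \<phi>"
    note g1 = green_weak(2)[OF w ri test_function_deriv(2)[OF \<phi>]]
      and g2 = green_weak(1)[OF w ri test_function_deriv(2)[OF test_function_deriv(1)[OF \<phi>]]]
    have g: "(LINT x|lborel. of_real ((deriv ^^ 2) \<phi> x) * Y x) - w\<^sup>2 * (LINT x|lborel. of_real (\<phi> x) * Y x) =
      - (LINT x|lborel. of_real (\<phi> x) * rhs0 h V0 f0 u2 x)"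
      unfolding Y_def using g1 g2 by (simp add: numeral_2_eq_2)
    have i: "integrable lborel (\<lambda>x. of_real (\<phi> x) * u2 x)" "integrable lborel (\<lambda>x. of_real ((deriv ^^ 2) \<phi> x) * u2 x)"
      "integrable lborel (\<lambda>x. of_real (\<phi> x) * Y x)" "integrable lborel (\<lambda>x. of_real ((deriv ^^ 2) \<phi> x) * Y x)"
      by (rule integrable_test_u0[OF um u2m uu2 u2B \<phi>] integrable_test_u0[OF Ym' Ym YY YB \<phi>])+
    have "(LINT x|lborel. (of_real ((deriv ^^ 2) \<phi> x) - w\<^sup>2 * of_real (\<phi> x)) * (u2 x - Y x)) =
      (LINT x|lborel. (of_real ((deriv ^^ 2) \<phi> x) * u2 x - w\<^sup>2 * (of_real (\<phi> x) * u2 x))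
        - (of_real ((deriv ^^ 2) \<phi> x) * Y x - w\<^sup>2 * (of_real (\<phi> x) * Y x)))"
      by (rule Bochner_Integration.integral_cong) (auto simp: algebra_simps)
    also have "\<dots> = 0"
      using id[OF \<phi>] g i by (simp only: Bochner_Integration.integral_diff Bochner_Integration.integrable_diff integrable_mult_right integral_mult_right_zero) simp
    finally show "(LINT x|lborel. (of_real ((deriv ^^ 2) \<phi> x) - w\<^sup>2 * of_real (\<phi> x)) * (u2 x - Y x)) = 0" .
  qed measurable
  \<comment> \<open>Replacing u2 by Y inside the source term changes it on a null set only, so Y
    satisfies the integral equation with itself on the right.\<close>
  then have u2Y: "AE x in lborel. u2 x = Y x" by eventually_elim simp
  then have "AE x in lborel. rhs0 h V0 f0 u2 x = rhs0 h V0 f0 Y x"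
    by eventually_elim (simp add: rhs0_def)
  then have "green w (rhs0 h V0 f0 u2) = green w (rhs0 h V0 f0 Y)"
    by (rule green_cong_AE) (auto simp: rhs0_def[abs_def])
  then have "Y = green w (rhs0 h V0 f0 Y)" by (simp add: Y_def)
  then have "is_solution w (\<lambda>x. V0 x / h\<^sup>2) (\<lambda>x. f0 x / (of_real h)\<^sup>2) Y"
    unfolding is_solution_rhs0 using Yc YB by (metis boundedI rangeE)
  moreover have "AE x in lborel. u x = Y x" using uu2 u2Y by eventually_elim simp
  ultimately show ?thesis by blast
qed

text \<open>Both \<open>green\<close> and \<open>dgreen\<close> of an integrable source are
  integrable and bounded, hence in L^2 and L^\<infinity>; and P u = f + z u is then in L^2.\<close>

lemma resolvent_solution_exists:
  assumes sol: "is_solution w (\<lambda>x. V0 x / h\<^sup>2) (\<lambda>x. f0 x / (of_real h)\<^sup>2) u"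
  shows "u \<in> schroedinger_dom h V" "AE x in lebesgue. schroedinger h V u x - z * u x = f x"
proof -
  note um = is_solutionD(4)[OF sol]
  have um': "u \<in> borel_measurable lebesgue" using um by (intro measurable_completion) simp
  obtain B where B: "\<And>x. cmod (u x) \<le> B" using is_solutionD(2)[OF sol] unfolding bounded_iff by blast
  have uu: "AE x in lborel. u x = u x" by simp
  have ri: "integrable lborel (rhs0 h V0 f0 u)" by (rule integrable_rhs0[OF um' um uu B])
  have ug: "u = green w (rhs0 h V0 f0 u)" using sol unfolding is_solution_rhs0 by blast
  have "integrable lborel u" using integrable_green(1)[OF w ri] ug by simp
  then have uL: "u \<in> L2 \<inter> Linfty" using B by (rule integrable_bounded_L2_Linfty)
  have gL: "dgreen w (rhs0 h V0 f0 u) \<in> L2 \<inter> Linfty"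
    by (rule integrable_bounded_L2_Linfty[OF integrable_green(2)[OF w ri] norm_dgreen_le[OF w ri]])
  have hd: "has_distr_deriv u (dgreen w (rhs0 h V0 f0 u))"
    unfolding has_distr_deriv_def
  proof (intro allI impI)
    fix \<phi> assume \<phi>: "test_function \<phi>"
    note C = test_function_deriv(2)[OF \<phi>]
    have m: "\<phi> \<in> borel_measurable borel" "deriv \<phi> \<in> borel_measurable borel"
      using C C1c_continuous[OF C] by (auto simp: C1c_def intro: borel_measurable_continuous_onI)
    have gm: "dgreen w (rhs0 h V0 f0 u) \<in> borel_measurable borel" using integrable_green(2)[OF w ri] by auto
    have "(LINT x|lebesgue. deriv \<phi> x *\<^sub>R u x) = (LINT x|lborel. of_real (deriv \<phi> x) * u x)"
      by (rule lebesgue_scaleR_integral[OF um' um uu m(2)])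
    moreover have "(LINT x|lebesgue. \<phi> x *\<^sub>R dgreen w (rhs0 h V0 f0 u) x) = (LINT x|lborel. of_real (\<phi> x) * dgreen w (rhs0 h V0 f0 u) x)"
      by (rule lebesgue_scaleR_integral[OF measurable_completion gm _ m(1)]) (use gm in auto)
    moreover have "(LINT x|lborel. of_real (deriv \<phi> x) * u x) = - (LINT x|lborel. of_real (\<phi> x) * dgreen w (rhs0 h V0 f0 u) x)"
      using green_weak(1)[OF w ri C] ug by metis
    ultimately show "- (LINT x|lebesgue. deriv \<phi> x *\<^sub>R u x) = (LINT x|lebesgue. \<phi> x *\<^sub>R dgreen w (rhs0 h V0 f0 u) x)" by simp
  qed
  define W where "W x = f x + z * u x" for x
  have WL: "W \<in> L2" unfolding W_def[abs_def] using uL f by (intro L2_add L2_cmult) auto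
  have Wd: "schroedinger_distr h V u W"
  proof -
    have "(LINT x|lborel. of_real ((deriv ^^ 2) \<phi> x) * u x) - w\<^sup>2 * (LINT x|lborel. of_real (\<phi> x) * u x) =
      - (LINT x|lborel. of_real (\<phi> x) * rhs0 h V0 f0 u x)" if \<phi>: "test_function \<phi>" for \<phi>
    proof -
      note g1 = green_weak(2)[OF w ri test_function_deriv(2)[OF \<phi>]]
        and g2 = green_weak(1)[OF w ri test_function_deriv(2)[OF test_function_deriv(1)[OF \<phi>]]]
      have "(LINT x|lborel. of_real ((deriv ^^ 2) \<phi> x) * green w (rhs0 h V0 f0 u) x) - w\<^sup>2 * (LINT x|lborel. of_real (\<phi> x) * green w (rhs0 h V0 f0 u) x) =
        - (LINT x|lborel. of_real (\<phi> x) * rhs0 h V0 f0 u x)"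
        using g1 g2 by (simp add: numeral_2_eq_2)
      then show ?thesis unfolding ug[symmetric] .
    qed
    then show ?thesis
      using schroedinger_distr_iff[OF um' um uu B, of W] WL by (simp add: W_def L2_def)
  qed
  have ex: "\<exists>g \<in> L2. schroedinger_distr h V u g" using WL Wd by blast
  show "u \<in> schroedinger_dom h V" unfolding schroedinger_dom_def using uL gL hd ex by blast
  \<comment> \<open>The choice made in \<open>schroedinger\<close> need not be W itself, but both
    represent the same distribution.\<close>
  have "AE x in lborel. schroedinger h V u x = W x"
    using schroedinger_someI[OF ex] WL Wd
    by (intro L2_distr_unique) (auto simp: schroedinger_distr_def)
  then have "AE x in lebesgue. schroedinger h V u x = W x" by (rule AE_completion)
  then show "AE x in lebesgue. schroedinger h V u x - z * u x = f x"
    by eventually_elim (simp add: W_def)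
qed

end

section \<open>From the pointwise bound to the weighted operator bound\<close>

lemma integral_Cauchy_Schwarz:
  fixes a b :: "'a \<Rightarrow> real"
  assumes [measurable]: "a \<in> borel_measurable M" "b \<in> borel_measurable M"
    and nn: "\<And>x. 0 \<le> a x" "\<And>x. 0 \<le> b x"
    and i: "integrable M (\<lambda>x. (a x)\<^sup>2)" "integrable M (\<lambda>x. (b x)\<^sup>2)" "integrable M (\<lambda>x. a x * b x)"
  shows "(LINT x|M. a x * b x) \<le> sqrt (LINT x|M. (a x)\<^sup>2) * sqrt (LINT x|M. (b x)\<^sup>2)"
proof -
  have c: "(\<integral>\<^sup>+x. ennreal (g x) \<partial>M) = ennreal (LINT x|M. g x)" if "integrable M g" "\<And>x. 0 \<le> g x" for g
    using that by (intro nn_integral_eq_integral) auto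
  have "(\<integral>\<^sup>+x. ennreal (a x) * ennreal (b x) \<partial>M)\<^sup>2 \<le> (\<integral>\<^sup>+x. ennreal (a x) ^ 2 \<partial>M) * (\<integral>\<^sup>+x. ennreal (b x) ^ 2 \<partial>M)"
    by (rule Cauchy_Schwarz_nn_integral) measurable
  then have "ennreal ((LINT x|M. a x * b x)\<^sup>2) \<le> ennreal ((LINT x|M. (a x)\<^sup>2) * (LINT x|M. (b x)\<^sup>2))"
    using c[OF i(1)] c[OF i(2)] c[OF i(3)] nn
    by (simp add: ennreal_power ennreal_mult'[symmetric] Bochner_Integration.integral_nonneg)
  then have "(LINT x|M. a x * b x)\<^sup>2 \<le> (LINT x|M. (a x)\<^sup>2) * (LINT x|M. (b x)\<^sup>2)"
    by (subst (asm) ennreal_le_iff) (auto simp: Bochner_Integration.integral_nonneg)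
  then have "LINT x|M. a x * b x \<le> sqrt ((LINT x|M. (a x)\<^sup>2) * (LINT x|M. (b x)\<^sup>2))"
    by (rule real_le_rsqrt)
  then show ?thesis by (simp add: real_sqrt_mult)
qed

text \<open>\<open>sqrt\<close> is odd on the reals, so this holds for negative arguments too; m is
  nonnegative only almost everywhere, and |sqrt(m x)| can still be rewritten at every x.\<close>

lemma abs_sqrt: "\<bar>sqrt x\<bar> = sqrt \<bar>x\<bar>"
  by (cases "0 \<le> x") (auto simp: real_sqrt_minus abs_if)

theorem theorem1:
  fixes V m :: "real \<Rightarrow> real" and E \<epsilon> h :: real
  assumes "integrable lebesgue V"
    and "integrable lebesgue m"
    and "AE x in lebesgue. \<bar>V x\<bar> \<le> m x"
    and "E \<ge> 2 * \<epsilon>" and "\<epsilon> > 0" and "h > 0"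
  shows "L2_opnorm_le
           (\<lambda>v. sqrt_mult m (resolvent h V (complex_of_real E + \<i> * complex_of_real \<epsilon>) (sqrt_mult m v)))
           (exp (2 * E powr (-1/2) * (LINT x|lebesgue. m x) / h))"
  unfolding L2_opnorm_le_def
proof (intro ballI)
  fix v assume "v \<in> L2 \<inter> Linfty"
  then have vm: "v \<in> borel_measurable lebesgue" and v2: "integrable lebesgue (\<lambda>x. (cmod (v x))\<^sup>2)"
    and "\<exists>C. AE x in lebesgue. cmod (v x) \<le> C"
    by (auto simp: L2_def Linfty_def)
  then obtain C where C: "AE x in lebesgue. cmod (v x) \<le> C" by blast
  have E: "0 < E" using assms by simp
  define z where "z = complex_of_real E + \<i> * complex_of_real \<epsilon>"
  define f where "f = sqrt_mult m v"
  define R where "R = resolvent h V z f"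
  define M where "M = (LINT x|lebesgue. m x)"
  define q where "q = sqrt E"
  have q: "0 < q" using E by (simp add: q_def)
  have mm: "m \<in> borel_measurable lebesgue" and Vm: "V \<in> borel_measurable lebesgue" using assms by auto
  have m0: "AE x in lebesgue. 0 \<le> m x" using assms(3) by eventually_elim linarith
  have Mabs: "(LINT x|lebesgue. \<bar>m x\<bar>) = M"
    unfolding M_def using m0 mm by (intro integral_cong_AE) auto
  have M0: "0 \<le> M" unfolding Mabs[symmetric] by simp
  have fm: "f \<in> borel_measurable lebesgue" unfolding f_def sqrt_mult_def using mm vm by measurable
  have fn: "cmod (f x) = sqrt \<bar>m x\<bar> * cmod (v x)" for x by (simp add: f_def sqrt_mult_def abs_sqrt)
  \<comment> \<open>Here the boundedness of v is used: m |v|^2 \<le> C^2 m puts f into L^2.\<close>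
  have f2: "integrable lebesgue (\<lambda>x. (cmod (f x))\<^sup>2)"
  proof (rule Bochner_Integration.integrable_bound)
    show "integrable lebesgue (\<lambda>x. \<bar>m x\<bar> * C\<^sup>2)" using assms(2) by simp
    show "AE x in lebesgue. norm ((cmod (f x))\<^sup>2) \<le> norm (\<bar>m x\<bar> * C\<^sup>2)"
      using C by eventually_elim (simp add: fn power_mult_distrib mult_left_mono power_mono)
  qed (use fm in measurable)
  have fL: "f \<in> L2" using fm f2 by (simp add: L2_def)
  have f1: "integrable lebesgue f"
  proof (rule Bochner_Integration.integrable_bound)
    show "integrable lebesgue (\<lambda>x. \<bar>m x\<bar> + (cmod (v x))\<^sup>2)" using assms(2) v2 by simp
    have "cmod (f x) \<le> \<bar>m x\<bar> + (cmod (v x))\<^sup>2" for x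
    proof -
      have "0 \<le> sqrt \<bar>m x\<bar> * cmod (v x)" by simp
      moreover have "2 * (sqrt \<bar>m x\<bar> * cmod (v x)) \<le> \<bar>m x\<bar> + (cmod (v x))\<^sup>2"
        using sum_squares_bound[of "sqrt \<bar>m x\<bar>" "cmod (v x)"] by simp
      ultimately show ?thesis unfolding fn by linarith
    qed
    then show "AE x in lebesgue. norm (f x) \<le> norm (\<bar>m x\<bar> + (cmod (v x))\<^sup>2)" by simp
  qed (rule fm)
  have f1n: "(LINT x|lebesgue. cmod (f x)) \<le> sqrt M * L2_norm v"
  proof -
    have "(LINT x|lebesgue. sqrt \<bar>m x\<bar> * cmod (v x)) \<le> sqrt (LINT x|lebesgue. (sqrt \<bar>m x\<bar>)\<^sup>2) * sqrt (LINT x|lebesgue. (cmod (v x))\<^sup>2)"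
      using integrable_norm[OF f1] assms(2) v2 mm vm by (intro integral_Cauchy_Schwarz) (auto simp: fn)
    then show ?thesis by (simp add: fn Mabs L2_norm_def)
  qed
  obtain V0 where V0m [measurable]: "V0 \<in> borel_measurable borel" and V0: "AE x in lborel. V x = V0 x"
    using completion_ex_borel_measurable_real[OF Vm] by auto
  have V0i: "integrable lborel V0" using integrable_lebesgue_cong(1)[OF Vm V0m V0] assms(1) by simp
  obtain f0 where f0m [measurable]: "f0 \<in> borel_measurable borel" and f0: "AE x in lborel. f x = f0 x"
    using lebesgue_borel_representative[OF fm] by blast
  have f0i: "integrable lborel f0" using integrable_lebesgue_cong(1)[OF fm f0m f0] f1 by simp
  \<comment> \<open>The principal root has nonnegative real part, hence the sign. The real part is
    not 0, since Im(w^2) = - \<epsilon> / h^2 differs from 0.\<close>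
  define w where "w = - csqrt (- z / (of_real h)\<^sup>2)"
  have w2: "w\<^sup>2 = - z / (of_real h)\<^sup>2" by (simp add: w_def)
  have z': "z / (of_real h)\<^sup>2 = Complex (E / h\<^sup>2) (\<epsilon> / h\<^sup>2)"
    by (simp add: z_def complex_eq_iff Re_divide_of_real Im_divide_of_real flip: of_real_power)
  then have w2': "w\<^sup>2 = - Complex (E / h\<^sup>2) (\<epsilon> / h\<^sup>2)" using w2 by simp
  have wneg: "Re w < 0"
  proof -
    have "Re w \<noteq> 0"
    proof
      assume "Re w = 0"
      then have "Im (w\<^sup>2) = 0" by (simp add: power2_eq_square)
      then show False using w2' assms by simp
    qed
    moreover have "Re w \<le> 0" using csqrt_principal[of "- z / (of_real h)\<^sup>2"] by (auto simp: w_def)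
    ultimately show ?thesis by simp
  qed
  let ?V = "\<lambda>x. V0 x / h\<^sup>2" and ?f = "\<lambda>x. f0 x / (of_real h)\<^sup>2"
  have \<epsilon>': "0 < \<epsilon> / h\<^sup>2" "2 * (\<epsilon> / h\<^sup>2) \<le> E / h\<^sup>2"
    using assms by (auto simp: divide_right_mono)
  have Vi: "integrable lborel ?V" and fi: "integrable lborel ?f" using V0i f0i by auto
  obtain u1 where u1: "is_solution w ?V ?f u1" using solution_exists[OF wneg w2' \<epsilon>' Vi fi] by blast
  note hyps = assms(6) wneg w2 Vm V0 V0i fL f0 f0i
  \<comment> \<open>Existence makes the choice in \<open>resolvent\<close> meaningful; weak
    uniqueness then makes whatever was chosen agree almost everywhere with a solution of the
    integral equation.\<close>
  have "\<exists>u. u \<in> schroedinger_dom h V \<and> (AE x in lebesgue. schroedinger h V u x - z * u x = f x)"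
    using resolvent_solution_exists[OF hyps u1] by blast
  then have "R \<in> schroedinger_dom h V \<and> (AE x in lebesgue. schroedinger h V R x - z * R x = f x)"
    unfolding R_def resolvent_def by (rule someI_ex)
  then obtain u where u: "is_solution w ?V ?f u" and Ru: "AE x in lborel. R x = u x"
    using resolvent_solution_unique[OF hyps, of R] by blast
  have Rm: "R \<in> borel_measurable lebesgue"
    using \<open>R \<in> schroedinger_dom h V \<and> _\<close> by (auto simp: schroedinger_dom_def L2_def)
  \<comment> \<open>Rescaling turns E and V into E / h^2 and V / h^2, so the ratio of ||V||_1 to the
    root of the energy becomes ||V||_1 / (h q), which A majorises.\<close>
  define A where "A = M / (h * q)"
  define K where "K = apriori_const A * (LINT x|lebesgue. cmod (f x)) / (h * q)"
  have uK: "cmod (u x) \<le> K" for x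
  proof -
    have N: "(LINT x|lborel. \<bar>?V x\<bar>) / sqrt (E / h\<^sup>2) \<le> A"
    proof -
      have "(LINT x|lborel. \<bar>V0 x\<bar>) = (LINT x|lebesgue. \<bar>V x\<bar>)"
        by (rule integrable_lebesgue_cong(2)[symmetric]) (use Vm V0 in auto)
      also have "\<dots> \<le> M" unfolding M_def using assms by (intro integral_mono_AE) auto
      finally have "(LINT x|lborel. \<bar>V0 x\<bar>) / h\<^sup>2 / (q / h) \<le> M / h\<^sup>2 / (q / h)"
        using q assms(6) by (intro divide_right_mono) auto
      moreover have "sqrt (E / h\<^sup>2) = q / h" using assms(6) by (simp add: q_def real_sqrt_divide)
      moreover have "M / h\<^sup>2 / (q / h) = A" using assms(6) q by (simp add: A_def power2_eq_square)
      ultimately show ?thesis by (simp add: abs_divide)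
    qed
    have F: "(LINT x|lborel. cmod (?f x)) = (LINT x|lebesgue. cmod (f x)) / h\<^sup>2"
    proof -
      have "(LINT x|lebesgue. cmod (f x)) = (LINT x|lborel. cmod (f0 x))"
        by (rule integrable_lebesgue_cong(2)) (use fm f0 in auto)
      then show ?thesis by (simp add: norm_divide norm_power)
    qed
    have "sqrt (E / h\<^sup>2) * cmod (u x) \<le> apriori_const ((LINT x|lborel. \<bar>?V x\<bar>) / sqrt (E / h\<^sup>2)) * (LINT x|lborel. cmod (?f x))"
      by (rule apriori[OF wneg w2' \<epsilon>' u Vi fi])
    also have "\<dots> \<le> apriori_const A * ((LINT x|lebesgue. cmod (f x)) / h\<^sup>2)"
      unfolding F using N by (intro mult_right_mono apriori_const_mono) auto
    finally have "q / h * cmod (u x) \<le> apriori_const A * ((LINT x|lebesgue. cmod (f x)) / h\<^sup>2)"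
      using assms(6) by (simp add: q_def real_sqrt_divide)
    moreover have "0 < q / h" using q assms(6) by simp
    ultimately have "cmod (u x) \<le> apriori_const A * ((LINT x|lebesgue. cmod (f x)) / h\<^sup>2) / (q / h)"
      by (simp only: pos_le_divide_eq mult.commute[of "cmod (u x)"])
    then show ?thesis using q assms(6) by (simp add: K_def power2_eq_square)
  qed
  have K0: "0 \<le> K" using uK[of 0] norm_ge_zero order_trans by blast
  let ?T = "sqrt_mult m R"
  have Tm: "?T \<in> borel_measurable lebesgue" unfolding sqrt_mult_def using mm Rm by measurable
  have Tle: "AE x in lebesgue. (cmod (?T x))\<^sup>2 \<le> \<bar>m x\<bar> * K\<^sup>2"
    using AE_completion[OF Ru]
    by eventually_elim (simp add: sqrt_mult_def abs_sqrt power_mult_distrib mult_left_mono power_mono uK)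
  have Ti: "integrable lebesgue (\<lambda>x. (cmod (?T x))\<^sup>2)"
  proof (rule Bochner_Integration.integrable_bound)
    show "integrable lebesgue (\<lambda>x. \<bar>m x\<bar> * K\<^sup>2)" using assms(2) by simp
    show "AE x in lebesgue. norm ((cmod (?T x))\<^sup>2) \<le> norm (\<bar>m x\<bar> * K\<^sup>2)" using Tle by eventually_elim simp
  qed (use Tm in measurable)
  have "(LINT x|lebesgue. (cmod (?T x))\<^sup>2) \<le> (LINT x|lebesgue. \<bar>m x\<bar> * K\<^sup>2)"
    using Ti assms(2) Tle by (intro integral_mono_AE) auto
  also have "\<dots> = M * K\<^sup>2" by (simp add: Mabs)
  finally have "L2_norm ?T \<le> sqrt M * K"
    unfolding L2_norm_def using K0 by (simp add: real_le_lsqrt power_mult_distrib M0)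
  \<comment> \<open>One sqrt(M) comes from the outer weight acting on a bounded function, the other
    from Cauchy-Schwarz on the inner weight. Their product over h q is the factor A that
    \<open>mult_apriori_const_le\<close> asks for.\<close>
  also have "\<dots> \<le> sqrt M * (apriori_const A * (sqrt M * L2_norm v) / (h * q))"
    unfolding K_def using f1n apriori_const_pos[of A] q assms(6) M0
    by (intro mult_left_mono divide_right_mono) auto
  also have "\<dots> = A * apriori_const A * L2_norm v"
    using M0 by (simp add: A_def)
  also have "\<dots> \<le> exp (2 * A) * L2_norm v"
    by (intro mult_right_mono mult_apriori_const_le) (simp add: L2_norm_def)
  also have "2 * A = 2 * E powr (-1/2) * M / h"
    using E by (simp add: A_def q_def powr_minus_divide powr_half_sqrt)
  finally have "L2_norm ?T \<le> exp (2 * E powr (-1/2) * M / h) * L2_norm v" .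
  moreover have "?T \<in> L2" using Tm Ti by (simp add: L2_def)
  ultimately show "sqrt_mult m (resolvent h V (complex_of_real E + \<i> * complex_of_real \<epsilon>) (sqrt_mult m v)) \<in> L2 \<and>
      L2_norm (sqrt_mult m (resolvent h V (complex_of_real E + \<i> * complex_of_real \<epsilon>) (sqrt_mult m v)))
      \<le> exp (2 * E powr (-1/2) * (LINT x|lebesgue. m x) / h) * L2_norm v"
    unfolding R_def f_def z_def M_def by blast
qed

end
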